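(* Let $h\in\mathcal{M}$ be such that $h\ge 0$ and $\log(h)$ exists. Then $$\exp\bigl(\tau(\log(h))\bigr)\ \ge\ \inf\left\{\tau\bigl(h\,e^{\operatorname{Re} f}\bigr):\ f\in\mathcal{M},\ \tau(f)=0\right\}.$$
   Context: $\mathcal{M}$ is a von Neumann algebra on a Hilbert space with unit $I$ and a faithful normal finite trace $\tau$, normalized by $\tau(I)=1$. For $f\in\mathcal{M}$, $\operatorname{Re} f=\frac12(f+f^* )$ is the real part of $f$. Here $\log(h)$ and $e^{\operatorname{Re} f}$ are understood in the sense of functional calculus for self-adjoint operators. *)

theory Defs
  imports "HOL-Analysis.Analysis"
begin

text \<open>Complex Hilbert spaces, with the inner product antilinear in the first argument.\<close>

class complex_hilbert = banach +
  fixes scaleC :: "complex \<Rightarrow> 'a \<Rightarrow> 'a" (infixr "*\<^sub>C" 75)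
    and cinner :: "'a \<Rightarrow> 'a \<Rightarrow> complex"
  assumes scaleC_add_right: "c *\<^sub>C (x + y) = c *\<^sub>C x + c *\<^sub>C y"
    and scaleC_add_left: "(c + d) *\<^sub>C x = c *\<^sub>C x + d *\<^sub>C x"
    and scaleC_scaleC: "c *\<^sub>C d *\<^sub>C x = (c * d) *\<^sub>C x"
    and scaleC_of_real: "complex_of_real r *\<^sub>C x = r *\<^sub>R x"
    and cinner_commute: "cinner x y = cnj (cinner y x)"
    and cinner_add_right: "cinner x (y + z) = cinner x y + cinner x z"
    and cinner_scaleC_right: "cinner x (c *\<^sub>C y) = c * cinner x y"
    and cinner_self: "cinner x x = complex_of_real ((norm x)\<^sup>2)"


subsection \<open>Bounded operators\<close>

text \<open>Bounded operators on the complex Hilbert space are the complex-linear elements of the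
  library's type of (real-linear) bounded operators.\<close>

definition bounded_ops :: "('a::complex_hilbert \<Rightarrow>\<^sub>L 'a) set" where
  "bounded_ops = {A. \<forall>c x. blinfun_apply A (c *\<^sub>C x) = c *\<^sub>C blinfun_apply A x}"

definition scaleC_op :: "complex \<Rightarrow> ('a::complex_hilbert \<Rightarrow>\<^sub>L 'a) \<Rightarrow> ('a \<Rightarrow>\<^sub>L 'a)" where
  "scaleC_op c A = Blinfun (\<lambda>x. c *\<^sub>C blinfun_apply A x)"

definition adj :: "('a::complex_hilbert \<Rightarrow>\<^sub>L 'a) \<Rightarrow> ('a \<Rightarrow>\<^sub>L 'a)" where
  "adj A = (THE B. \<forall>x y. cinner (blinfun_apply B x) y = cinner x (blinfun_apply A y))"

definition re_op :: "('a::complex_hilbert \<Rightarrow>\<^sub>L 'a) \<Rightarrow> ('a \<Rightarrow>\<^sub>L 'a)" where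
  "re_op A = (1/2) *\<^sub>R (A + adj A)"

definition positive_op :: "('a::complex_hilbert \<Rightarrow>\<^sub>L 'a) \<Rightarrow> bool" where
  "positive_op A \<longleftrightarrow> A \<in> bounded_ops \<and>
     (\<forall>x. cinner x (blinfun_apply A x) \<in> \<real> \<and> 0 \<le> Re (cinner x (blinfun_apply A x)))"

definition op_le :: "('a::complex_hilbert \<Rightarrow>\<^sub>L 'a) \<Rightarrow> ('a \<Rightarrow>\<^sub>L 'a) \<Rightarrow> bool" where
  "op_le A B \<longleftrightarrow> positive_op (B - A)"


subsection \<open>Von Neumann algebras and traces\<close>

definition commutant :: "('a::complex_hilbert \<Rightarrow>\<^sub>L 'a) set \<Rightarrow> ('a \<Rightarrow>\<^sub>L 'a) set" where
  "commutant S = {B \<in> bounded_ops. \<forall>A\<in>S. A o\<^sub>L B = B o\<^sub>L A}"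

definition von_neumann_algebra :: "('a::complex_hilbert \<Rightarrow>\<^sub>L 'a) set \<Rightarrow> bool" where
  "von_neumann_algebra M \<longleftrightarrow>
     M \<subseteq> bounded_ops \<and> (\<forall>A\<in>M. adj A \<in> M) \<and> commutant (commutant M) = M"

text \<open>The trace is a function on all operators, but only its values on \<open>M\<close> matter.\<close>

definition finite_trace ::
    "('a::complex_hilbert \<Rightarrow>\<^sub>L 'a) set \<Rightarrow> (('a \<Rightarrow>\<^sub>L 'a) \<Rightarrow> complex) \<Rightarrow> bool" where
  "finite_trace M \<tau> \<longleftrightarrow>
     (\<forall>A\<in>M. \<forall>B\<in>M. \<tau> (A + B) = \<tau> A + \<tau> B) \<and>
     (\<forall>c. \<forall>A\<in>M. \<tau> (scaleC_op c A) = c * \<tau> A) \<and>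
     (\<forall>A\<in>M. positive_op A \<longrightarrow> \<tau> A \<in> \<real> \<and> 0 \<le> Re (\<tau> A)) \<and>
     (\<forall>A\<in>M. \<forall>B\<in>M. \<tau> (A o\<^sub>L B) = \<tau> (B o\<^sub>L A))"

definition faithful ::
    "('a::complex_hilbert \<Rightarrow>\<^sub>L 'a) set \<Rightarrow> (('a \<Rightarrow>\<^sub>L 'a) \<Rightarrow> complex) \<Rightarrow> bool" where
  "faithful M \<tau> \<longleftrightarrow> (\<forall>A\<in>M. positive_op A \<and> \<tau> A = 0 \<longrightarrow> A = 0)"

definition is_sup_in ::
    "('a::complex_hilbert \<Rightarrow>\<^sub>L 'a) set \<Rightarrow> ('a \<Rightarrow>\<^sub>L 'a) set \<Rightarrow> ('a \<Rightarrow>\<^sub>L 'a) \<Rightarrow> bool" where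
  "is_sup_in M D A \<longleftrightarrow> A \<in> M \<and> (\<forall>B\<in>D. op_le B A) \<and>
     (\<forall>C\<in>M. (\<forall>B\<in>D. op_le B C) \<longrightarrow> op_le A C)"

text \<open>Normality: the trace preserves suprema of bounded upward directed families of positive
  elements. The supremum on the right is a real one; the set is bounded above by \<open>Re (\<tau> A)\<close>.\<close>

definition normal_on ::
    "('a::complex_hilbert \<Rightarrow>\<^sub>L 'a) set \<Rightarrow> (('a \<Rightarrow>\<^sub>L 'a) \<Rightarrow> complex) \<Rightarrow> bool" where
  "normal_on M \<tau> \<longleftrightarrow>
     (\<forall>D A. D \<subseteq> M \<and> D \<noteq> {} \<and> (\<forall>B\<in>D. positive_op B) \<and>
        (\<forall>B\<in>D. \<forall>C\<in>D. \<exists>U\<in>D. op_le B U \<and> op_le C U) \<and> is_sup_in M D A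
        \<longrightarrow> Re (\<tau> A) = (SUP B\<in>D. Re (\<tau> B)))"


subsection \<open>Functional calculus for self-adjoint operators\<close>

definition pvm :: "(real set \<Rightarrow> ('a::complex_hilbert \<Rightarrow>\<^sub>L 'a)) \<Rightarrow> bool" where
  "pvm E \<longleftrightarrow>
     (\<forall>S\<in>sets borel. E S \<in> bounded_ops \<and> adj (E S) = E S) \<and>
     (\<forall>S\<in>sets borel. \<forall>T\<in>sets borel. E (S \<inter> T) = E S o\<^sub>L E T) \<and>
     E UNIV = id_blinfun \<and>
     (\<forall>X x. range X \<subseteq> sets borel \<and> disjoint_family X \<longrightarrow>
        (\<lambda>n::nat. blinfun_apply (E (X n)) x) sums blinfun_apply (E (\<Union>n. X n)) x)"

definition scalar_measure ::
    "(real set \<Rightarrow> ('a::complex_hilbert \<Rightarrow>\<^sub>L 'a)) \<Rightarrow> 'a \<Rightarrow> real measure" where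
  "scalar_measure E x =
     measure_of UNIV (sets borel) (\<lambda>S. ennreal (Re (cinner x (blinfun_apply (E S) x))))"

definition bounded_spectral_integral ::
    "(real set \<Rightarrow> ('a::complex_hilbert \<Rightarrow>\<^sub>L 'a)) \<Rightarrow> (real \<Rightarrow> real) \<Rightarrow> ('a \<Rightarrow>\<^sub>L 'a)" where
  "bounded_spectral_integral E g =
     (THE B. B \<in> bounded_ops \<and>
        (\<forall>x. cinner x (blinfun_apply B x) =
              complex_of_real (integral\<^sup>L (scalar_measure E x) g)))"

text \<open>A possibly unbounded operator is represented by its graph. The integral of a Borel function
  \<open>g\<close> has domain \<open>{x. \<integral> g\<^sup>2 dE\<^sub>x < \<infinity>}\<close>, on which it is the strong limit of the integrals of the
  truncations of \<open>g\<close>.\<close>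

definition graph_of :: "('a::complex_hilbert \<Rightarrow>\<^sub>L 'a) \<Rightarrow> ('a \<times> 'a) set" where
  "graph_of A = {(x, blinfun_apply A x) | x. True}"

definition spectral_integral ::
    "(real set \<Rightarrow> ('a::complex_hilbert \<Rightarrow>\<^sub>L 'a)) \<Rightarrow> (real \<Rightarrow> real) \<Rightarrow> ('a \<times> 'a) set" where
  "spectral_integral E g =
     {(x, y). integrable (scalar_measure E x) (\<lambda>t. (g t)\<^sup>2) \<and>
        (\<lambda>n. blinfun_apply
               (bounded_spectral_integral E (\<lambda>t. if \<bar>g t\<bar> \<le> real n then g t else 0)) x)
          \<longlonglongrightarrow> y}"

text \<open>By the spectral theorem every self-adjoint operator has a spectral measure, and its values on
  Borel sets are unique; the choice operator is only needed because the values on other sets are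
  unconstrained.\<close>

definition spectral_measure ::
    "('a \<times> 'a) set \<Rightarrow> (real set \<Rightarrow> ('a::complex_hilbert \<Rightarrow>\<^sub>L 'a))" where
  "spectral_measure T = (SOME E. pvm E \<and> T = spectral_integral E (\<lambda>t. t))"

definition fun_calc :: "(real \<Rightarrow> real) \<Rightarrow> ('a::complex_hilbert \<times> 'a) set \<Rightarrow> ('a \<times> 'a) set" where
  "fun_calc g T = spectral_integral (spectral_measure T) g"

definition exp_op :: "('a::complex_hilbert \<Rightarrow>\<^sub>L 'a) \<Rightarrow> ('a \<Rightarrow>\<^sub>L 'a)" where
  "exp_op A = (THE B. B \<in> bounded_ops \<and> graph_of B = fun_calc exp (graph_of A))"

text \<open>The logarithm of a positive operator is a self-adjoint, in general unbounded, operator. It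
  exists when the logarithm is defined almost everywhere with respect to the spectral measure,
  i.e. when that measure lives on the open half-line. The condition is needed explicitly because
  the library's \<open>ln\<close> is total.\<close>

definition log_exists :: "('a::complex_hilbert \<Rightarrow>\<^sub>L 'a) \<Rightarrow> bool" where
  "log_exists A \<longleftrightarrow> spectral_measure (graph_of A) {0<..} = id_blinfun"

definition log_op :: "('a::complex_hilbert \<Rightarrow>\<^sub>L 'a) \<Rightarrow> ('a \<times> 'a) set" where
  "log_op A = fun_calc ln (graph_of A)"


subsection \<open>The trace of a self-adjoint operator affiliated with the algebra\<close>

text \<open>The usual extension of the trace: \<open>\<integral> t d\<tau>(E\<^sub>T(t))\<close> for the spectral measure \<open>E\<^sub>T\<close> of \<open>T\<close>, which
  is the value of the trace at \<open>T\<close> if \<open>T\<close> is bounded. The integral is extended-real valued. For the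
  logarithm of a bounded positive operator the positive part is finite, so that the difference is
  never \<open>\<infinity> - \<infinity>\<close>, but the value may be \<open>-\<infinity>\<close>.\<close>

definition trace_measure ::
    "(('a::complex_hilbert \<Rightarrow>\<^sub>L 'a) \<Rightarrow> complex) \<Rightarrow> ('a \<times> 'a) set \<Rightarrow> real measure" where
  "trace_measure \<tau> T =
     measure_of UNIV (sets borel) (\<lambda>S. ennreal (Re (\<tau> (spectral_measure T S))))"

definition ext_trace ::
    "(('a::complex_hilbert \<Rightarrow>\<^sub>L 'a) \<Rightarrow> complex) \<Rightarrow> ('a \<times> 'a) set \<Rightarrow> ereal" where
  "ext_trace \<tau> T =
     enn2ereal (\<integral>\<^sup>+ t. ennreal t \<partial>trace_measure \<tau> T)
     - enn2ereal (\<integral>\<^sup>+ t. ennreal (- t) \<partial>trace_measure \<tau> T)"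

fun exp_ereal :: "ereal \<Rightarrow> ereal" where
  "exp_ereal (ereal r) = ereal (exp r)"
| "exp_ereal PInfty = \<infinity>"
| "exp_ereal MInfty = 0"

end

theory Submission
  imports Defs
begin

text \<open>Let \<open>\<nu>\<close> be the trace of the spectral measure of \<open>h\<close>, a probability measure on \<open>(0, \<parallel>h\<parallel>]\<close>. For \<open>\<epsilon> > 0\<close>
  put \<open>c = \<integral> ln (t + \<epsilon>) d\<nu>\<close> and \<open>f = c - log (h + \<epsilon>)\<close>, so that \<open>\<tau> f = 0\<close> and
  \<open>\<tau> (h e\<^sup>f) = e\<^sup>c \<integral> t / (t + \<epsilon>) d\<nu> \<le> e\<^sup>c\<close>; by monotone convergence \<open>c\<close> decreases to \<open>\<tau> (log h)\<close> as
  \<open>\<epsilon>\<close> tends to \<open>0\<close>. The spectral theorem needed here is obtained from sign projections: the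
  projections separating the parts of \<open>A\<close> below and above each real number form a right-continuous
  family, whose Stieltjes measures are the scalar spectral measures. Uniqueness of the spectral
  measure, also of the unbounded operator \<open>log h\<close>, holds because the ranges of the projections of
  closed intervals can be read off from the growth of iterates.\<close>


subsection \<open>The underlying real Hilbert space\<close>

text \<open>The logarithm of h may be unbounded and its trace -\<infinity>, whereas a competitor f
  must be a bounded element of M: hence the shift by \<epsilon>, which keeps the logarithm bounded
  on the spectrum of h at the cost of a factor t / (t + \<epsilon>) that is at most 1. A
  self-adjoint f makes Re f = f, so every operator involved is a function of h and the inequality
  becomes one between integrals over \<nu>. The weight lies in this reduction:
  \<open>exp_op\<close>, \<open>log_op\<close> and \<open>ext_trace\<close> refer to spectral
  measures taken by choice, those of f, h and log h respectively, and all three have to be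
  recognized as pushforwards of the one spectral measure of h; this is where uniqueness is needed.
  The constructions take place among real-linear operators, with the real part of the inner product.
  A commutation clause is carried along at each stage: whatever commutes with the given operator
  commutes with what is built from it. It yields complex linearity and, through the bicommutant,
  membership in M.\<close>

definition rinner :: "'a::complex_hilbert \<Rightarrow> 'a \<Rightarrow> real" where
  "rinner x y = Re (cinner x y)"

lemma cinner_add_left: "cinner (x + y) z = cinner x z + cinner y z"
  by (metis cinner_add_right cinner_commute complex_cnj_add)

lemma cinner_scaleC_left: "cinner (c *\<^sub>C x) y = cnj c * cinner x y"
  by (metis cinner_commute cinner_scaleC_right complex_cnj_mult)

lemma scaleC_ii_ii: "\<i> *\<^sub>C \<i> *\<^sub>C x = - x"
  using scaleC_of_real[of "-1" x] by (simp add: scaleC_scaleC)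

lemma rinner_commute: "rinner x y = rinner y x"
  unfolding rinner_def by (subst cinner_commute) simp

lemma rinner_add_right: "rinner x (y + z) = rinner x y + rinner x z"
  by (simp add: rinner_def cinner_add_right)

lemma rinner_add_left: "rinner (x + y) z = rinner x z + rinner y z"
  by (simp add: rinner_def cinner_add_left)

lemma rinner_scaleR_right: "rinner x (r *\<^sub>R y) = r * rinner x y"
  unfolding rinner_def scaleC_of_real[symmetric] cinner_scaleC_right by simp

lemma rinner_scaleR_left: "rinner (r *\<^sub>R x) y = r * rinner x y"
  using rinner_commute rinner_scaleR_right by metis

lemma rinner_self: "rinner x x = (norm x)\<^sup>2"
  by (simp add: rinner_def cinner_self)

lemma Im_cinner: "Im (cinner x y) = rinner (\<i> *\<^sub>C x) y"
  by (simp add: rinner_def cinner_scaleC_left)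

text \<open>Degenerate forms are allowed because the inequality serves twice: for
  \<open>rinner\<close> itself and for \<open>rinner x (A y)\<close> with a positive operator A,
  which may have a kernel.\<close>

lemma Cauchy_Schwarz_semidefinite:
  fixes b :: "'a::real_vector \<Rightarrow> 'a \<Rightarrow> real"
  assumes sym: "\<And>x y. b x y = b y x"
    and add: "\<And>x y z. b x (y + z) = b x y + b x z"
    and scale: "\<And>r x y. b x (r *\<^sub>R y) = r * b x y"
    and nonneg: "\<And>x. 0 \<le> b x x"
  shows "(b x y)\<^sup>2 \<le> b x x * b y y"
proof -
  have addl: "b (x + y) z = b x z + b y z" for x y z
    using sym add by metis
  have scalel: "b (r *\<^sub>R x) y = r * b x y" for r x y
    using sym scale by metis
  have quad: "0 \<le> b x x + 2 * t * b x y + t\<^sup>2 * b y y" for t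
    using nonneg[of "x + t *\<^sub>R y"] sym[of y x]
    by (simp add: add addl scale scalel power2_eq_square algebra_simps)
  show ?thesis
  proof (cases "b y y = 0")
    case True
    have "b x y = 0"
    proof (rule ccontr)
      assume "b x y \<noteq> 0"
      \<comment> \<open>With b y y = 0 the quadratic is affine in t, and this t gives it the value
        -1.\<close>
      then show False
        using quad[of "- (b x x + 1) / (2 * b x y)"] True by (simp add: field_simps)
    qed
    then show ?thesis using True by simp
  next
    case False
    then have pos: "b y y > 0" using nonneg[of y] by simp
    have "0 \<le> b x x - (b x y)\<^sup>2 / b y y"
      using quad[of "- b x y / b y y"] pos by (simp add: power2_eq_square field_simps)
    then show ?thesis using pos by (simp add: field_simps)
  qed
qed

lemma rinner_Cauchy_Schwarz: "\<bar>rinner x y\<bar> \<le> norm x * norm y"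
proof -
  have "(rinner x y)\<^sup>2 \<le> (norm x * norm y)\<^sup>2"
    using Cauchy_Schwarz_semidefinite[of rinner x y]
    by (auto simp: rinner_commute rinner_add_right rinner_scaleR_right rinner_self power_mult_distrib)
  then show ?thesis
    by (simp add: abs_le_square_iff[symmetric])
qed

lemma bounded_bilinear_rinner: "bounded_bilinear rinner"
  by (standard; (intro exI[of _ 1] allI)?)
    (auto simp: rinner_add_right rinner_add_left rinner_scaleR_right rinner_scaleR_left
      rinner_Cauchy_Schwarz)

interpretation rinner: bounded_bilinear rinner
  by (rule bounded_bilinear_rinner)

lemmas rinner_simps = rinner.add_left rinner.add_right rinner.diff_left rinner.diff_right
  rinner.minus_left rinner.minus_right rinner_scaleR_left rinner_scaleR_right
  rinner.zero_left rinner.zero_right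

lemma rinner_eqI: "x = y" if "\<And>z. rinner z x = rinner z y"
  using that[of "x - y"] rinner_self[of "x - y"] by (simp add: rinner_simps)

lemma norm_add_square: "(norm (x + y))\<^sup>2 = (norm x)\<^sup>2 + 2 * rinner x y + (norm y)\<^sup>2"
  unfolding rinner_self[symmetric] by (simp add: rinner_simps rinner_commute[of y x])

lemma parallelogram_rinner:
  fixes x y :: "'a::complex_hilbert"
  shows "(norm (x - y))\<^sup>2 = 2 * (norm x)\<^sup>2 + 2 * (norm y)\<^sup>2 - (norm (x + y))\<^sup>2"
  unfolding rinner_self[symmetric] by (simp add: rinner_simps)

text \<open>The representing vector is the minimum point of \<open>\<parallel>z\<parallel>\<^sup>2 / 2 - f z\<close>.\<close>

lemma riesz_representation:
  fixes f :: "'a::complex_hilbert \<Rightarrow> real"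
  assumes "bounded_linear f"
  shows "\<exists>z. \<forall>x. f x = rinner z x"
proof -
  interpret f: bounded_linear f by fact
  obtain K where K: "K > 0" "\<And>x. norm (f x) \<le> norm x * K"
    using f.pos_bounded by blast
  define J where "J z = (norm z)\<^sup>2 / 2 - f z" for z
  have J_ge: "- K\<^sup>2 / 2 \<le> J z" for z
  proof -
    have "f z \<le> norm z * K" using K(2)[of z] by simp
    then have "(norm z)\<^sup>2 - 2 * (norm z * K) \<le> (norm z)\<^sup>2 - 2 * f z"
      by simp
    moreover have "(norm z)\<^sup>2 - 2 * (norm z * K) = (norm z - K)\<^sup>2 - K\<^sup>2"
      by (simp add: power2_eq_square algebra_simps)
    moreover have "(norm z - K)\<^sup>2 \<ge> 0" by simp
    ultimately show ?thesis unfolding J_def by linarith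
  qed
  then have bdd: "bdd_below (range J)" by (intro bdd_belowI2)
  define m where "m = Inf (range J)"
  have m_le: "m \<le> J z" for z
    unfolding m_def using bdd by (intro cInf_lower) auto
  have "\<exists>z. J z < m + inverse (real (Suc n))" for n
  proof -
    have "Inf (range J) < m + inverse (real (Suc n))"
      by (simp add: m_def)
    then show ?thesis
      using cInf_less_iff[OF _ bdd] by blast
  qed
  then obtain u where u: "\<And>n. J (u n) < m + inverse (real (Suc n))" by metis
  \<comment> \<open>The midpoint of x and y cannot push J below m, so the parallelogram law forces
    two near-minimizers to be close to each other.\<close>
  have dist: "(norm (x - y))\<^sup>2 \<le> 4 * (J x - m) + 4 * (J y - m)" for x y
  proof -
    have "J ((1/2) *\<^sub>R (x + y)) = (norm (x + y))\<^sup>2 / 8 - (f x + f y) / 2"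
      by (simp add: J_def f.scale f.add power_divide)
    moreover have "(norm (x - y))\<^sup>2 = 4 * J x + 4 * J y - 8 * ((norm (x + y))\<^sup>2 / 8 - (f x + f y) / 2)"
      unfolding parallelogram_rinner J_def by (simp add: field_simps)
    ultimately show ?thesis using m_le[of "(1/2) *\<^sub>R (x + y)"] by argo
  qed
  have "Cauchy u"
  proof (rule CauchyI)
    fix e :: real assume "e > 0"
    then obtain N where N: "inverse (real (Suc N)) < e\<^sup>2 / 8"
      using reals_Archimedean[of "e\<^sup>2 / 8"] by auto
    have "norm (u i - u j) < e" if "i \<ge> N" "j \<ge> N" for i j
    proof -
      have "inverse (real (Suc i)) \<le> inverse (real (Suc N))"
        "inverse (real (Suc j)) \<le> inverse (real (Suc N))" using that by simp_all
      then have "(norm (u i - u j))\<^sup>2 < e\<^sup>2"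
        using dist[of "u i" "u j"] u[of i] u[of j] N by argo
      then show ?thesis using \<open>e > 0\<close> by (simp add: power_less_imp_less_base)
    qed
    then show "\<exists>M. \<forall>i\<ge>M. \<forall>j\<ge>M. norm (u i - u j) < e" by blast
  qed
  then obtain z where z: "u \<longlonglongrightarrow> z"
    using Cauchy_convergent_iff convergent_def by blast
  have "(\<lambda>n. J (u n)) \<longlonglongrightarrow> J z"
    unfolding J_def by (intro tendsto_intros z f.tendsto) auto
  moreover have "(\<lambda>n. m + inverse (real (Suc n))) \<longlonglongrightarrow> m + 0"
    by (intro tendsto_intros LIMSEQ_inverse_real_of_nat)
  ultimately have "J z \<le> m"
    using u by (intro LIMSEQ_le[of "\<lambda>n. J (u n)"]) (auto intro: less_imp_le)
  then have min: "J z \<le> J x" for x using m_le[of x] by simp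
  have "f x = rinner z x" for x
  proof -
    have quad: "0 \<le> t * (rinner z x - f x) + t\<^sup>2 * ((norm x)\<^sup>2 / 2)" for t
      using min[of "z + t *\<^sub>R x"]
      unfolding J_def norm_add_square f.add f.scale
      by (simp add: rinner_simps power_mult_distrib algebra_simps)
    define d where "d = rinner z x - f x"
    define q where "q = (norm x)\<^sup>2 / 2"
    have "q \<ge> 0" by (simp add: q_def)
    \<comment> \<open>At this t the quadratic t d + t^2 q equals -d^2 / (q + 1)^2. The summand 1
      keeps the denominator nonzero when x = 0.\<close>
    have "0 \<le> (- d / (q + 1)) * d + (- d / (q + 1))\<^sup>2 * q"
      using quad[of "- d / (q + 1)"] unfolding d_def q_def .
    also have "\<dots> = - (d\<^sup>2) / (q + 1)\<^sup>2"
    proof -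
      have "q + 1 \<noteq> 0" using \<open>q \<ge> 0\<close> by simp
      then show ?thesis by (simp add: power2_eq_square divide_simps) algebra
    qed
    finally have "d\<^sup>2 \<le> 0" using \<open>q \<ge> 0\<close> by (simp add: divide_simps)
    then show ?thesis by (simp add: d_def)
  qed
  then show ?thesis by blast
qed

lemma adjoint_exists:
  fixes A :: "'a::complex_hilbert \<Rightarrow>\<^sub>L 'a"
  shows "\<exists>B::'a \<Rightarrow>\<^sub>L 'a. \<forall>x y. rinner (B x) y = rinner x (A y)"
proof -
  have "bounded_linear (\<lambda>y. rinner x (A y))" for x
    by (intro rinner.bounded_linear_right bounded_linear_compose[OF rinner.bounded_linear_right]
      blinfun.bounded_linear_right)
  then have "\<exists>z. \<forall>y. rinner x (A y) = rinner z y" for x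
    by (rule riesz_representation)
  then obtain b where b: "\<And>x y. rinner x (A y) = rinner (b x) y" by metis
  have "bounded_linear b"
  proof (rule bounded_linear_intro)
    show "b (x + y) = b x + b y" for x y
      by (rule rinner_eqI) (simp add: rinner_simps rinner_commute[of _ "b _"] b[symmetric])
    show "b (r *\<^sub>R x) = r *\<^sub>R b x" for r x
      by (rule rinner_eqI) (simp add: rinner_simps rinner_commute[of _ "b _"] b[symmetric])
    show "norm (b x) \<le> norm x * norm A" for x
    proof (cases "b x = 0")
      case False
      have "(norm (b x))\<^sup>2 \<le> norm x * (norm A * norm (b x))"
        using rinner_Cauchy_Schwarz[of x "A (b x)"] norm_blinfun[of A "b x"]
        unfolding rinner_self[symmetric] b[symmetric]
        by (meson abs_le_D1 mult_left_mono norm_ge_zero order_trans)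
      then show ?thesis using False by (simp add: power2_eq_square mult.assoc)
    qed simp
  qed
  then show ?thesis
    using b by (intro exI[of _ "Blinfun b"]) (simp add: bounded_linear_Blinfun_apply)
qed


subsection \<open>Symmetric and positive operators\<close>

definition symop :: "('a::complex_hilbert \<Rightarrow>\<^sub>L 'a) \<Rightarrow> bool" where
  "symop A \<longleftrightarrow> (\<forall>x y. rinner (A x) y = rinner x (A y))"

definition posop :: "('a::complex_hilbert \<Rightarrow>\<^sub>L 'a) \<Rightarrow> bool" where
  "posop A \<longleftrightarrow> symop A \<and> (\<forall>x. 0 \<le> rinner x (A x))"

lemma symopD: "symop A \<Longrightarrow> rinner (A x) y = rinner x (A y)"
  by (simp add: symop_def)

lemma posopD: "posop A \<Longrightarrow> symop A" "posop A \<Longrightarrow> 0 \<le> rinner x (A x)"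
  by (simp_all add: posop_def)

text \<open>The imaginary part of \<open>cinner u v\<close> is, up to sign, the real part with \<i>
  moved onto v, and A commutes with \<i>; so the real adjoint relation already contains the complex
  one.\<close>

lemma cinner_eq_iff_rinner:
  fixes A B :: "'a::complex_hilbert \<Rightarrow>\<^sub>L 'a"
  assumes "\<And>x y. rinner (B x) y = rinner x (A y)" and "A \<in> bounded_ops"
  shows "cinner (B x) y = cinner x (A y)"
proof (rule complex_eqI)
  show "Re (cinner (B x) y) = Re (cinner x (A y))"
    using assms(1) by (simp add: rinner_def)
  have im: "Im (cinner u v) = - rinner u (\<i> *\<^sub>C v)" for u v :: 'a
    by (simp add: rinner_def cinner_scaleC_right)
  show "Im (cinner (B x) y) = Im (cinner x (A y))"
    unfolding im assms(1) using assms(2) by (simp add: bounded_ops_def)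
qed

lemma cinner_eqI: "x = y" if "\<And>z. cinner z x = cinner z y"
  by (rule rinner_eqI) (simp add: rinner_def that)

lemma adj_unique:
  fixes A B :: "'a::complex_hilbert \<Rightarrow>\<^sub>L 'a"
  assumes "\<And>x y. cinner (B x) y = cinner x (A y)"
  shows "adj A = B"
  unfolding adj_def
proof (rule the_equality)
  fix B' :: "'a \<Rightarrow>\<^sub>L 'a" assume *: "\<forall>x y. cinner (B' x) y = cinner x (A y)"
  show "B' = B"
  proof (rule blinfun_eqI, rule cinner_eqI)
    show "cinner z (B' x) = cinner z (B x)" for z x
      by (metis * assms cinner_commute)
  qed
qed (use assms in blast)

text \<open>\<open>adj\<close> is a definite description, so the forward direction has to produce an
  actual adjoint by the Riesz theorem before the value of \<open>adj A\<close> can be used.\<close>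

lemma adj_eq_iff_symop:
  assumes "A \<in> bounded_ops"
  shows "adj A = A \<longleftrightarrow> symop A"
proof
  assume "symop A"
  then show "adj A = A"
    using assms by (intro adj_unique cinner_eq_iff_rinner) (auto simp: symop_def)
next
  assume *: "adj A = A"
  obtain B where B: "\<And>x y. rinner (blinfun_apply B x) y = rinner x (A y)"
    using adjoint_exists by blast
  then have "adj A = B"
    by (intro adj_unique cinner_eq_iff_rinner assms) auto
  then show "symop A" using * B by (simp add: symop_def)
qed

lemma bounded_ops_real_form:
  assumes "A \<in> bounded_ops"
  shows "symop A \<longleftrightarrow> (\<forall>x. cinner x (blinfun_apply A x) \<in> \<real>)"
proof
  assume A: "symop A"
  show "\<forall>x. cinner x (A x) \<in> \<real>"
  proof
    fix x
    have "cinner (A x) x = cinner x (A x)"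
      using A assms by (intro cinner_eq_iff_rinner) (auto simp: symop_def)
    then have "cnj (cinner x (A x)) = cinner x (A x)"
      by (subst cinner_commute) simp
    then show "cinner x (A x) \<in> \<real>" by (simp add: complex_is_Real_iff complex_eq_iff)
  qed
next
  assume real: "\<forall>x. cinner x (A x) \<in> \<real>"
  have z: "rinner (\<i> *\<^sub>C x) (A x) = 0" for x
    using real by (simp add: Im_cinner[symmetric] complex_is_Real_iff)
  have scaleA: "A (c *\<^sub>C x) = c *\<^sub>C A x" for c x
    using assms by (simp add: bounded_ops_def)
  have iso: "rinner (\<i> *\<^sub>C u) (\<i> *\<^sub>C v) = rinner u v" for u v :: 'a
    by (simp add: rinner_def cinner_scaleC_left cinner_scaleC_right)
  have "rinner (A x) y = rinner x (A y)" for x y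
  proof -
    \<comment> \<open>Complex polarization: the form \<open>rinner (\<i> *\<^sub>C u) (A u)\<close>
      vanishes identically, so at the sum of \<i> x and y only the two cross terms survive, and they
      are the two sides of symmetry.\<close>
    have "rinner (\<i> *\<^sub>C (\<i> *\<^sub>C x + y)) (A (\<i> *\<^sub>C x + y)) = 0" by (rule z)
    then have "rinner (\<i> *\<^sub>C y) (A (\<i> *\<^sub>C x)) + rinner (\<i> *\<^sub>C \<i> *\<^sub>C x) (A y) = 0"
      using z[of "\<i> *\<^sub>C x"] z[of y]
      by (simp add: rinner_simps blinfun.add_right scaleC_add_right)
    then show ?thesis
      unfolding scaleA iso scaleC_ii_ii by (simp add: rinner_simps rinner_commute)
  qed
  then show "symop A" by (simp add: symop_def)
qed

lemma positive_op_iff: "positive_op A \<longleftrightarrow> A \<in> bounded_ops \<and> posop A"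
  unfolding positive_op_def posop_def using bounded_ops_real_form[of A]
  by (auto simp: rinner_def)

lemma symop_0: "symop 0" and symop_id: "symop id_blinfun"
  by (simp_all add: symop_def rinner_simps)

lemma symop_add: "symop A \<Longrightarrow> symop B \<Longrightarrow> symop (A + B)"
  and symop_diff: "symop A \<Longrightarrow> symop B \<Longrightarrow> symop (A - B)"
  and symop_scaleR: "symop A \<Longrightarrow> symop (r *\<^sub>R A)"
  by (simp_all add: symop_def rinner_simps blinfun.add_left blinfun.diff_left blinfun.scaleR_left)

lemma symop_limit:
  fixes B :: "'a::complex_hilbert \<Rightarrow>\<^sub>L 'a"
  assumes "\<And>n. symop (A n)" and "\<And>x. (\<lambda>n. blinfun_apply (A n) x) \<longlonglongrightarrow> B x"
  shows "symop B"
  unfolding symop_def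
proof (intro allI)
  fix x y
  have "(\<lambda>n. rinner (A n x) y) \<longlonglongrightarrow> rinner (B x) y"
    by (intro rinner.tendsto assms tendsto_const)
  moreover have "(\<lambda>n. rinner x (A n y)) \<longlonglongrightarrow> rinner x (B y)"
    by (intro rinner.tendsto assms tendsto_const)
  ultimately show "rinner (B x) y = rinner x (B y)"
    using assms(1) by (auto simp: symop_def intro: LIMSEQ_unique)
qed

lemmas blin_simps = blinfun.add_left blinfun.diff_left blinfun.scaleR_left blinfun.minus_left
  blinfun.add_right blinfun.diff_right blinfun.scaleR_right blinfun.minus_right
  blinfun.zero_left blinfun.zero_right

lemma symop_quadratic_polar:
  assumes "symop A"
  shows "4 * rinner x (A y) = rinner (x + y) (A (x + y)) - rinner (x - y) (A (x - y))"
  using symopD[OF assms, of x y] by (simp add: blin_simps rinner_simps rinner_commute)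

lemma symop_eqI:
  assumes "symop A" "symop B" "\<And>x. rinner x (blinfun_apply A x) = rinner x (blinfun_apply B x)"
  shows "A = B"
proof (rule blinfun_eqI, rule rinner_eqI)
  fix x z
  show "rinner z (A x) = rinner z (B x)"
    using symop_quadratic_polar[OF assms(1), of z x] symop_quadratic_polar[OF assms(2), of z x]
      assms(3) by simp
qed

lemma posop_Cauchy_Schwarz:
  assumes "posop A"
  shows "(rinner x (A y))\<^sup>2 \<le> rinner x (A x) * rinner y (A y)"
  by (rule Cauchy_Schwarz_semidefinite[of "\<lambda>x y. rinner x (A y)"])
    (use assms symopD[OF posopD(1)[OF assms]] in
      \<open>auto simp: rinner_simps blin_simps posopD rinner_commute\<close>)

text \<open>Cauchy-Schwarz for the form of A, applied to x and A x. It turns smallness of the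
  quadratic form into smallness of the vector A x, which is how convergence of quadratic forms
  becomes strong convergence.\<close>

lemma posop_norm_square_le:
  assumes "posop A"
  shows "(norm (A x))\<^sup>2 \<le> norm A * rinner x (A x)"
proof (cases "A x = 0")
  case True
  then show ?thesis by (simp add: rinner.zero_right)
next
  case False
  have "((norm (A x))\<^sup>2)\<^sup>2 = (rinner x (A (A x)))\<^sup>2"
    using symopD[OF posopD(1)[OF assms], of x "A x"] by (simp add: rinner_self)
  also have "\<dots> \<le> rinner x (A x) * rinner (A x) (A (A x))"
    by (rule posop_Cauchy_Schwarz[OF assms])
  also have "\<dots> \<le> rinner x (A x) * (norm A * (norm (A x))\<^sup>2)"
  proof (rule mult_left_mono[OF _ posopD(2)[OF assms]])
    have "rinner (A x) (A (A x)) \<le> norm (A x) * norm (A (A x))"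
      using rinner_Cauchy_Schwarz abs_le_D1 by blast
    also have "\<dots> \<le> norm (A x) * (norm A * norm (A x))"
      by (intro mult_left_mono norm_blinfun) simp
    finally show "rinner (A x) (A (A x)) \<le> norm A * (norm (A x))\<^sup>2"
      by (simp add: power2_eq_square ac_simps)
  qed
  finally have "(norm (A x))\<^sup>2 * (norm (A x))\<^sup>2 \<le> (norm A * rinner x (A x)) * (norm (A x))\<^sup>2"
    by (simp add: power2_eq_square ac_simps)
  then show ?thesis using False by (simp only: mult_le_cancel_right) simp
qed

lemma posop_norm_le:
  assumes "posop A" "\<And>x. rinner x (blinfun_apply A x) \<le> c * (norm x)\<^sup>2" "0 \<le> c"
  shows "norm A \<le> c"
proof (cases "norm A = 0")
  case False
  have "norm A \<le> sqrt (norm A * c)"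
  proof (rule norm_blinfun_bound)
    fix x
    have "(norm (A x))\<^sup>2 \<le> norm A * (c * (norm x)\<^sup>2)"
      using posop_norm_square_le[OF assms(1), of x] assms(2)[of x]
      by (meson mult_left_mono norm_ge_zero order_trans)
    then have "sqrt ((norm (A x))\<^sup>2) \<le> sqrt (norm A * c * (norm x)\<^sup>2)"
      by (intro real_sqrt_le_mono) (simp add: ac_simps)
    then show "norm (A x) \<le> sqrt (norm A * c) * norm x"
      by (simp add: real_sqrt_mult)
  qed (use assms in simp)
  then have "(norm A)\<^sup>2 \<le> norm A * c"
    using sqrt_ge_absD by fastforce
  then show ?thesis using False by (simp add: power2_eq_square)
qed (use assms in simp)

lemma rinner_blinfun_le: "\<bar>rinner x (blinfun_apply A x)\<bar> \<le> norm A * (norm x)\<^sup>2"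
proof -
  have "\<bar>rinner x (A x)\<bar> \<le> norm x * norm (A x)" by (rule rinner_Cauchy_Schwarz)
  also have "\<dots> \<le> norm x * (norm A * norm x)"
    by (intro mult_left_mono norm_blinfun) simp
  finally show ?thesis by (simp add: power2_eq_square ac_simps)
qed

section \<open>Strong limits of bounded sequences of operators\<close>

lemma strong_limit_exists:
  fixes A :: "nat \<Rightarrow> ('a::complex_hilbert \<Rightarrow>\<^sub>L 'a)"
  assumes "\<And>x. convergent (\<lambda>n. A n x)" and bound: "\<And>n. norm (A n) \<le> C"
  obtains B :: "'a \<Rightarrow>\<^sub>L 'a" where "\<And>x. (\<lambda>n. A n x) \<longlonglongrightarrow> B x" "norm B \<le> C"
proof -
  define b where "b x = lim (\<lambda>n. A n x)" for x
  have b: "(\<lambda>n. A n x) \<longlonglongrightarrow> b x" for x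
    unfolding b_def using assms(1) by (simp add: convergent_LIMSEQ_iff)
  have nb: "norm (b x) \<le> C * norm x" for x
  proof (rule LIMSEQ_le_const2[OF tendsto_norm[OF b]])
    have "norm (A n x) \<le> C * norm x" for n
      using norm_blinfun[of "A n" x] bound[of n] by (meson mult_right_mono norm_ge_zero order_trans)
    then show "\<exists>N. \<forall>n\<ge>N. norm (A n x) \<le> C * norm x" by blast
  qed
  have "bounded_linear b"
  proof (rule bounded_linear_intro)
    show "b (x + y) = b x + b y" for x y
      using tendsto_add[OF b[of x] b[of y]] b[of "x + y"]
      by (auto simp: blin_simps intro: LIMSEQ_unique)
    show "b (r *\<^sub>R x) = r *\<^sub>R b x" for r x
      using tendsto_scaleR[OF tendsto_const b[of x]] b[of "r *\<^sub>R x"]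
      by (auto simp: blin_simps intro: LIMSEQ_unique)
    show "norm (b x) \<le> norm x * C" for x using nb[of x] by (simp add: mult.commute)
  qed
  then have *: "blinfun_apply (Blinfun b) = b" by (rule bounded_linear_Blinfun_apply)
  have "0 \<le> C" using bound[of 0] norm_ge_zero order_trans by blast
  then have "norm (Blinfun b) \<le> C" by (intro norm_blinfun_bound) (simp_all add: * nb)
  then show thesis using that[of "Blinfun b"] b by (simp add: *)
qed

text \<open>At each x the numbers \<open>rinner x (A n x)\<close> increase and are bounded, hence
  form a Cauchy sequence. A difference of two members is positive with norm at most 2 C, so
  \<open>posop_norm_square_le\<close> transfers the Cauchy property to the vectors A n x.\<close>

lemma monotone_strong_limit:
  fixes A :: "nat \<Rightarrow> ('a::complex_hilbert \<Rightarrow>\<^sub>L 'a)"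
  assumes sym: "\<And>n. symop (A n)" and bound: "\<And>n. norm (A n) \<le> C"
    and mono: "\<And>n x. rinner x (A n x) \<le> rinner x (A (Suc n) x)"
  obtains B :: "'a \<Rightarrow>\<^sub>L 'a" where "\<And>x. (\<lambda>n. A n x) \<longlonglongrightarrow> B x" "norm B \<le> C" "symop B"
proof -
  have "convergent (\<lambda>n. A n x)" for x
  proof -
    define a where "a n = rinner x (A n x)" for n
    have "incseq a" unfolding a_def by (rule incseq_SucI) (rule mono)
    moreover have "a n \<le> C * (norm x)\<^sup>2" for n
      unfolding a_def using rinner_blinfun_le[of x "A n"] bound[of n]
      by (meson abs_le_D1 mult_right_mono order_trans zero_le_power2)
    ultimately have "Cauchy a"
      using incseq_convergent[of a] LIMSEQ_imp_Cauchy by metis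
    have dist: "(norm (A m x - A n x))\<^sup>2 \<le> 2 * C * \<bar>a m - a n\<bar>" if "n \<le> m" for m n
    proof -
      have D: "posop (A m - A n)"
        unfolding posop_def
      proof (intro conjI allI symop_diff sym)
        fix y
        have "incseq (\<lambda>n. rinner y (A n y))" by (rule incseq_SucI) (rule mono)
        from incseqD[OF this that] show "0 \<le> rinner y ((A m - A n) y)"
          by (simp add: blin_simps rinner_simps)
      qed
      have "norm (A m - A n) \<le> 2 * C"
        using norm_triangle_ineq4[of "A m" "A n"] bound[of m] bound[of n] by linarith
      then have "(norm ((A m - A n) x))\<^sup>2 \<le> 2 * C * rinner x ((A m - A n) x)"
        using posop_norm_square_le[OF D, of x] posopD(2)[OF D, of x]
        by (meson mult_right_mono order_trans)
      also have "rinner x ((A m - A n) x) = a m - a n"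
        by (simp add: a_def blin_simps rinner_simps)
      also have "2 * C * (a m - a n) \<le> 2 * C * \<bar>a m - a n\<bar>"
        using bound[of 0] norm_ge_zero[of "A 0"] by (intro mult_left_mono) (auto simp del: norm_ge_zero)
      finally show ?thesis by (simp add: blin_simps)
    qed
    have dist': "(norm (A m x - A n x))\<^sup>2 \<le> 2 * C * \<bar>a m - a n\<bar>" for m n
    proof (cases "n \<le> m")
      case False
      then show ?thesis using dist[of m n] by (simp add: norm_minus_commute abs_minus_commute)
    qed (rule dist)
    have "Cauchy (\<lambda>n. A n x)"
    proof (rule CauchyI)
      fix e :: real assume "e > 0"
      have "0 \<le> C" using bound[of 0] norm_ge_zero[of "A 0"] by linarith
      then have "0 < e\<^sup>2 / (2 * C + 1)" using \<open>e > 0\<close> by simp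
      then obtain N where N: "\<And>m n. m \<ge> N \<Longrightarrow> n \<ge> N \<Longrightarrow> \<bar>a m - a n\<bar> < e\<^sup>2 / (2 * C + 1)"
        using CauchyD[OF \<open>Cauchy a\<close>] by (metis real_norm_def)
      have "norm (A m x - A n x) < e" if "m \<ge> N" "n \<ge> N" for m n
      proof -
        have "(2 * C + 1) * \<bar>a m - a n\<bar> < e\<^sup>2"
          using N[OF that] \<open>0 \<le> C\<close> by (simp add: field_simps)
        then have "(norm (A m x - A n x))\<^sup>2 < e\<^sup>2"
          using dist'[of m n] by (simp add: algebra_simps)
        then show ?thesis using \<open>e > 0\<close> by (simp add: power_less_imp_less_base)
      qed
      then show "\<exists>M. \<forall>m\<ge>M. \<forall>n\<ge>M. norm (A m x - A n x) < e" by blast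
    qed
    then show ?thesis by (simp add: Cauchy_convergent_iff)
  qed
  from strong_limit_exists[OF this bound] obtain B
    where "\<And>x. (\<lambda>n. A n x) \<longlonglongrightarrow> blinfun_apply B x" "norm B \<le> C" by blast
  with symop_limit[of A B, OF sym] show thesis by (intro that) auto
qed

lemma strong_limit_commute:
  assumes "\<And>x. (\<lambda>n. blinfun_apply (A n) x) \<longlonglongrightarrow> blinfun_apply B x" and "\<And>n. A n o\<^sub>L C = C o\<^sub>L A n"
  shows "B o\<^sub>L C = C o\<^sub>L B"
proof (rule blinfun_eqI)
  fix x
  have "(\<lambda>n. A n (C x)) \<longlonglongrightarrow> C (B x)"
    using blinfun.tendsto[OF tendsto_const assms(1)[of x], of C] assms(2)
    by (metis (no_types, lifting) blinfun_apply_blinfun_compose ext)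
  then show "(B o\<^sub>L C) x = (C o\<^sub>L B) x"
    using assms(1)[of "C x"] by (simp add: LIMSEQ_unique)
qed


subsection \<open>Square roots and sign projections\<close>

definition commutes :: "('a::complex_hilbert \<Rightarrow>\<^sub>L 'a) \<Rightarrow> ('a \<Rightarrow>\<^sub>L 'a) \<Rightarrow> bool" where
  "commutes A B \<longleftrightarrow> (\<forall>x. A (B x) = B (A x))"

lemma commutesD: "commutes A B \<Longrightarrow> blinfun_apply A (B x) = blinfun_apply B (A x)"
  by (simp add: commutes_def)

lemma commutes_sym: "commutes A B \<Longrightarrow> commutes B A"
  by (simp add: commutes_def)

lemma commutes_refl: "commutes A A"
  by (simp add: commutes_def)

lemma commutes_id: "commutes A id_blinfun"
  by (simp add: commutes_def)

lemma commutes_compose: "commutes A B \<Longrightarrow> commutes A C \<Longrightarrow> commutes A (B o\<^sub>L C)"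
  and commutes_add: "commutes A B \<Longrightarrow> commutes A C \<Longrightarrow> commutes A (B + C)"
  and commutes_diff: "commutes A B \<Longrightarrow> commutes A C \<Longrightarrow> commutes A (B - C)"
  and commutes_scaleR: "commutes A B \<Longrightarrow> commutes A (r *\<^sub>R B)"
  by (simp_all add: commutes_def blin_simps)

lemma commutes_limit:
  fixes B :: "'a::complex_hilbert \<Rightarrow>\<^sub>L 'a"
  assumes "\<And>x. (\<lambda>n. blinfun_apply (A n) x) \<longlonglongrightarrow> B x" and "\<And>n. commutes C (A n)"
  shows "commutes C B"
  using strong_limit_commute[of A B C] assms
  unfolding commutes_def by (metis blinfun_apply_blinfun_compose blinfun_eqI)

lemma symop_compose_commutes: "symop A \<Longrightarrow> symop B \<Longrightarrow> commutes A B \<Longrightarrow> symop (A o\<^sub>L B)"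
  by (simp add: symop_def commutes_def)

text \<open>Composition is not jointly continuous for strong convergence; the uniform norm bound
  repairs this. It is what allows passing to the limit in squares such as Y n (Y n x).\<close>

lemma strong_limit_apply:
  fixes B :: "'a::complex_hilbert \<Rightarrow>\<^sub>L 'a"
  assumes lim: "\<And>x. (\<lambda>n. blinfun_apply (A n) x) \<longlonglongrightarrow> B x"
    and bound: "\<And>n. norm (A n) \<le> C" and v: "v \<longlonglongrightarrow> w"
  shows "(\<lambda>n. blinfun_apply (A n) (v n)) \<longlonglongrightarrow> B w"
proof -
  have "(\<lambda>n. A n (v n - w)) \<longlonglongrightarrow> 0"
  proof (rule Lim_null_comparison)
    show "\<forall>\<^sub>F n in sequentially. norm (A n (v n - w)) \<le> C * norm (v n - w)"
      using bound by (intro always_eventually allI)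
        (meson mult_right_mono norm_blinfun norm_ge_zero order_trans)
    show "(\<lambda>n. C * norm (v n - w)) \<longlonglongrightarrow> 0"
      using v by (intro tendsto_mult_right_zero tendsto_norm_zero) (simp add: LIM_zero)
  qed
  from tendsto_add[OF this lim[of w]] show ?thesis by (simp add: blin_simps)
qed

text \<open>These are the polynomials in B with nonnegative coefficients. They are positive when B
  is, by an elementary induction; positivity of products of arbitrary commuting positive operators
  would require the square roots that are being constructed.\<close>

inductive power_cone :: "('a::complex_hilbert \<Rightarrow>\<^sub>L 'a) \<Rightarrow> ('a \<Rightarrow>\<^sub>L 'a) \<Rightarrow> bool" for B where
  one: "power_cone B id_blinfun"
| step: "power_cone B X \<Longrightarrow> power_cone B (B o\<^sub>L X)"
| add: "power_cone B X \<Longrightarrow> power_cone B Y \<Longrightarrow> power_cone B (X + Y)"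
| scale: "power_cone B X \<Longrightarrow> 0 \<le> r \<Longrightarrow> power_cone B (r *\<^sub>R X)"

lemma power_cone_zero: "power_cone B 0"
  using power_cone.scale[OF power_cone.one, of 0] by simp

lemma power_cone_self: "power_cone B B"
proof -
  have "B o\<^sub>L id_blinfun = B" by (rule blinfun_eqI) simp
  then show ?thesis using power_cone.step[OF power_cone.one, of B] by simp
qed

lemma power_cone_compose:
  assumes "power_cone B X" "power_cone B Y"
  shows "power_cone B (X o\<^sub>L Y)"
  using assms(1)
proof induction
  case one
  have "id_blinfun o\<^sub>L Y = Y" by (rule blinfun_eqI) simp
  then show ?case using assms(2) by simp
next
  case (step X)
  have "B o\<^sub>L X o\<^sub>L Y = B o\<^sub>L (X o\<^sub>L Y)" by (rule blinfun_eqI) simp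
  then show ?case using step power_cone.step by simp
next
  case (add X Z)
  have "(X + Z) o\<^sub>L Y = (X o\<^sub>L Y) + (Z o\<^sub>L Y)" by (rule blinfun_eqI) (simp add: blin_simps)
  then show ?case using add power_cone.add by simp
next
  case (scale X r)
  have "(r *\<^sub>R X) o\<^sub>L Y = r *\<^sub>R (X o\<^sub>L Y)" by (rule blinfun_eqI) (simp add: blin_simps)
  then show ?case using scale power_cone.scale by simp
qed

lemma power_cone_commutes: "power_cone B X \<Longrightarrow> commutes C B \<Longrightarrow> commutes C X"
  by (induction rule: power_cone.induct)
    (auto intro: commutes_id commutes_compose commutes_add commutes_scaleR)

lemma power_cone_symop: "power_cone B X \<Longrightarrow> symop B \<Longrightarrow> symop X"
  by (induction rule: power_cone.induct)
    (auto intro: symop_id symop_add symop_scaleR symop_compose_commutes power_cone_commutes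
      commutes_refl)

text \<open>The second conjunct strengthens the induction: \<open>B X\<close> is positive for odd powers because
  \<open>B B X = B X B\<close>.\<close>

lemma power_cone_nonneg:
  assumes "power_cone B X" "posop B"
  shows "0 \<le> rinner x (X x) \<and> 0 \<le> rinner x (B (X x))"
  using assms(1)
proof (induction arbitrary: x)
  case one
  then show ?case using posopD(2)[OF assms(2)] by (simp add: rinner_self)
next
  case (step X)
  have "rinner x (B (B (X x))) = rinner (B x) (X (B x))"
    using symopD[OF posopD(1)[OF assms(2)]] commutesD[OF power_cone_commutes[OF step.hyps commutes_refl]]
    by simp
  then show ?case using step.IH by simp
next
  case (add X Y)
  then show ?case by (simp add: blin_simps rinner_simps)
next
  case (scale X r)
  then show ?case by (simp add: blin_simps rinner_simps)
qed

text \<open>Writing A = 1 - B and looking for the root in the form 1 - Z leads to the equation 2 Z =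
  B + Z^2. Its iteration from 0 stays in the power cone of B with increments in that cone, so it
  increases, and its norms stay at most 1; the strong limit solves the equation.\<close>

lemma positive_sqrt_exists:
  fixes A :: "'a::complex_hilbert \<Rightarrow>\<^sub>L 'a"
  assumes A: "posop A" and le: "\<And>x. rinner x (A x) \<le> (norm x)\<^sup>2"
  obtains S where "posop S" "\<And>x. blinfun_apply S (S x) = A x"
    "\<And>C. commutes C A \<Longrightarrow> commutes C S"
proof -
  define B where "B = id_blinfun - A"
  have B: "posop B"
    using A le unfolding B_def posop_def
    by (auto intro!: symop_diff symop_id simp: blin_simps rinner_simps rinner_self)
  have "norm B \<le> 1"
    using posopD(2)[OF A]
    by (intro posop_norm_le[OF B]) (auto simp: B_def blin_simps rinner_simps rinner_self)
  define Y where "Y = rec_nat 0 (\<lambda>_ Y. (1/2) *\<^sub>R (B + (Y o\<^sub>L Y)))"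
  have Y0: "Y 0 = 0" and YS: "Y (Suc n) = (1/2) *\<^sub>R (B + (Y n o\<^sub>L Y n))" for n
    by (simp_all add: Y_def)
  have cone: "power_cone B (Y n)" for n
    by (induction n) (auto simp: Y0 YS intro!: power_cone_zero power_cone.scale power_cone.add
      power_cone_self power_cone_compose)
  have comm: "commutes (Y m) (Y n)" for m n
    using power_cone_commutes[OF cone power_cone_commutes[OF cone commutes_refl, THEN commutes_sym]] .
  have coneD: "power_cone B (Y (Suc n) - Y n)" for n
  proof (induction n)
    case 0
    then show ?case
      by (simp add: Y0 YS power_cone.scale power_cone_self)
  next
    case (Suc n)
    \<comment> \<open>A difference of squares: since the iterates commute, it factors into the
      previous increment and a sum, both in the cone.\<close>
    have "Y (Suc (Suc n)) - Y (Suc n) = (1/2) *\<^sub>R ((Y (Suc n) - Y n) o\<^sub>L (Y (Suc n) + Y n))"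
      unfolding YS[of "Suc n"] by (subst (3) YS, rule blinfun_eqI)
        (use comm[of n "Suc n"] in \<open>simp add: blin_simps commutes_def algebra_simps\<close>)
    then show ?case
      using Suc cone by (auto intro!: power_cone.scale power_cone_compose power_cone.add)
  qed
  have norm: "norm (Y n) \<le> 1" for n
  proof (induction n)
    case (Suc n)
    have "norm (Y n o\<^sub>L Y n) \<le> norm (Y n) * norm (Y n)" by (rule norm_blinfun_compose)
    also have "\<dots> \<le> 1 * 1" using Suc by (intro mult_mono) auto
    finally have "norm (B + (Y n o\<^sub>L Y n)) \<le> 2"
      using norm_triangle_ineq[of B "Y n o\<^sub>L Y n"] \<open>norm B \<le> 1\<close> by linarith
    then show ?case by (simp add: YS)
  qed (simp add: Y0)
  have mono: "rinner x (Y n x) \<le> rinner x (Y (Suc n) x)" for n x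
    using power_cone_nonneg[OF coneD B, of x n] by (simp add: blin_simps rinner_simps)
  obtain Z where Z: "\<And>x. (\<lambda>n. Y n x) \<longlonglongrightarrow> blinfun_apply Z x" "norm Z \<le> 1" "symop Z"
    using monotone_strong_limit[of Y 1, OF power_cone_symop[OF cone posopD(1)[OF B]] norm mono]
    by metis
  have fix_point: "Z x = (1/2) *\<^sub>R (B x + Z (Z x))" for x
  proof (rule LIMSEQ_unique)
    show "(\<lambda>n. Y (Suc n) x) \<longlonglongrightarrow> Z x" using Z(1) by (rule LIMSEQ_Suc)
    show "(\<lambda>n. Y (Suc n) x) \<longlonglongrightarrow> (1/2) *\<^sub>R (B x + Z (Z x))"
      unfolding YS blinfun.scaleR_left blinfun.add_left blinfun_apply_blinfun_compose
      by (intro tendsto_intros strong_limit_apply[OF Z(1) norm] Z(1))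
  qed
  show thesis
  proof
    show "posop (id_blinfun - Z)"
      unfolding posop_def
    proof (intro conjI allI symop_diff symop_id Z(3))
      fix x :: 'a
      have "norm Z * (norm x)\<^sup>2 \<le> 1 * (norm x)\<^sup>2"
        using Z(2) by (intro mult_right_mono) auto
      then show "0 \<le> rinner x (blinfun_apply (id_blinfun - Z) x)"
        using rinner_blinfun_le[of x Z] by (simp add: blin_simps rinner_simps rinner_self)
    qed
    show "blinfun_apply (id_blinfun - Z) (blinfun_apply (id_blinfun - Z) x) = A x" for x
    proof -
      have "2 *\<^sub>R Z x = B x + Z (Z x)" by (subst fix_point) simp
      then have "Z (Z x) = 2 *\<^sub>R Z x - x + A x"
        by (simp add: B_def blin_simps algebra_simps)
      then show ?thesis by (simp add: blin_simps scaleR_2)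
    qed
    show "commutes C (id_blinfun - Z)" if "commutes C A" for C
    proof -
      have "commutes C B" unfolding B_def by (intro commutes_diff commutes_id that)
      then have "commutes C Z" by (intro commutes_limit[OF Z(1)] power_cone_commutes[OF cone])
      then show ?thesis by (intro commutes_diff commutes_id)
    qed
  qed
qed

text \<open>With R = 1 - T^2 the powers of R decrease to the projection onto the fixed vectors of R.
  These are exactly the kernel of T, because \<open>rinner x (T (T x))\<close> is the squared norm
  of T x.\<close>

lemma kernel_projection_exists:
  fixes T :: "'a::complex_hilbert \<Rightarrow>\<^sub>L 'a"
  assumes T: "symop T" and norm: "norm T \<le> 1"
  obtains P where "symop P" "\<And>x. blinfun_apply P (P x) = P x" "\<And>x. blinfun_apply T (P x) = 0"
    "\<And>x. T x = 0 \<Longrightarrow> P x = x" "\<And>C. commutes C T \<Longrightarrow> commutes C P"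
proof -
  define R where "R = id_blinfun - (T o\<^sub>L T)"
  have TT: "rinner x (T (T x)) = (norm (T x))\<^sup>2" for x
    using symopD[OF T, of x "T x"] by (simp add: rinner_self)
  have TT_le: "(norm (T x))\<^sup>2 \<le> (norm x)\<^sup>2" for x
    using norm_blinfun[of T x] mult_right_mono[OF norm norm_ge_zero[of x]]
    by (intro power_mono) auto
  have R: "posop R"
    unfolding R_def posop_def using TT TT_le
    by (auto intro!: symop_diff symop_id symop_compose_commutes T commutes_refl
        simp: blin_simps rinner_simps rinner_self)
  have "norm R \<le> 1"
    by (rule posop_norm_le[OF R]) (simp_all add: R_def blin_simps rinner_simps rinner_self TT)
  define X where "X n = ((\<lambda>Y. R o\<^sub>L Y) ^^ n) id_blinfun" for n
  have X0: "X 0 = id_blinfun" and XS: "X (Suc n) = R o\<^sub>L X n" for n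
    by (simp_all add: X_def)
  have cone: "power_cone R (X n)" for n
    by (induction n) (auto simp: X0 XS intro: power_cone.intros)
  have commTR: "commutes C R" if "commutes C T" for C
    unfolding R_def by (intro commutes_diff commutes_id commutes_compose that)
  have commT: "commutes C (X n)" if "commutes C T" for C n
    by (rule power_cone_commutes[OF cone commTR[OF that]])
  have mono: "rinner x (X (Suc n) x) \<le> rinner x (X n x)" for n x
  proof -
    have "rinner x (X n x) - rinner x (X (Suc n) x) = rinner x (T (T (X n x)))"
      by (simp add: XS R_def blin_simps rinner_simps)
    also have "\<dots> = rinner (T x) (X n (T x))"
      using symopD[OF T, of x "T (X n x)"] commutesD[OF commT[OF commutes_refl]] by simp
    also have "\<dots> \<ge> 0" using power_cone_nonneg[OF cone R] by blast
    finally show ?thesis by simp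
  qed
  have normX: "norm (X n) \<le> 1" for n
  proof (induction n)
    case (Suc n)
    have "norm (X (Suc n)) \<le> norm R * norm (X n)" unfolding XS by (rule norm_blinfun_compose)
    also have "\<dots> \<le> 1 * 1" using Suc \<open>norm R \<le> 1\<close> by (intro mult_mono) auto
    finally show ?case by simp
  qed (simp add: X0 norm_blinfun_id_le)
  have symX: "symop (X n)" for n by (rule power_cone_symop[OF cone posopD(1)[OF R]])
  have symX': "symop (- X n)" for n using symop_scaleR[OF symX, of "-1" n] by simp
  \<comment> \<open>The limit theorem is about increasing sequences, so it is applied to the
    negatives of the decreasing powers.\<close>
  obtain Q where Q: "\<And>x. (\<lambda>n. (- X n) x) \<longlonglongrightarrow> blinfun_apply Q x"
    by (rule monotone_strong_limit[of "\<lambda>n. - X n" 1])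
      (auto simp: symX' normX blin_simps rinner_simps mono)
  define P where "P = - Q"
  have P: "(\<lambda>n. X n x) \<longlonglongrightarrow> P x" for x
    using tendsto_minus[OF Q[of x]] by (simp add: P_def blin_simps)
  have RP: "R (P x) = P x" for x
  proof (rule LIMSEQ_unique)
    show "(\<lambda>n. X (Suc n) x) \<longlonglongrightarrow> P x" using P by (rule LIMSEQ_Suc)
    show "(\<lambda>n. X (Suc n) x) \<longlonglongrightarrow> R (P x)"
      unfolding XS blinfun_apply_blinfun_compose by (intro blinfun.tendsto tendsto_const P)
  qed
  have fixP: "P v = v" if "R v = v" for v
  proof -
    have "X n v = v" for n by (induction n) (simp_all add: X0 XS that)
    then show ?thesis using LIMSEQ_unique[OF P[of v]] by simp
  qed
  show thesis
  proof
    show "symop P" by (rule symop_limit[OF symX P])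
    show "P (P x) = P x" for x by (rule fixP[OF RP])
    show "T (P x) = 0" for x
      using RP[of x] TT[of "P x"] by (simp add: R_def blin_simps rinner.zero_right)
    show "P x = x" if "T x = 0" for x
      by (rule fixP) (simp add: R_def blin_simps that)
    show "commutes C P" if "commutes C T" for C
      by (rule commutes_limit[OF P commT[OF that]])
  qed
qed

text \<open>With \<open>S = \<bar>A\<bar>\<close>, \<open>P\<close> is the projection onto the kernel of the positive part \<open>(S + A) / 2\<close>, which
  contains the range of the negative part \<open>(S - A) / 2\<close>.\<close>

lemma sign_projection_exists_contraction:
  fixes A :: "'a::complex_hilbert \<Rightarrow>\<^sub>L 'a"
  assumes A: "symop A" and norm: "norm A \<le> 1"
  shows "\<exists>P. symop P \<and> (\<forall>x. P (P x) = P x) \<and> (\<forall>C. commutes C A \<longrightarrow> commutes C P) \<and>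
    (\<forall>x. rinner x (A (P x)) \<le> 0) \<and> (\<forall>x. 0 \<le> rinner x (A (x - P x))) \<and>
    (\<forall>x. A x = 0 \<longrightarrow> P x = x)"
proof -
  have AA: "rinner x (A (A x)) = (norm (A x))\<^sup>2" for x
    using symopD[OF A, of x "A x"] by (simp add: rinner_self)
  have AA_le: "(norm (A x))\<^sup>2 \<le> (norm x)\<^sup>2" for x
    using norm_blinfun[of A x] mult_right_mono[OF norm norm_ge_zero[of x]]
    by (intro power_mono) auto
  have "posop (A o\<^sub>L A)"
    unfolding posop_def using AA by (auto intro!: symop_compose_commutes A commutes_refl)
  then obtain S where S: "posop S" "\<And>x. blinfun_apply S (S x) = A (A x)"
      and commS: "\<And>C. commutes C (A o\<^sub>L A) \<Longrightarrow> commutes C S"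
    by (rule positive_sqrt_exists[of "A o\<^sub>L A"]) (auto simp: AA AA_le)
  have symS: "symop S" by (rule posopD(1)[OF S(1)])
  have commAS: "commutes A S" by (intro commS commutes_compose commutes_refl)
  have normS: "norm (S x) \<le> norm x" for x
  proof -
    have "(norm (S x))\<^sup>2 = rinner x (S (S x))"
      using symopD[OF symS, of x "S x"] by (simp add: rinner_self)
    then show ?thesis using S(2) AA AA_le by (simp add: power2_le_iff_abs_le)
  qed
  define T where "T = (1/2) *\<^sub>R (S + A)"
  have "norm S \<le> 1" by (rule norm_blinfun_bound) (simp_all add: normS)
  then have "norm T \<le> 1"
    using norm_triangle_ineq[of S A] norm by (simp add: T_def)
  moreover have "symop T" unfolding T_def by (intro symop_scaleR symop_add symS A)
  ultimately obtain P where P: "symop P" "\<And>x. blinfun_apply P (P x) = P x"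
    "\<And>x. blinfun_apply T (P x) = 0" "\<And>x. T x = 0 \<Longrightarrow> P x = x"
    and commP: "\<And>C. commutes C T \<Longrightarrow> commutes C P"
    using kernel_projection_exists[of T] by metis
  have "commutes A T" unfolding T_def by (intro commutes_scaleR commutes_add commAS commutes_refl)
  then have AP: "A (P x) = P (A x)" for x using commP commutesD by blast
  have "commutes S T" unfolding T_def
    by (intro commutes_scaleR commutes_add commAS[THEN commutes_sym] commutes_refl)
  then have SP: "S (P x) = P (S x)" for x using commP commutesD by blast
  show ?thesis
  proof (intro exI conjI allI impI)
    show "symop P" "P (P x) = P x" for x by fact+
    show "commutes C P" if "commutes C A" for C
      by (intro commP) (unfold T_def, intro commutes_scaleR commutes_add commS commutes_compose that)
    show "rinner x (A (P x)) \<le> 0" for x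
    proof -
      have "A (P x) = - S (P x)"
        using P(3)[of x] by (simp add: T_def blin_simps add_eq_0_iff2)
      moreover have "rinner x (A (P x)) = rinner (P x) (A (P x))"
        using symopD[OF P(1), of x "A (P x)"] AP P(2) by metis
      ultimately show ?thesis using posopD(2)[OF S(1), of "P x"] by (simp add: rinner_simps)
    qed
    show "0 \<le> rinner x (A (x - P x))" for x
    proof -
      define y where "y = x - P x"
      have Py: "P y = 0" by (simp add: y_def blin_simps P(2))
      \<comment> \<open>Since S and A commute, (S + A)(S - A) = S^2 - A^2 = 0, so P fixes S y - A y.
        But P commutes with S and A and kills y, whence S y = A y: on the complement of P the
        operator A coincides with its absolute value.\<close>
      have "T (S x - A x) = 0" for x
        using S(2)[of x] commutesD[OF commAS, of x] by (simp add: T_def blin_simps)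
      then have "P (S y - A y) = S y - A y" by (rule P(4))
      then have "S y = A y" by (simp add: blin_simps SP[symmetric] AP[symmetric] Py)
      moreover have "rinner x (A y) = rinner y (A y)"
      proof -
        have "rinner (P x) (A y) = rinner x (P (A y))" by (rule symopD[OF P(1)])
        also have "\<dots> = 0" by (simp add: AP[symmetric] Py blin_simps rinner_simps)
        finally show ?thesis by (simp add: y_def rinner_simps)
      qed
      ultimately show ?thesis using posopD(2)[OF S(1), of y] by (simp add: y_def)
    qed
    \<comment> \<open>The kernel of A is put on the nonpositive side. This convention is the source
      of \<open>eigen\<close> below and makes the spectral family right-continuous rather than
      left-continuous.\<close>
    show "P x = x" if "A x = 0" for x
    proof (rule P(4))
      have "rinner (S x) (S x) = rinner x (S (S x))" by (rule symopD[OF symS])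
      then have "S x = 0" by (simp add: S(2) that rinner_self blin_simps rinner_simps)
      then show "T x = 0" by (simp add: T_def blin_simps that)
    qed
  qed
qed

lemma sign_projection_exists:
  fixes A :: "'a::complex_hilbert \<Rightarrow>\<^sub>L 'a"
  assumes A: "symop A"
  shows "\<exists>P. symop P \<and> (\<forall>x. P (P x) = P x) \<and> (\<forall>C. commutes C A \<longrightarrow> commutes C P) \<and>
    (\<forall>x. rinner x (A (P x)) \<le> 0) \<and> (\<forall>x. 0 \<le> rinner x (A (x - P x))) \<and>
    (\<forall>x. A x = 0 \<longrightarrow> P x = x)"
proof -
  define c where "c = inverse (norm A + 1)"
  have "norm A + 1 > 0" using norm_ge_zero[of A] by linarith
  then have c: "c > 0" by (simp add: c_def)
  have "norm (c *\<^sub>R A) \<le> 1"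
    using \<open>norm A + 1 > 0\<close> by (simp add: c_def field_simps)
  from sign_projection_exists_contraction[OF symop_scaleR[OF A] this]
  obtain P where P: "symop P" "\<And>x. blinfun_apply P (P x) = P x"
    "\<And>C. commutes C (c *\<^sub>R A) \<Longrightarrow> commutes C P"
    "\<And>x. rinner x ((c *\<^sub>R A) (P x)) \<le> 0" "\<And>x. 0 \<le> rinner x ((c *\<^sub>R A) (x - P x))"
    "\<And>x. (c *\<^sub>R A) x = 0 \<Longrightarrow> P x = x"
    by blast
  have "rinner x (A (P x)) \<le> 0" "0 \<le> rinner x (A (x - P x))" for x
    using P(4)[of x] P(5)[of x] c
    by (simp_all add: blinfun.scaleR_left rinner_scaleR_right mult_le_0_iff zero_le_mult_iff)
  moreover have "commutes C P" if "commutes C A" for C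
    by (intro P(3) commutes_scaleR that)
  moreover have "P x = x" if "A x = 0" for x
    using P(6)[of x] that by (simp add: blinfun.scaleR_left)
  ultimately show ?thesis using P(1,2) by blast
qed


subsection \<open>Projection-valued measures from families of scalar measures\<close>

lemma norm_scaleC: "norm (c *\<^sub>C x) = cmod c * norm x" for x :: "'a::complex_hilbert"
proof -
  have "cinner (c *\<^sub>C x) (c *\<^sub>C x) = cnj c * (c * cinner x x)"
    by (simp only: cinner_scaleC_left cinner_scaleC_right mult.left_commute)
  then have "complex_of_real ((norm (c *\<^sub>C x))\<^sup>2) = cnj c * (c * complex_of_real ((norm x)\<^sup>2))"
    unfolding cinner_self .
  then have "(norm (c *\<^sub>C x))\<^sup>2 = Re (cnj c * (c * complex_of_real ((norm x)\<^sup>2)))"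
    by (metis Re_complex_of_real)
  also have "\<dots> = ((Re c)\<^sup>2 + (Im c)\<^sup>2) * (norm x)\<^sup>2"
    by (simp add: power2_eq_square algebra_simps)
  also have "\<dots> = (cmod c * norm x)\<^sup>2"
    by (simp add: cmod_power2 power_mult_distrib)
  finally show ?thesis by (simp add: power2_eq_iff_nonneg)
qed

lemma bounded_linear_scaleC: "bounded_linear (\<lambda>x::'a::complex_hilbert. c *\<^sub>C x)"
proof (rule bounded_linear_intro)
  show "c *\<^sub>C (x + y) = c *\<^sub>C x + c *\<^sub>C y" for x y :: 'a by (rule scaleC_add_right)
  show "c *\<^sub>C (r *\<^sub>R x) = r *\<^sub>R (c *\<^sub>C x)" for r and x :: 'a
    by (simp add: scaleC_of_real[symmetric] scaleC_scaleC mult.commute)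
  show "norm (c *\<^sub>C x) \<le> norm x * cmod c" for x :: 'a by (simp add: norm_scaleC)
qed

text \<open>Complex linearity is commutation with the scalars, which are real-linear operators; so the
  spectral projections of \<open>A\<close>, constructed within the bicommutant of \<open>A\<close> in the real sense, inherit it.\<close>

lemma bounded_ops_iff_commutes: "A \<in> bounded_ops \<longleftrightarrow> (\<forall>c. commutes (Blinfun (\<lambda>x. c *\<^sub>C x)) A)"
  by (auto simp: bounded_ops_def commutes_def bounded_linear_Blinfun_apply[OF bounded_linear_scaleC])

definition is_projection :: "('a::complex_hilbert \<Rightarrow>\<^sub>L 'a) \<Rightarrow> bool" where
  "is_projection P \<longleftrightarrow> symop P \<and> (\<forall>x. P (P x) = P x)"

lemma is_projectionD:
  "is_projection P \<Longrightarrow> symop P" "is_projection P \<Longrightarrow> P (blinfun_apply P x) = P x"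
  by (simp_all add: is_projection_def)

lemma is_projection_norm: "is_projection P \<Longrightarrow> rinner x (blinfun_apply P x) = (norm (P x))\<^sup>2"
  unfolding is_projection_def using symopD[of P x "P x"] by (simp add: rinner_self)

lemma is_projection_diff_norm:
  "is_projection P \<Longrightarrow> (norm (x - blinfun_apply P x))\<^sup>2 = (norm x)\<^sup>2 - (norm (P x))\<^sup>2"
  using is_projection_norm[of P x] norm_add_square[of x "- P x"] by (simp add: rinner_simps)

lemma is_projection_norm_le:
  assumes "is_projection P"
  shows "norm (blinfun_apply P x) \<le> norm x" "norm P \<le> 1"
proof -
  show *: "norm (P x) \<le> norm x" for x
  proof (rule power2_le_imp_le)
    show "(norm (P x))\<^sup>2 \<le> (norm x)\<^sup>2"
      using is_projection_diff_norm[OF assms, of x] zero_le_power2[of "norm (x - P x)"] by linarith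
  qed simp
  show "norm P \<le> 1" by (rule norm_blinfun_bound) (simp_all add: *)
qed

text \<open>At the vector Q x the inequality reads: squared norm of P (Q x) plus squared norm of Q x
  is at most the latter.\<close>

lemma is_projection_orthogonal:
  assumes P: "is_projection P" and Q: "is_projection Q"
    and le: "\<And>x. rinner x (blinfun_apply P x) + rinner x (blinfun_apply Q x) \<le> (norm x)\<^sup>2"
  shows "P (blinfun_apply Q x) = 0"
  using le[of "Q x"] unfolding is_projection_norm[OF P] is_projection_norm[OF Q]
  by (simp add: is_projectionD(2)[OF Q])

lemma is_projection_add:
  assumes P: "is_projection P" and Q: "is_projection Q"
    and le: "\<And>x. rinner x (blinfun_apply P x) + rinner x (blinfun_apply Q x) \<le> (norm x)\<^sup>2"
  shows "is_projection (P + Q)"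
  unfolding is_projection_def
proof (intro conjI allI symop_add is_projectionD(1) P Q)
  fix x
  have "P (Q x) = 0" by (rule is_projection_orthogonal[OF P Q le])
  moreover have "Q (P x) = 0"
    by (rule is_projection_orthogonal[OF Q P]) (metis le add.commute)
  ultimately show "blinfun_apply (P + Q) (blinfun_apply (P + Q) x) = blinfun_apply (P + Q) x"
    by (simp add: blin_simps is_projectionD(2)[OF P] is_projectionD(2)[OF Q])
qed

lemma is_projection_complement: "is_projection P \<Longrightarrow> is_projection (id_blinfun - P)"
  by (simp add: is_projection_def blin_simps symop_diff symop_id)

lemma measure_disjoint_le:
  assumes "finite_measure M" "space M = UNIV" "S \<in> sets M" "T \<in> sets M" "S \<inter> T = {}"
  shows "measure M S + measure M T \<le> measure M UNIV"
proof -
  interpret finite_measure M by fact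
  have "measure M S + measure M T = measure M (S \<union> T)"
    using assms by (simp add: finite_measure_Union)
  also have "\<dots> \<le> measure M UNIV"
    using assms sets.top[of M] by (intro finite_measure_mono) auto
  finally show ?thesis .
qed

text \<open>The quadratic forms carry everything. Finite additivity of the measures gives that of E,
  the bound by the total mass makes projections of disjoint sets orthogonal, and together these give
  multiplicativity. As the squared norm of E S x is the measure of S, continuity from above of the
  measure at the remainders yields strong countable additivity.\<close>

lemma pvm_of_measures:
  fixes E :: "real set \<Rightarrow> ('a::complex_hilbert \<Rightarrow>\<^sub>L 'a)"
  assumes fin: "\<And>x. finite_measure (\<mu> x)" and sets: "\<And>x. sets (\<mu> x) = sets borel"
    and total: "\<And>x. measure (\<mu> x) UNIV = (norm x)\<^sup>2"
    and proj: "\<And>S. S \<in> sets borel \<Longrightarrow> is_projection (E S)"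
    and bounded: "\<And>S. S \<in> sets borel \<Longrightarrow> E S \<in> bounded_ops"
    and meas: "\<And>S x. S \<in> sets borel \<Longrightarrow> rinner x (E S x) = measure (\<mu> x) S"
  shows "pvm E"
proof -
  have space: "space (\<mu> x) = UNIV" for x using sets_eq_imp_space_eq[OF sets] by simp
  have norm: "(norm (E S x))\<^sup>2 = measure (\<mu> x) S" if "S \<in> sets borel" for S x
    using is_projection_norm[OF proj] meas that by metis
  have add: "E (S \<union> T) = E S + E T"
    if "S \<in> sets borel" "T \<in> sets borel" "S \<inter> T = {}" for S T
    using that
    by (intro symop_eqI symop_add is_projectionD(1) proj)
      (auto simp: blin_simps rinner_simps meas finite_measure.finite_measure_Union[OF fin] sets)
  have orth: "E S (E T x) = 0"
    if "S \<in> sets borel" "T \<in> sets borel" "S \<inter> T = {}" for S T x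
    using that measure_disjoint_le[OF fin space, of S _ T]
    by (intro is_projection_orthogonal proj) (auto simp: meas total sets)
  show ?thesis
    unfolding pvm_def
  proof (intro conjI ballI allI impI; (elim conjE)?)
    fix S :: "real set" assume S: "S \<in> sets borel"
    show "E S \<in> bounded_ops" by (rule bounded[OF S])
    then show "adj (E S) = E S"
      using adj_eq_iff_symop is_projectionD(1)[OF proj[OF S]] by blast
    fix T :: "real set" assume T: "T \<in> sets borel"
    show "E (S \<inter> T) = E S o\<^sub>L E T"
    proof (rule blinfun_eqI)
      fix x
      have split: "E S = E (S \<inter> T) + E (S - T)" if "S \<in> sets borel" "T \<in> sets borel" for S T
      proof -
        have "E ((S \<inter> T) \<union> (S - T)) = E (S \<inter> T) + E (S - T)"
          using that by (intro add) auto
        then show ?thesis by (simp add: Un_Diff_Int Int_Diff_Un)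
      qed
      have "E S (E T x) = E (S \<inter> T) (E T x) + E (S - T) (E T x)"
        by (subst split[OF S T]) (simp add: blin_simps)
      moreover have "E T x = E (S \<inter> T) x + E (T - S) x"
        by (subst split[OF T S]) (simp add: blin_simps Int_commute)
      moreover have "E (S \<inter> T) (E (S \<inter> T) x + E (T - S) x) = E (S \<inter> T) x"
        using S T by (simp add: blin_simps is_projectionD(2)[OF proj] orth disjoint_iff)
      moreover have "E (S - T) (E (S \<inter> T) x + E (T - S) x) = 0"
        using S T by (simp add: blin_simps orth disjoint_iff)
      ultimately show "E (S \<inter> T) x = (E S o\<^sub>L E T) x"
        by (simp only: blinfun_apply_blinfun_compose add_0_right)
    qed
  next
    show "E UNIV = id_blinfun"
      by (intro symop_eqI is_projectionD(1) proj symop_id) (simp_all add: meas total rinner_self)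
  next
    fix X :: "nat \<Rightarrow> real set" and x
    assume "range X \<subseteq> sets borel" and disj: "disjoint_family X"
    then have X: "X i \<in> sets borel" for i by auto
    define U where "U n = (\<Union>i<n. X i)" for n
    have U: "U n \<in> sets borel" for n unfolding U_def using X by auto
    have "(\<Sum>i<n. E (X i)) = E (U n)" for n
    proof (induction n)
      case 0
      have "E {} = E {} + E {}" using add[of "{}" "{}"] by simp
      then show ?case by (simp add: U_def)
    next
      case (Suc n)
      have "X i \<inter> X n = {}" if "i < n" for i
        using disjoint_family_onD[OF disj, of i n] that by simp
      then have "U n \<inter> X n = {}" unfolding U_def by blast
      moreover have "U (Suc n) = U n \<union> X n" by (auto simp: U_def less_Suc_eq)
      ultimately show ?case using Suc add[OF U X] by simp
    qed
    then have part: "(\<Sum>i<n. E (X i) x) = E (U n) x" for n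
      by (simp add: blinfun.sum_left[symmetric])
    have UX: "(\<Union>i. X i) \<in> sets borel" using X by auto
    have diff: "E (\<Union>i. X i) x - E (U n) x = E ((\<Union>i. X i) - U n) x" for n
    proof -
      have "((\<Union>i. X i) - U n) \<union> U n = (\<Union>i. X i)" by (auto simp: U_def)
      moreover have "E (((\<Union>i. X i) - U n) \<union> U n) = E ((\<Union>i. X i) - U n) + E (U n)"
        using U UX by (intro add) auto
      ultimately have "E (\<Union>i. X i) = E ((\<Union>i. X i) - U n) + E (U n)" by (simp only:)
      then show ?thesis by (simp add: blin_simps)
    qed
    have "(\<lambda>n. measure (\<mu> x) ((\<Union>i. X i) - U n)) \<longlonglongrightarrow> measure (\<mu> x) (\<Inter>n. (\<Union>i. X i) - U n)"
      using U UX by (intro finite_measure.finite_Lim_measure_decseq[OF fin])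
        (auto simp: sets decseq_def U_def)
    also have "(\<Inter>n. (\<Union>i. X i) - U n) = {}" by (auto simp: U_def)
    finally have "(\<lambda>n. (norm (E ((\<Union>i. X i) - U n) x))\<^sup>2) \<longlonglongrightarrow> 0"
      using U UX by (simp add: norm)
    from tendsto_real_sqrt[OF this]
    have "(\<lambda>n. norm (E (\<Union>i. X i) x - E (U n) x)) \<longlonglongrightarrow> 0"
      by (simp add: diff)
    then have "(\<lambda>n. E (U n) x) \<longlonglongrightarrow> E (\<Union>i. X i) x"
      by (subst tendsto_dist_iff) (simp add: dist_norm norm_minus_commute)
    then show "(\<lambda>n. E (X n) x) sums E (\<Union>n. X n) x"
      by (simp add: sums_def part)
  qed
qed


subsection \<open>The spectral theorem\<close>

text \<open>\<open>P a\<close> is meant to be the spectral projection of A for the half-line of all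
  t \<le> a. \<open>upper\<close> and \<open>lower\<close> say that A is at most a on its range and
  at least a on its complement; \<open>eigen\<close> fixes the side on which the point a itself
  falls.\<close>

locale spectral_family =
  fixes A :: "'a::complex_hilbert \<Rightarrow>\<^sub>L 'a" and P :: "real \<Rightarrow> ('a \<Rightarrow>\<^sub>L 'a)"
  assumes symA: "symop A" and proj: "is_projection (P a)"
    and comm: "commutes C A \<Longrightarrow> commutes C (P a)"
    and upper: "P a x = x \<Longrightarrow> rinner x (A x) \<le> a * (norm x)\<^sup>2"
    and lower: "P a x = 0 \<Longrightarrow> a * (norm x)\<^sup>2 \<le> rinner x (A x)"
    and eigen: "A x = a *\<^sub>R x \<Longrightarrow> P a x = x"
begin

lemma idem: "P a (P a x) = P a x"
  by (rule is_projectionD(2)[OF proj])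

lemma commA: "A (P a x) = P a (A x)"
  using comm[OF commutes_refl] by (rule commutesD)

lemma commP: "P a (P b x) = P b (P a x)"
  using comm[OF commutes_sym[OF comm[OF commutes_refl]]] by (rule commutesD)

text \<open>The part y of P a x outside the range of P b would satisfy both estimates of the
  quadratic form, at most a and at least b, which for a < b is possible only for y = 0.\<close>

lemma P_P:
  assumes "a \<le> b"
  shows "P a (P b x) = P a x"
proof (cases "a = b")
  case False
  define y where "y = P a x - P b (P a x)"
  have "P a y = y" by (simp add: y_def blin_simps idem commP[of a b])
  moreover have "P b y = 0" by (simp add: y_def blin_simps idem)
  ultimately have "b * (norm y)\<^sup>2 \<le> a * (norm y)\<^sup>2" using upper lower order_trans by blast
  then have "y = 0" using False assms by (simp add: mult_le_cancel_right)
  then show ?thesis by (simp add: y_def commP[of b a])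
qed (simp add: idem)

lemma P_zero:
  assumes "a < - norm A" shows "P a x = 0"
proof -
  have "rinner (P a x) (A (P a x)) \<le> a * (norm (P a x))\<^sup>2" by (rule upper) (rule idem)
  then have "- norm A * (norm (P a x))\<^sup>2 \<le> a * (norm (P a x))\<^sup>2"
    using rinner_blinfun_le[of "P a x" A] by linarith
  then show ?thesis using assms by (simp only: mult_le_cancel_right) (auto simp: not_less)
qed

lemma P_id:
  assumes "norm A < a" shows "P a x = x"
proof -
  define y where "y = x - P a x"
  have "a * (norm y)\<^sup>2 \<le> rinner y (A y)" by (rule lower) (simp add: y_def blin_simps idem)
  then have "a * (norm y)\<^sup>2 \<le> norm A * (norm y)\<^sup>2"
    using rinner_blinfun_le[of y A] by linarith
  then have "y = 0" using assms by (simp add: mult_le_cancel_right)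
  then show ?thesis by (simp add: y_def)
qed

definition F :: "'a \<Rightarrow> real \<Rightarrow> real" where
  "F x a = rinner x (P a x)"

lemma F_norm: "F x a = (norm (P a x))\<^sup>2"
  unfolding F_def by (rule is_projection_norm[OF proj])

lemma F_mono:
  assumes "a \<le> b" shows "F x a \<le> F x b"
proof -
  have "norm (P a (P b x)) \<le> norm (P b x)" by (rule is_projection_norm_le[OF proj])
  then show ?thesis unfolding F_norm P_P[OF assms] by simp
qed

text \<open>The range of the jump of \<open>P\<close> at \<open>a\<close> is an eigenspace of \<open>A\<close> for \<open>a\<close>, hence already contained
  in the range of \<open>P a\<close>.\<close>

lemma P_right_limit: "(\<lambda>n. P (a + inverse (real (Suc n))) x) \<longlonglongrightarrow> P a x"
proof -
  define t where "t n = a + inverse (real (Suc n))" for n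
  have t: "a < t n" "t (Suc n) \<le> t n" for n by (simp_all add: t_def)
  have lim_t: "t \<longlonglongrightarrow> a"
    unfolding t_def using tendsto_add[OF tendsto_const LIMSEQ_inverse_real_of_nat, of a] by simp
  have mono: "rinner x (P (t (Suc n)) x) \<le> rinner x (P (t n) x)" for n x
    using F_mono[OF t(2), of x] by (simp add: F_def)
  have sym: "symop (- P (t n))" for n
    using symop_scaleR[OF is_projectionD(1)[OF proj], of "-1"] by simp
  obtain Q' where Q': "\<And>x. (\<lambda>n. (- P (t n)) x) \<longlonglongrightarrow> blinfun_apply Q' x"
    by (rule monotone_strong_limit[of "\<lambda>n. - P (t n)" 1])
      (auto simp: sym is_projection_norm_le[OF proj] blin_simps rinner_simps mono)
  define Q where "Q = - Q'"
  have Q: "(\<lambda>n. P (t n) x) \<longlonglongrightarrow> Q x" for x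
    using tendsto_minus[OF Q'[of x]] by (simp add: Q_def blin_simps)
  have PQ: "P b (Q x) = (if b \<le> a then P b x else Q x)" for b x
  proof -
    have "(\<lambda>n. P b (P (t n) x)) \<longlonglongrightarrow> P b (Q x)" by (intro blinfun.tendsto tendsto_const Q)
    moreover have "(\<lambda>n. P b (P (t n) x)) \<longlonglongrightarrow> (if b \<le> a then P b x else Q x)"
    proof (cases "b \<le> a")
      case True
      then have "P b (P (t n) x) = P b x" for n using t(1)[of n] by (intro P_P) simp
      then show ?thesis using True by simp
    next
      case False
      then have "eventually (\<lambda>n. t n < b) sequentially"
        using order_tendstoD(2)[OF lim_t, of b] by simp
      then have "eventually (\<lambda>n. P (t n) x = P b (P (t n) x)) sequentially"
        by eventually_elim (simp add: commP[of b] P_P)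
      with Q[of x] False show ?thesis by (simp add: Lim_transform_eventually)
    qed
    ultimately show ?thesis by (rule LIMSEQ_unique)
  qed
  \<comment> \<open>V is the subspace carried by the jump just to the right of a; it contains Q x -
    P a x, and the aim is to show that it is zero.\<close>
  define V where "V = {z. P a z = 0 \<and> (\<forall>b>a. P b z = z)}"
  define B where "B = A - a *\<^sub>R id_blinfun"
  have symB: "symop B" unfolding B_def by (intro symop_diff symA symop_scaleR symop_id)
  have quad: "rinner z (B z) = 0" if "z \<in> V" for z
  proof (rule antisym)
    have "rinner z (A z) \<le> a * (norm z)\<^sup>2"
    proof (rule LIMSEQ_le_const)
      show "(\<lambda>n. t n * (norm z)\<^sup>2) \<longlonglongrightarrow> a * (norm z)\<^sup>2" by (intro tendsto_intros lim_t)
      show "\<exists>N. \<forall>n\<ge>N. rinner z (A z) \<le> t n * (norm z)\<^sup>2"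
        using that t(1) by (auto simp: V_def intro!: upper)
    qed
    then show "rinner z (B z) \<le> 0" by (simp add: B_def blin_simps rinner_simps rinner_self)
    have "a * (norm z)\<^sup>2 \<le> rinner z (A z)" using that by (intro lower) (simp add: V_def)
    then show "0 \<le> rinner z (B z)" by (simp add: B_def blin_simps rinner_simps rinner_self)
  qed
  have QV: "Q x - P a x \<in> V"
    by (auto simp: V_def blin_simps PQ idem commP[of _ a] P_P)
  have "z = 0" if z: "z \<in> V" for z
  proof -
    have Bz: "B z \<in> V"
      using z by (auto simp: V_def B_def blin_simps commA[symmetric])
    have "z + B z \<in> V" "z - B z \<in> V" using z Bz by (auto simp: V_def blin_simps)
    \<comment> \<open>The form of B vanishes on V and B maps V into itself, so polarization between
      z and B z kills the squared norm of B z. Thus z is an eigenvector for a.\<close>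
    then have "rinner z (B (B z)) = 0"
      using symop_quadratic_polar[OF symB, of z "B z"] by (simp add: quad)
    then have "B z = 0" using symopD[OF symB, of z "B z"] by (simp add: rinner_self)
    then have "P a z = z" by (intro eigen) (simp add: B_def blin_simps)
    then show "z = 0" using z by (simp add: V_def)
  qed
  from this[OF QV] have "Q x = P a x" by simp
  then show ?thesis using Q[of x] by (simp add: t_def)
qed

lemma F_right_continuous: "continuous (at_right a) (F x)"
  unfolding continuous_within
proof (rule order_tendstoI)
  fix l assume "l < F x a"
  then show "\<forall>\<^sub>F b in at_right a. l < F x b"
    using F_mono[of a _ x] by (auto simp: eventually_at_right_field intro!: exI[of _ "a + 1"]
        intro: less_le_trans)
next
  fix u assume u: "F x a < u"
  have "(\<lambda>n. F x (a + inverse (real (Suc n)))) \<longlonglongrightarrow> F x a"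
    unfolding F_def by (intro rinner.tendsto tendsto_const P_right_limit)
  from order_tendstoD(2)[OF this u] obtain n where n: "F x (a + inverse (real (Suc n))) < u"
    by (auto simp: eventually_sequentially)
  have "F x b < u" if "b < a + inverse (real (Suc n))" for b
    using F_mono[of b _ x] n that by (meson le_less_trans less_imp_le)
  then show "\<forall>\<^sub>F b in at_right a. F x b < u"
    by (auto simp: eventually_at_right_field intro!: exI[of _ "a + inverse (real (Suc n))"])
qed

definition mu :: "'a \<Rightarrow> real measure" where
  "mu x = interval_measure (F x)"

lemma sets_mu: "sets (mu x) = sets borel" and space_mu: "space (mu x) = UNIV"
  by (simp_all add: mu_def)

lemma emeasure_mu_Ioc: "a \<le> b \<Longrightarrow> emeasure (mu x) {a<..b} = ennreal (F x b - F x a)"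
  unfolding mu_def by (rule emeasure_interval_measure_Ioc) (auto intro: F_mono F_right_continuous)

lemma emeasure_mu_UNIV: "emeasure (mu x) UNIV = ennreal ((norm x)\<^sup>2)"
proof -
  have "(\<lambda>n. emeasure (mu x) {- real n<..real n}) \<longlonglongrightarrow> emeasure (mu x) (\<Union>n. {- real n<..real n})"
    by (intro Lim_emeasure_incseq) (auto simp: sets_mu incseq_def)
  moreover have "(\<Union>n. {- real n<..real n}) = UNIV"
  proof -
    have "\<exists>n. - real n < t \<and> t \<le> real n" for t
      using reals_Archimedean2[of "\<bar>t\<bar>"] by (metis abs_less_iff less_imp_le minus_less_iff)
    then show ?thesis by auto
  qed
  moreover have "(\<lambda>n. emeasure (mu x) {- real n<..real n}) \<longlonglongrightarrow> ennreal ((norm x)\<^sup>2)"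
  proof (rule tendsto_eventually)
    have "emeasure (mu x) {- real n<..real n} = ennreal ((norm x)\<^sup>2)" if "norm A < real n" for n
      using that by (subst emeasure_mu_Ioc) (auto simp: F_norm P_zero P_id)
    moreover have "eventually (\<lambda>n. norm A < real n) sequentially"
      using filterlim_real_sequentially by (simp add: filterlim_at_top_dense)
    ultimately show "\<forall>\<^sub>F n in sequentially. emeasure (mu x) {- real n<..real n} = ennreal ((norm x)\<^sup>2)"
      by (auto elim: eventually_mono)
  qed
  ultimately show ?thesis using LIMSEQ_unique by metis
qed

lemma finite_mu: "finite_measure (mu x)"
  by (rule finite_measureI) (simp add: space_mu emeasure_mu_UNIV)

lemma measure_mu_UNIV: "measure (mu x) UNIV = (norm x)\<^sup>2"
  by (simp add: measure_def emeasure_mu_UNIV)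

lemma measure_mu_Ioc: "a \<le> b \<Longrightarrow> measure (mu x) {a<..b} = F x b - F x a"
  by (simp add: measure_def emeasure_mu_Ioc F_mono)

text \<open>A relation instead of a construction, since projections for general Borel sets are
  reached by induction over the generated sigma-algebra. Each clause survives complements and
  disjoint countable unions; the commutation clause later gives complex linearity and membership in
  M.\<close>

definition represents :: "real set \<Rightarrow> ('a \<Rightarrow>\<^sub>L 'a) \<Rightarrow> bool" where
  "represents S Q \<longleftrightarrow> is_projection Q \<and> (\<forall>x. rinner x (Q x) = measure (mu x) S) \<and>
     (\<forall>C. commutes C A \<longrightarrow> commutes C Q)"

lemma represents_exists:
  assumes "S \<in> sets borel"
  shows "\<exists>Q. represents S Q"
proof -
  let ?G = "range (\<lambda>(a, b). {a<..b::real})"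
  have borel: "sigma_sets UNIV ?G = sets borel"
    unfolding borel_sigma_sets_Ioc by simp
  have "Int_stable ?G"
  proof (rule Int_stableI)
    fix S T assume "S \<in> ?G" "T \<in> ?G"
    then obtain a b c d where "S = {a<..b}" "T = {c<..d}" by auto
    then have "S \<inter> T = {max a c<..min b d}" by auto
    then show "S \<inter> T \<in> ?G" by auto
  qed
  moreover have "?G \<subseteq> Pow UNIV" by simp
  moreover have "S \<in> sigma_sets UNIV ?G" using assms borel by simp
  ultimately show ?thesis
  proof (induction rule: sigma_sets_induct_disjoint)
    case (basic S)
    then obtain a b where S: "S = {a<..b}" by auto
    show ?case
    proof (cases "a \<le> b")
      case True
      have "P b (P a x) = P a x" for x using P_P[OF True] commP by simp
      then have "is_projection (P b - P a)"
        unfolding is_projection_def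
        by (intro conjI allI symop_diff is_projectionD(1) proj) (simp add: blin_simps idem P_P True)
      then have "represents S (P b - P a)"
        unfolding represents_def S
        by (intro conjI allI impI commutes_diff comm)
          (simp_all add: measure_mu_Ioc[OF True] F_def blin_simps rinner_simps)
      then show ?thesis by blast
    next
      case False
      then have "represents S 0"
        unfolding represents_def is_projection_def S
        by (auto simp: symop_0 rinner_simps commutes_def blin_simps)
      then show ?thesis by blast
    qed
  next
    case empty
    have "represents {} 0"
      unfolding represents_def is_projection_def
      by (auto simp: symop_0 rinner_simps commutes_def blin_simps)
    then show ?case by blast
  next
    case (compl S)
    then obtain Q where Q: "represents S Q" by blast
    have "S \<in> sets (mu x)" for x using compl(1) borel by (simp add: sets_mu)
    then have "measure (mu x) (UNIV - S) = (norm x)\<^sup>2 - measure (mu x) S" for x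
      using finite_measure.finite_measure_compl[OF finite_mu, of S x]
      by (simp add: space_mu measure_mu_UNIV)
    then have "represents (UNIV - S) (id_blinfun - Q)"
      using Q unfolding represents_def
      by (auto simp: blin_simps rinner_simps rinner_self intro!: is_projection_complement
          commutes_diff commutes_id)
    then show ?case by blast
  next
    case (union X)
    then obtain R where R: "\<And>i. represents (X i) (R i)" by metis
    have X: "X i \<in> sets (mu x)" for i x using union(2) borel by (auto simp: sets_mu)
    define U where "U n = (\<Union>i<n. X i)" for n
    have U: "U n \<in> sets (mu x)" for n x using X unfolding U_def by auto
    define Q where "Q n = (\<Sum>i<n. R i)" for n
    have Q: "represents (U n) (Q n)" for n
    proof (induction n)
      case 0
      show ?case
        unfolding represents_def is_projection_def U_def Q_def
        by (auto simp: symop_0 rinner_simps commutes_def blin_simps)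
    next
      case (Suc n)
      have "X i \<inter> X n = {}" if "i < n" for i
        using disjoint_family_onD[OF union(1), of i n] that by simp
      then have disj: "U n \<inter> X n = {}" unfolding U_def by blast
      have un: "U (Suc n) = U n \<union> X n" by (auto simp: U_def less_Suc_eq)
      have "is_projection (Q n + R n)"
        using Suc R[of n] measure_disjoint_le[OF finite_mu space_mu U X disj]
        by (intro is_projection_add) (auto simp: represents_def measure_mu_UNIV)
      then show ?case
        using Suc R[of n] unfolding un represents_def
        by (auto simp: Q_def finite_measure.finite_measure_Union[OF finite_mu U X disj]
            blin_simps rinner_simps intro!: commutes_add)
    qed
    have mono: "rinner x (Q n x) \<le> rinner x (Q (Suc n) x)" for n x
      using Q U unfolding represents_def
      by (auto intro!: finite_measure.finite_measure_mono[OF finite_mu] simp: U_def less_Suc_eq)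
    \<comment> \<open>The partial sums are projections because disjoint sets have forms that add up
      to at most the total mass; they increase, so their strong limit serves for the whole
      union.\<close>
    obtain Z where Z: "\<And>x. (\<lambda>n. Q n x) \<longlonglongrightarrow> blinfun_apply Z x" "symop Z"
      using monotone_strong_limit[of Q 1, OF _ _ mono] Q
      unfolding represents_def by (metis is_projectionD(1) is_projection_norm_le(2))
    have "represents (\<Union>i. X i) Z"
      unfolding represents_def is_projection_def
    proof (intro conjI allI impI Z(2))
      fix x
      show "Z (Z x) = Z x"
      proof (rule LIMSEQ_unique)
        show "(\<lambda>n. Q n (Q n x)) \<longlonglongrightarrow> Z (Z x)"
          by (intro strong_limit_apply[OF Z(1), where C = 1] Z(1))
            (use Q in \<open>simp add: represents_def is_projection_norm_le\<close>)
        show "(\<lambda>n. Q n (Q n x)) \<longlonglongrightarrow> Z x"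
          using Z(1) Q by (simp add: represents_def is_projection_def)
      qed
      show "rinner x (Z x) = measure (mu x) (\<Union>i. X i)"
      proof (rule LIMSEQ_unique)
        show "(\<lambda>n. rinner x (Q n x)) \<longlonglongrightarrow> rinner x (Z x)"
          by (intro rinner.tendsto tendsto_const Z(1))
        have "(\<lambda>n. measure (mu x) (U n)) \<longlonglongrightarrow> measure (mu x) (\<Union>n. U n)"
          using U by (intro finite_measure.finite_Lim_measure_incseq[OF finite_mu] incseq_SucI)
            (auto simp: U_def less_Suc_eq)
        moreover have "(\<Union>n. U n) = (\<Union>i. X i)" by (auto simp: U_def)
        ultimately show "(\<lambda>n. rinner x (Q n x)) \<longlonglongrightarrow> measure (mu x) (\<Union>i. X i)"
          using Q by (simp add: represents_def)
      qed
      show "commutes C Z" if "commutes C A" for C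
        using that Q by (intro commutes_limit[OF Z(1)]) (auto simp: represents_def)
    qed
    then show ?case by blast
  qed
qed

definition E :: "real set \<Rightarrow> ('a \<Rightarrow>\<^sub>L 'a)" where
  "E S = (SOME Q. represents S Q)"

lemma represents_E: "S \<in> sets borel \<Longrightarrow> represents S (E S)"
  unfolding E_def using represents_exists by (rule someI_ex)

lemma E_commutes: "S \<in> sets borel \<Longrightarrow> commutes C A \<Longrightarrow> commutes C (E S)"
  using represents_E by (simp add: represents_def)

lemma pvm_E:
  assumes "A \<in> bounded_ops"
  shows "pvm E"
proof (rule pvm_of_measures[OF finite_mu sets_mu measure_mu_UNIV])
  fix S :: "real set" assume S: "S \<in> sets borel"
  show "is_projection (E S)" "\<And>x. rinner x (E S x) = measure (mu x) S"
    using represents_E[OF S] by (simp_all add: represents_def)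
  show "E S \<in> bounded_ops"
    using assms E_commutes[OF S] by (simp add: bounded_ops_iff_commutes)
qed

lemma E_Ioc:
  assumes "a \<le> b"
  shows "E {a<..b} = P b - P a"
  using represents_E[of "{a<..b}"] assms
  by (intro symop_eqI symop_diff is_projectionD(1) proj)
    (auto simp: represents_def measure_mu_Ioc F_def blin_simps rinner_simps)

end

text \<open>\<open>P a\<close> is the sign projection of A - a, whose nonpositive part is the part
  of A not exceeding a.\<close>

lemma spectral_family_exists:
  fixes A :: "'a::complex_hilbert \<Rightarrow>\<^sub>L 'a"
  assumes A: "symop A"
  shows "\<exists>P. spectral_family A P"
proof -
  have "\<exists>Q. is_projection Q \<and> (\<forall>C. commutes C A \<longrightarrow> commutes C Q) \<and>
      (\<forall>x. Q x = x \<longrightarrow> rinner x (A x) \<le> a * (norm x)\<^sup>2) \<and>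
      (\<forall>x. Q x = 0 \<longrightarrow> a * (norm x)\<^sup>2 \<le> rinner x (A x)) \<and>
      (\<forall>x. A x = a *\<^sub>R x \<longrightarrow> Q x = x)" for a
  proof -
    obtain Q where Q: "symop Q" "\<And>x. blinfun_apply Q (Q x) = Q x"
      "\<And>C. commutes C (A - a *\<^sub>R id_blinfun) \<Longrightarrow> commutes C Q"
      "\<And>x. rinner x ((A - a *\<^sub>R id_blinfun) (Q x)) \<le> 0"
      "\<And>x. 0 \<le> rinner x ((A - a *\<^sub>R id_blinfun) (x - Q x))"
      "\<And>x. (A - a *\<^sub>R id_blinfun) x = 0 \<Longrightarrow> Q x = x"
      using sign_projection_exists[of "A - a *\<^sub>R id_blinfun"]
        symop_diff[OF A symop_scaleR[OF symop_id]] by blast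
    show ?thesis
    proof (intro exI conjI allI impI)
      show "is_projection Q" using Q by (simp add: is_projection_def)
      show "commutes C Q" if "commutes C A" for C
        by (intro Q(3) commutes_diff commutes_scaleR commutes_id that)
      show "rinner x (A x) \<le> a * (norm x)\<^sup>2" if "Q x = x" for x
        using Q(4)[of x] that by (simp add: blin_simps rinner_simps rinner_self)
      show "a * (norm x)\<^sup>2 \<le> rinner x (A x)" if "Q x = 0" for x
        using Q(5)[of x] that by (simp add: blin_simps rinner_simps rinner_self)
      show "Q x = x" if "A x = a *\<^sub>R x" for x
        using Q(6)[of x] that by (simp add: blin_simps)
    qed
  qed
  then obtain P where "\<And>a. is_projection (P a) \<and> (\<forall>C. commutes C A \<longrightarrow> commutes C (P a)) \<and>
      (\<forall>x. P a x = x \<longrightarrow> rinner x (A x) \<le> a * (norm x)\<^sup>2) \<and>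
      (\<forall>x. P a x = 0 \<longrightarrow> a * (norm x)\<^sup>2 \<le> rinner x (A x)) \<and>
      (\<forall>x. A x = a *\<^sub>R x \<longrightarrow> blinfun_apply (P a) x = x)"
    by metis
  then have "spectral_family A P" using A by unfold_locales auto
  then show ?thesis by blast
qed


subsection \<open>Bounded Borel functional calculus\<close>

definition bounded_borel :: "(real \<Rightarrow> real) \<Rightarrow> bool" where
  "bounded_borel g \<longleftrightarrow> g \<in> borel_measurable borel \<and> (\<exists>C. \<forall>t. \<bar>g t\<bar> \<le> C)"

lemma bounded_borelI: "g \<in> borel_measurable borel \<Longrightarrow> (\<And>t. \<bar>g t\<bar> \<le> C) \<Longrightarrow> bounded_borel g"
  by (auto simp: bounded_borel_def)

lemma bounded_borel_measurable: "bounded_borel g \<Longrightarrow> g \<in> borel_measurable borel"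
  by (simp add: bounded_borel_def)

lemma bounded_borel_const: "bounded_borel (\<lambda>_. c)"
  by (rule bounded_borelI[of _ "\<bar>c\<bar>"]) auto

lemma bounded_borel_indicator: "S \<in> sets borel \<Longrightarrow> bounded_borel (indicator S)"
  by (rule bounded_borelI[of _ 1]) (auto simp: indicator_def)

lemma bounded_borel_add:
  assumes "bounded_borel f" "bounded_borel g"
  shows "bounded_borel (\<lambda>t. f t + g t)"
proof -
  obtain C D where "\<And>t. \<bar>f t\<bar> \<le> C" "\<And>t. \<bar>g t\<bar> \<le> D" using assms by (auto simp: bounded_borel_def)
  then have "\<bar>f t + g t\<bar> \<le> C + D" for t by (metis abs_triangle_ineq add_mono order_trans)
  then show ?thesis
    using assms by (intro bounded_borelI[of _ "C + D"]) (auto simp: bounded_borel_def)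
qed

lemma bounded_borel_mult:
  assumes "bounded_borel f" "bounded_borel g"
  shows "bounded_borel (\<lambda>t. f t * g t)"
proof -
  obtain C D where *: "\<And>t. \<bar>f t\<bar> \<le> C" "\<And>t. \<bar>g t\<bar> \<le> D" using assms by (auto simp: bounded_borel_def)
  have "\<bar>f t * g t\<bar> \<le> C * D" for t
    unfolding abs_mult using *[of t] by (intro mult_mono) auto
  then show ?thesis
    using assms by (intro bounded_borelI[of _ "C * D"]) (auto simp: bounded_borel_def)
qed

lemma bounded_borel_scale: "bounded_borel g \<Longrightarrow> bounded_borel (\<lambda>t. c * g t)"
  by (rule bounded_borel_mult[OF bounded_borel_const])

lemma bounded_borel_diff: "bounded_borel f \<Longrightarrow> bounded_borel g \<Longrightarrow> bounded_borel (\<lambda>t. f t - g t)"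
  using bounded_borel_add[of f "\<lambda>t. - 1 * g t"] bounded_borel_scale[of g "- 1"] by simp

lemmas bounded_borel_intros = bounded_borel_const bounded_borel_indicator bounded_borel_add
  bounded_borel_mult bounded_borel_diff

lemma truncation_bounded: "bounded_borel (\<lambda>t. if \<bar>t\<bar> \<le> real n then t else 0)"
  by (rule bounded_borelI[of _ "real n"]) auto

lemma indicator_affine_bounded:
  assumes "S \<in> sets borel" "\<And>t. t \<in> S \<Longrightarrow> \<bar>t\<bar> \<le> m"
  shows "bounded_borel (\<lambda>t. indicator S t * (t - c))"
proof (rule bounded_borelI[of _ "\<bar>m\<bar> + \<bar>c\<bar>"])
  show "\<bar>indicator S t * (t - c)\<bar> \<le> \<bar>m\<bar> + \<bar>c\<bar>" for t
    using assms(2)[of t] by (cases "t \<in> S") auto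
qed (use assms(1) in simp)

lemma indicator_truncation:
  assumes "\<And>t. t \<in> S \<Longrightarrow> \<bar>t\<bar> \<le> m" "m \<le> real n"
  shows "(\<lambda>t. indicator S t * (if \<bar>t\<bar> \<le> real n then t else 0)) = (\<lambda>t. indicator S t * (t - 0))"
  using assms order_trans by (fastforce simp: indicator_def)

text \<open>\<open>measure_of\<close> has the prescribed values only after countable additivity is
  established; this is done once for the scalar measures and for the trace measure \<nu>.\<close>

lemma measure_of_borel:
  fixes f :: "real set \<Rightarrow> real"
  assumes nonneg: "\<And>S. S \<in> sets borel \<Longrightarrow> 0 \<le> f S" and empty: "f {} = 0"
    and sums: "\<And>X. range X \<subseteq> sets borel \<Longrightarrow> disjoint_family X \<Longrightarrow> (\<lambda>n::nat. f (X n)) sums f (\<Union>n. X n)"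
  defines "N \<equiv> measure_of UNIV (sets borel) (\<lambda>S. ennreal (f S))"
  shows "sets N = sets borel" "space N = UNIV"
    "S \<in> sets borel \<Longrightarrow> emeasure N S = ennreal (f S)"
    "S \<in> sets borel \<Longrightarrow> measure N S = f S"
    "finite_measure N"
proof -
  have sa: "sigma_algebra UNIV (sets borel :: real set set)"
    using sets.sigma_algebra_axioms[of "borel :: real measure"] by simp
  show sets: "sets N = sets borel" unfolding N_def by (rule sigma_algebra.sets_measure_of_eq[OF sa])
  show space: "space N = UNIV" unfolding N_def by (simp add: space_measure_of_conv)
  show em: "emeasure N S = ennreal (f S)" if "S \<in> sets borel" for S
    unfolding N_def
  proof (rule emeasure_measure_of_sigma[OF sa _ _ that])
    show "positive (sets borel) (\<lambda>S. ennreal (f S))" by (simp add: positive_def empty)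
    show "countably_additive (sets borel) (\<lambda>S. ennreal (f S))"
    proof (rule countably_additiveI)
      fix X :: "nat \<Rightarrow> real set" assume X: "range X \<subseteq> sets borel" "disjoint_family X"
      show "(\<Sum>i. ennreal (f (X i))) = ennreal (f (\<Union>i. X i))"
        using X(1) by (intro suminf_ennreal_eq nonneg sums[OF X]) auto
    qed
  qed
  show "measure N S = f S" if "S \<in> sets borel"
    using em[OF that] nonneg[OF that] by (simp add: measure_def)
  show "finite_measure N"
    by (rule finite_measureI) (simp add: space em)
qed

section \<open>Integration of bounded Borel functions against a projection-valued measure\<close>

locale spectral_pvm =
  fixes E :: "real set \<Rightarrow> ('a::complex_hilbert \<Rightarrow>\<^sub>L 'a)"
  assumes pvm: "pvm E"
begin

abbreviation \<mu> :: "'a \<Rightarrow> real measure" where "\<mu> \<equiv> scalar_measure E"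
abbreviation \<Phi> :: "(real \<Rightarrow> real) \<Rightarrow> ('a \<Rightarrow>\<^sub>L 'a)" where "\<Phi> \<equiv> bounded_spectral_integral E"

lemma E_bounded_ops: "S \<in> sets borel \<Longrightarrow> E S \<in> bounded_ops"
  using pvm by (simp add: pvm_def)

lemma E_symop: "S \<in> sets borel \<Longrightarrow> symop (E S)"
  using pvm adj_eq_iff_symop by (auto simp: pvm_def)

lemma E_Int: "S \<in> sets borel \<Longrightarrow> T \<in> sets borel \<Longrightarrow> E S (E T x) = E (S \<inter> T) x"
  using pvm by (simp add: pvm_def)

lemma E_UNIV: "E UNIV = id_blinfun"
  using pvm by (simp add: pvm_def)

lemma E_sums: "range X \<subseteq> sets borel \<Longrightarrow> disjoint_family X \<Longrightarrow> (\<lambda>n. E (X n) x) sums E (\<Union>n::nat. X n) x"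
  using pvm by (simp add: pvm_def)

lemma E_empty: "E {} = 0"
proof (rule blinfun_eqI)
  fix x
  have "(\<lambda>n::nat. E {} x) sums E {} x"
    using E_sums[of "\<lambda>_. {}" x] by (simp add: disjoint_family_on_def)
  then show "E {} x = blinfun_apply 0 x"
    using sums_summable summable_const_iff by (metis blinfun.zero_left)
qed

lemma E_projection: "S \<in> sets borel \<Longrightarrow> is_projection (E S)"
  by (simp add: is_projection_def E_symop E_Int)

lemma E_commutes: "S \<in> sets borel \<Longrightarrow> T \<in> sets borel \<Longrightarrow> commutes (E S) (E T)"
  by (simp add: commutes_def E_Int Int_commute)

lemma rinner_E_sums:
  assumes "range X \<subseteq> sets borel" "disjoint_family X"
  shows "(\<lambda>n::nat. rinner x (E (X n) x)) sums rinner x (E (\<Union>n. X n) x)"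
  by (intro bounded_linear.sums[OF rinner.bounded_linear_right] E_sums assms)

lemma scalar_measure_eq:
  "\<mu> x = measure_of UNIV (sets borel) (\<lambda>S. ennreal (rinner x (E S x)))"
  unfolding scalar_measure_def rinner_def ..

lemma rinner_E_nonneg: "S \<in> sets borel \<Longrightarrow> 0 \<le> rinner x (E S x)"
  by (simp add: is_projection_norm[OF E_projection])

lemma sets_mu [simp, measurable_cong]: "sets (\<mu> x) = sets borel"
  and space_mu [simp]: "space (\<mu> x) = UNIV"
  and emeasure_mu: "S \<in> sets borel \<Longrightarrow> emeasure (\<mu> x) S = ennreal (rinner x (E S x))"
  and measure_mu: "S \<in> sets borel \<Longrightarrow> measure (\<mu> x) S = rinner x (E S x)"
  and finite_measure_mu: "finite_measure (\<mu> x)"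
  unfolding scalar_measure_eq
  by (intro measure_of_borel; simp add: E_empty blinfun.zero_left rinner.zero_right rinner_E_nonneg rinner_E_sums)+

lemma measure_mu_norm: "S \<in> sets borel \<Longrightarrow> measure (\<mu> x) S = (norm (E S x))\<^sup>2"
  by (simp add: measure_mu is_projection_norm[OF E_projection])

lemma measure_mu_UNIV: "measure (\<mu> x) UNIV = (norm x)\<^sup>2"
  by (simp add: measure_mu_norm E_UNIV)

lemma integrable_mu:
  fixes g :: "real \<Rightarrow> real"
  assumes "g \<in> borel_measurable borel" "\<And>t. \<bar>g t\<bar> \<le> C"
  shows "integrable (\<mu> x) g"
proof (rule finite_measure.integrable_const_bound[OF finite_measure_mu])
  show "AE t in \<mu> x. norm (g t) \<le> C" using assms(2) by simp
  show "g \<in> borel_measurable (\<mu> x)" using assms(1) by measurable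
qed

lemma integral_mu_mono:
  fixes f g :: "real \<Rightarrow> real"
  assumes "f \<in> borel_measurable borel" "\<And>t. \<bar>f t\<bar> \<le> C"
    and "g \<in> borel_measurable borel" "\<And>t. \<bar>g t\<bar> \<le> D" and "\<And>t. f t \<le> g t"
  shows "(\<integral>t. f t \<partial>\<mu> x) \<le> (\<integral>t. g t \<partial>\<mu> x)"
  by (rule integral_mono[OF integrable_mu[OF assms(1,2)] integrable_mu[OF assms(3,4)] assms(5)])

lemma bounded_borel_integrable: "bounded_borel g \<Longrightarrow> integrable (\<mu> x) g"
  unfolding bounded_borel_def using integrable_mu by blast

text \<open>The properties of an integral of g, stated without the definite description in
  \<open>bounded_spectral_integral\<close>, which can be evaluated only once such an operator has
  been found. The last clause again records complex linearity and, for M, the bicommutant.\<close>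

definition calculus :: "(real \<Rightarrow> real) \<Rightarrow> ('a \<Rightarrow>\<^sub>L 'a) \<Rightarrow> bool" where
  "calculus g B \<longleftrightarrow> symop B \<and> (\<forall>x. rinner x (B x) = (\<integral>t. g t \<partial>\<mu> x)) \<and>
     (\<forall>C. (\<forall>S\<in>sets borel. commutes C (E S)) \<longrightarrow> commutes C B)"

lemma calculus_indicator: "S \<in> sets borel \<Longrightarrow> calculus (indicator S) (E S)"
  by (simp add: calculus_def E_symop measure_mu)

lemma calculus_add:
  "bounded_borel f \<Longrightarrow> bounded_borel g \<Longrightarrow> calculus f A \<Longrightarrow> calculus g B \<Longrightarrow>
    calculus (\<lambda>t. f t + g t) (A + B)"
  by (simp add: calculus_def symop_add blin_simps rinner_simps commutes_add bounded_borel_integrable)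

lemma calculus_scale: "bounded_borel f \<Longrightarrow> calculus f A \<Longrightarrow> calculus (\<lambda>t. c * f t) (c *\<^sub>R A)"
  by (simp add: calculus_def symop_scaleR blin_simps rinner_simps commutes_scaleR)

lemma calculus_const: "calculus (\<lambda>_. c) (c *\<^sub>R id_blinfun)"
  unfolding calculus_def
  by (simp add: symop_scaleR symop_id blin_simps rinner_simps rinner_self commutes_scaleR
      commutes_id measure_mu_UNIV)

lemma dominated_convergence_mu:
  fixes g :: "real \<Rightarrow> real"
  assumes "\<And>i. U i \<in> borel_measurable borel" "g \<in> borel_measurable borel"
    and "\<And>i t. \<bar>U i t\<bar> \<le> C" "\<And>t. (\<lambda>i. U i t) \<longlonglongrightarrow> g t"
  shows "(\<lambda>i. \<integral>t. U i t \<partial>\<mu> x) \<longlonglongrightarrow> (\<integral>t. g t \<partial>\<mu> x)"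
proof (rule integral_dominated_convergence[where w = "\<lambda>_. C"])
  show "integrable (\<mu> x) (\<lambda>_. C)" by (rule bounded_borel_integrable[OF bounded_borel_const])
qed (use assms in \<open>simp_all, measurable\<close>)

lemma calculus_exists_nonneg:
  assumes "u \<in> borel_measurable borel" "\<And>t. 0 \<le> u t" "\<And>t. u t \<le> C"
  shows "\<exists>B. calculus u B"
  using assms
proof (induction u arbitrary: C rule: borel_measurable_induct_real)
  case (set S)
  then show ?case using calculus_indicator by auto
next
  case (mult u c)
  show ?case
  \<comment> \<open>For c = 0 the bound on the product says nothing about u, so the induction
    hypothesis is out of reach and the zero operator is supplied directly.\<close>
  proof (cases "c = 0")
    case True
    then show ?thesis using calculus_const[of 0] by auto
  next
    case False
    then have le: "u t \<le> C / c" for t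
      using mult.hyps(1) mult.prems[of t] by (simp add: pos_le_divide_eq mult.commute)
    moreover have "bounded_borel u"
      using mult.hyps(2,3) le by (intro bounded_borelI[of _ "C / c"]) auto
    ultimately show ?thesis using mult.IH calculus_scale by blast
  qed
next
  case (add u v)
  have "u t \<le> C" "v t \<le> C" for t
    using add.prems[of t] add.hyps(2)[of t] add.hyps(4)[of t] by linarith+
  moreover from this have "bounded_borel u" "bounded_borel v"
    using add.hyps(1-4) by (auto intro!: bounded_borelI[of _ C])
  ultimately show ?case using add.IH calculus_add by blast
next
  case (seq U)
  have inc: "incseq (\<lambda>i. U i t)" for t using seq.hyps(3) by (simp add: incseq_def le_fun_def)
  have lim: "(\<lambda>i. U i t) \<longlonglongrightarrow> u t" for t using seq.hyps(4) by simp
  have le: "U i t \<le> C" for i t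
    using incseq_le[OF inc lim] seq.prems by (rule order_trans)
  have "\<exists>B. calculus (U i) B" for i by (rule seq.IH[OF le])
  then obtain B where B: "\<And>i. calculus (U i) (B i)" by metis
  have ab: "\<bar>U i t\<bar> \<le> C" for i t using le seq.hyps(2) by simp
  have C: "0 \<le> C" using ab[of 0 0] by linarith
  have pos: "posop (B i)" for i
    using B[of i] seq.hyps(2) by (auto simp: posop_def calculus_def)
  have nB: "norm (B i) \<le> C" for i
  proof (rule posop_norm_le[OF pos _ C])
    fix x
    have "(\<integral>t. U i t \<partial>\<mu> x) \<le> (\<integral>t. C \<partial>\<mu> x)"
      using ab le C seq.hyps(1) by (intro integral_mu_mono[where C = C and D = C]) auto
    then show "rinner x (B i x) \<le> C * (norm x)\<^sup>2"
      using B[of i] by (simp add: calculus_def measure_mu_UNIV mult.commute)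
  qed
  have mono: "rinner x (B i x) \<le> rinner x (B (Suc i) x)" for i x
  proof -
    have "(\<integral>t. U i t \<partial>\<mu> x) \<le> (\<integral>t. U (Suc i) t \<partial>\<mu> x)"
      using seq.hyps(3) by (intro integral_mu_mono[where C = C and D = C] seq.hyps(1) ab)
        (simp add: incseq_Suc_iff le_fun_def)
    then show ?thesis using B by (simp add: calculus_def)
  qed
  obtain Z where Z: "\<And>x. (\<lambda>i. B i x) \<longlonglongrightarrow> blinfun_apply Z x" "symop Z"
    using monotone_strong_limit[of B C, OF posopD(1)[OF pos] nB mono] by blast
  have "calculus u Z"
    unfolding calculus_def
  proof (intro conjI allI impI Z(2))
    fix x
    have "u \<in> borel_measurable borel"
      using seq.hyps(1,4) by (intro borel_measurable_LIMSEQ_real[of borel U u]) auto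
    then have "(\<lambda>i. \<integral>t. U i t \<partial>\<mu> x) \<longlonglongrightarrow> (\<integral>t. u t \<partial>\<mu> x)"
      using seq.hyps by (intro dominated_convergence_mu[where C = C] ab) auto
    moreover have "(\<lambda>i. rinner x (B i x)) \<longlonglongrightarrow> rinner x (Z x)"
      by (intro rinner.tendsto tendsto_const Z(1))
    moreover have "rinner x (B i x) = (\<integral>t. U i t \<partial>\<mu> x)" for i
      using B[of i] by (simp add: calculus_def)
    ultimately show "rinner x (Z x) = (\<integral>t. u t \<partial>\<mu> x)"
      using LIMSEQ_unique by simp
  next
    fix C assume "\<forall>S\<in>sets borel. commutes C (E S)"
    then show "commutes C Z"
      using B by (intro commutes_limit[OF Z(1)]) (auto simp: calculus_def)
  qed
  then show ?case by blast
qed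

lemma calculus_exists:
  assumes "bounded_borel g"
  shows "\<exists>B. calculus g B"
proof -
  obtain C where C: "\<And>t. \<bar>g t\<bar> \<le> C" using assms by (auto simp: bounded_borel_def)
  \<comment> \<open>The induction principle is about nonnegative functions; adding the bound C makes
    g nonnegative, and C times the identity is subtracted afterwards.\<close>
  have "\<exists>B. calculus (\<lambda>t. g t + C) B"
  proof (rule calculus_exists_nonneg)
    show "(\<lambda>t. g t + C) \<in> borel_measurable borel"
      by (intro borel_measurable_add bounded_borel_measurable assms borel_measurable_const)
    show "0 \<le> g t + C" "g t + C \<le> 2 * C" for t using C[of t] by linarith+
  qed
  then obtain B where "calculus (\<lambda>t. g t + C) B" by blast
  then have "calculus (\<lambda>t. (g t + C) + - C) (B + (- C) *\<^sub>R id_blinfun)"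
    using assms by (intro calculus_add calculus_const bounded_borel_intros)
  then show ?thesis by auto
qed

lemma calculus_bounded_ops: "calculus g B \<Longrightarrow> B \<in> bounded_ops"
  using E_bounded_ops by (simp add: calculus_def bounded_ops_iff_commutes)

lemma calculus_eq:
  assumes "calculus g B"
  shows "\<Phi> g = B"
  unfolding bounded_spectral_integral_def
proof (rule the_equality)
  have B: "B \<in> bounded_ops" "symop B"
    using assms calculus_bounded_ops by (auto simp: calculus_def)
  have "cinner x (B x) = complex_of_real (\<integral>t. g t \<partial>\<mu> x)" for x
  proof -
    have "cinner x (B x) = complex_of_real (Re (cinner x (B x)))"
      using B bounded_ops_real_form by (metis of_real_Re)
    then show ?thesis using assms by (simp add: calculus_def rinner_def)
  qed
  then show "B \<in> bounded_ops \<and> (\<forall>x. cinner x (B x) = complex_of_real (\<integral>t. g t \<partial>\<mu> x))"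
    using B by simp
  fix B' assume B': "B' \<in> bounded_ops \<and> (\<forall>x. cinner x (B' x) = complex_of_real (\<integral>t. g t \<partial>\<mu> x))"
  then have "symop B'" using bounded_ops_real_form[of B'] by simp
  then show "B' = B"
    using B' B assms by (intro symop_eqI) (auto simp: calculus_def rinner_def)
qed

lemma calculus_Phi: "bounded_borel g \<Longrightarrow> calculus g (\<Phi> g)"
  using calculus_exists calculus_eq by metis

lemma Phi_symop: "bounded_borel g \<Longrightarrow> symop (\<Phi> g)"
  and rinner_Phi: "bounded_borel g \<Longrightarrow> rinner x (\<Phi> g x) = (\<integral>t. g t \<partial>\<mu> x)"
  and Phi_commutes: "bounded_borel g \<Longrightarrow> (\<And>S. S \<in> sets borel \<Longrightarrow> commutes C (E S)) \<Longrightarrow> commutes C (\<Phi> g)"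
  using calculus_Phi by (auto simp: calculus_def)

lemma Phi_bounded_ops: "bounded_borel g \<Longrightarrow> \<Phi> g \<in> bounded_ops"
  by (rule calculus_bounded_ops[OF calculus_Phi])

lemma Phi_indicator: "S \<in> sets borel \<Longrightarrow> \<Phi> (indicator S) = E S"
  by (rule calculus_eq[OF calculus_indicator])

lemma Phi_const: "\<Phi> (\<lambda>_. c) = c *\<^sub>R id_blinfun"
  by (rule calculus_eq[OF calculus_const])

lemma Phi_add: "bounded_borel f \<Longrightarrow> bounded_borel g \<Longrightarrow> \<Phi> (\<lambda>t. f t + g t) = \<Phi> f + \<Phi> g"
  by (intro calculus_eq calculus_add calculus_Phi)

lemma Phi_scale: "bounded_borel g \<Longrightarrow> \<Phi> (\<lambda>t. c * g t) = c *\<^sub>R \<Phi> g"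
  by (intro calculus_eq calculus_scale calculus_Phi)

lemma Phi_diff: "bounded_borel f \<Longrightarrow> bounded_borel g \<Longrightarrow> \<Phi> (\<lambda>t. f t - g t) = \<Phi> f - \<Phi> g"
  using Phi_add[of f "\<lambda>t. - 1 * g t"] Phi_scale[of g "- 1"] bounded_borel_scale[of g "- 1"] by simp

lemma Phi_commutes_E: "bounded_borel g \<Longrightarrow> S \<in> sets borel \<Longrightarrow> E S (\<Phi> g x) = \<Phi> g (E S x)"
  by (rule commutesD[OF Phi_commutes[OF _ E_commutes]])

text \<open>Projecting the vector restricts its scalar measure to S, since
  \<open>rinner (E S x) (E T (E S x))\<close> collapses to the form of E for the intersection at x.
  This is multiplicativity of the calculus with one factor an indicator.\<close>

lemma scalar_measure_E:
  assumes "S \<in> sets borel"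
  shows "\<mu> (E S x) = density (\<mu> x) (\<lambda>t. ennreal (indicator S t))"
proof (rule measure_eqI)
  fix T assume "T \<in> sets (\<mu> (E S x))"
  then have T: "T \<in> sets borel" by simp
  have "emeasure (\<mu> (E S x)) T = ennreal (rinner x (E (S \<inter> T) x))"
    using symopD[OF E_symop[OF assms]] assms T
    by (simp add: emeasure_mu E_Int Int_commute Int_left_commute)
  moreover have "emeasure (density (\<mu> x) (\<lambda>t. ennreal (indicator S t))) T = emeasure (\<mu> x) (S \<inter> T)"
    using assms T by (subst emeasure_density)
      (auto simp: indicator_inter_arith[symmetric] ennreal_indicator ennreal_mult[symmetric]
        simp del: ennreal_mult)
  ultimately show "emeasure (\<mu> (E S x)) T = emeasure (density (\<mu> x) (\<lambda>t. ennreal (indicator S t))) T"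
    using assms T by (simp add: emeasure_mu)
qed simp

lemma Phi_indicator_mult:
  assumes S: "S \<in> sets borel" and g: "bounded_borel g"
  shows "\<Phi> (\<lambda>t. indicator S t * g t) x = E S (\<Phi> g x)"
proof -
  have "symop (E S o\<^sub>L \<Phi> g)"
    by (intro symop_compose_commutes E_symop Phi_symop Phi_commutes E_commutes S g)
  moreover have "rinner x (E S (\<Phi> g x)) = (\<integral>t. indicator S t * g t \<partial>\<mu> x)" for x
  proof -
    have "rinner x (E S (\<Phi> g x)) = rinner (E S x) (\<Phi> g (E S x))"
      using symopD[OF E_symop[OF S], of x "\<Phi> g (E S x)"] Phi_commutes_E[OF g S]
      by (simp add: E_Int S)
    also have "\<dots> = (\<integral>t. g t \<partial>\<mu> (E S x))" by (rule rinner_Phi[OF g])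
    also have "\<dots> = (\<integral>t. indicator S t * g t \<partial>\<mu> x)"
      unfolding scalar_measure_E[OF S]
      using S bounded_borel_measurable[OF g] by (subst integral_density) auto
    finally show ?thesis .
  qed
  ultimately have "\<Phi> (\<lambda>t. indicator S t * g t) = E S o\<^sub>L \<Phi> g"
    by (intro symop_eqI Phi_symop) (auto simp: rinner_Phi bounded_borel_intros S g)
  then show ?thesis by simp
qed

text \<open>Multiplicativity is extended from indicators to a general first factor by induction on
  u, with the second factor g kept fixed.\<close>

lemma rinner_Phi_mult_nonneg:
  assumes "u \<in> borel_measurable borel" "\<And>t. 0 \<le> u t" "\<And>t. u t \<le> C" and g: "bounded_borel g"
  shows "rinner x (\<Phi> u (\<Phi> g x)) = (\<integral>t. u t * g t \<partial>\<mu> x)"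
  using assms(1-3)
proof (induction u arbitrary: C rule: borel_measurable_induct_real)
  case (set S)
  then show ?case
    using Phi_indicator_mult[OF _ g, of S x, symmetric]
    by (simp add: Phi_indicator rinner_Phi bounded_borel_intros g)
next
  case (mult u c)
  show ?case
  proof (cases "c = 0")
    case True
    then show ?thesis by (simp add: Phi_const blin_simps rinner_simps)
  next
    case False
    then have le: "u t \<le> C / c" for t
      using mult.hyps(1) mult.prems[of t] by (simp add: pos_le_divide_eq mult.commute)
    moreover have "bounded_borel u"
      using mult.hyps(2,3) le by (intro bounded_borelI[of _ "C / c"]) auto
    ultimately show ?thesis
      using mult.IH[of "C / c"] by (simp add: Phi_scale blin_simps rinner_simps mult.assoc)
  qed
next
  case (add u v)
  have "u t \<le> C" "v t \<le> C" for t
    using add.prems[of t] add.hyps(2)[of t] add.hyps(4)[of t] by linarith+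
  moreover from this have "bounded_borel u" "bounded_borel v"
    using add.hyps(1-4) by (auto intro!: bounded_borelI[of _ C])
  ultimately show ?case
    using add.IH[of C] by (simp add: Phi_add blin_simps rinner_simps distrib_right g
        bounded_borel_integrable bounded_borel_mult)
next
  case (seq U)
  have inc: "incseq (\<lambda>i. U i t)" for t using seq.hyps(3) by (simp add: incseq_def le_fun_def)
  have lim: "(\<lambda>i. U i t) \<longlonglongrightarrow> u t" for t using seq.hyps(4) by simp
  have le: "U i t \<le> C" for i t
    using incseq_le[OF inc lim] seq.prems by (rule order_trans)
  have ab: "\<bar>U i t\<bar> \<le> C" for i t using le seq.hyps(2) by simp
  have meas: "u \<in> borel_measurable borel"
    using seq.hyps(1,4) by (intro borel_measurable_LIMSEQ_real[of borel U u]) auto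
  have u0: "0 \<le> u t" for t
    using lim seq.hyps(2) by (intro LIMSEQ_le_const[of "\<lambda>i. U i t"]) auto
  have bbU: "bounded_borel (U i)" for i using seq.hyps(1) ab by (rule bounded_borelI)
  have bbu: "bounded_borel u" using meas u0 seq.prems by (intro bounded_borelI[of _ C]) auto
  obtain D where D: "\<And>t. \<bar>g t\<bar> \<le> D" using g by (auto simp: bounded_borel_def)
  have quad: "(\<lambda>i. rinner z (\<Phi> (U i) z)) \<longlonglongrightarrow> rinner z (\<Phi> u z)" for z
    using dominated_convergence_mu[of U u C z] bbU bbu ab lim seq.hyps(1) meas by (simp add: rinner_Phi)
  have "(\<lambda>i. rinner x (\<Phi> (U i) (\<Phi> g x))) \<longlonglongrightarrow> rinner x (\<Phi> u (\<Phi> g x))"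
  proof -
    \<comment> \<open>Convergence is known only for quadratic forms, while here the two arguments x
      and \<Phi> g x differ; polarization bridges the gap.\<close>
    have pol: "rinner x (\<Phi> v y) = (rinner (x + y) (\<Phi> v (x + y)) - rinner (x - y) (\<Phi> v (x - y))) / 4"
      if "bounded_borel v" for v y
      using symop_quadratic_polar[OF Phi_symop[OF that], of x y] by simp
    show ?thesis
      unfolding pol[OF bbU] pol[OF bbu] by (intro tendsto_intros quad) simp
  qed
  moreover have "(\<lambda>i. \<integral>t. U i t * g t \<partial>\<mu> x) \<longlonglongrightarrow> (\<integral>t. u t * g t \<partial>\<mu> x)"
  proof (rule dominated_convergence_mu[where C = "C * D"])
    show "\<bar>U i t * g t\<bar> \<le> C * D" for i t
      unfolding abs_mult using ab[of i t] D[of t] by (intro mult_mono) auto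
  qed (use bounded_borel_measurable[OF g] seq.hyps(1) meas lim in \<open>auto intro!: tendsto_mult\<close>)
  ultimately show ?case
    using seq.IH[OF le] LIMSEQ_unique by auto
qed

lemma Phi_mult:
  assumes f: "bounded_borel f" and g: "bounded_borel g"
  shows "\<Phi> (\<lambda>t. f t * g t) x = \<Phi> f (\<Phi> g x)"
proof -
  obtain C where C: "\<And>t. \<bar>f t\<bar> \<le> C" using f by (auto simp: bounded_borel_def)
  have "rinner x (\<Phi> (\<lambda>t. f t + C) (\<Phi> g x)) = (\<integral>t. (f t + C) * g t \<partial>\<mu> x)" for x
  proof (rule rinner_Phi_mult_nonneg[OF _ _ _ g])
    show "(\<lambda>t. f t + C) \<in> borel_measurable borel"
      by (intro borel_measurable_add bounded_borel_measurable f borel_measurable_const)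
    show "0 \<le> f t + C" "f t + C \<le> 2 * C" for t using C[of t] by linarith+
  qed
  then have "rinner x (\<Phi> f (\<Phi> g x)) = (\<integral>t. f t * g t \<partial>\<mu> x)" for x
    using f g by (simp add: Phi_add Phi_const bounded_borel_intros blin_simps rinner_simps
        distrib_right bounded_borel_integrable rinner_Phi)
  moreover have "symop (\<Phi> f o\<^sub>L \<Phi> g)"
    by (intro symop_compose_commutes Phi_symop Phi_commutes[OF g] Phi_commutes[OF f, THEN commutes_sym]
        E_commutes f g)
  ultimately have "\<Phi> (\<lambda>t. f t * g t) = \<Phi> f o\<^sub>L \<Phi> g"
    by (intro symop_eqI Phi_symop) (auto simp: rinner_Phi bounded_borel_intros f g)
  then show ?thesis by simp
qed

lemma norm_Phi:
  assumes "bounded_borel g"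
  shows "(norm (\<Phi> g x))\<^sup>2 = (\<integral>t. (g t)\<^sup>2 \<partial>\<mu> x)"
proof -
  have "(norm (\<Phi> g x))\<^sup>2 = rinner x (\<Phi> g (\<Phi> g x))"
    using symopD[OF Phi_symop[OF assms]] by (simp add: rinner_self[symmetric])
  also have "\<dots> = (\<integral>t. (g t)\<^sup>2 \<partial>\<mu> x)"
    using assms by (simp add: Phi_mult[symmetric] rinner_Phi bounded_borel_mult power2_eq_square)
  finally show ?thesis .
qed

lemma norm_Phi_le:
  assumes "bounded_borel g" "\<And>t. \<bar>g t\<bar> \<le> C"
  shows "norm (\<Phi> g x) \<le> C * norm x"
proof -
  have C: "0 \<le> C" using assms(2)[of 0] by linarith
  have "(norm (\<Phi> g x))\<^sup>2 \<le> (\<integral>t. C\<^sup>2 \<partial>\<mu> x)"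
    unfolding norm_Phi[OF assms(1)] using assms C bounded_borel_mult[OF assms(1) assms(1)]
    by (intro integral_mono bounded_borel_integrable bounded_borel_const)
      (auto simp: power2_eq_square[symmetric] abs_le_square_iff[symmetric])
  also have "\<dots> = (C * norm x)\<^sup>2" by (simp add: measure_mu_UNIV power_mult_distrib)
  finally show ?thesis using C by (simp add: power2_le_iff_abs_le)
qed

lemma Phi_cong:
  assumes "E S = id_blinfun" "S \<in> sets borel" "bounded_borel f" "bounded_borel g"
    and "\<And>t. t \<in> S \<Longrightarrow> f t = g t"
  shows "\<Phi> f = \<Phi> g"
proof (rule blinfun_eqI)
  fix x
  have "(\<lambda>t. indicator S t * f t) = (\<lambda>t. indicator S t * g t)"
    using assms(5) by (auto simp: indicator_def)
  then show "\<Phi> f x = \<Phi> g x"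
    using Phi_indicator_mult[of S f x] Phi_indicator_mult[of S g x] assms by simp
qed

text \<open>The bound on g is required only on a set S carrying E, as for the identity function on
  the spectrum of a bounded operator. The scalar measures do not see the complement of S, and from C
  \<le> n on the truncations give the same operator, so the limit defining the graph is eventually
  constant.\<close>

lemma spectral_integral_bounded:
  assumes g: "g \<in> borel_measurable borel" and S: "S \<in> sets borel" "E S = id_blinfun"
    and bound: "\<And>t. t \<in> S \<Longrightarrow> \<bar>g t\<bar> \<le> C"
  shows "spectral_integral E g = graph_of (\<Phi> (\<lambda>t. indicator S t * g t))"
proof -
  have AE: "AE t in \<mu> x. t \<in> S" for x
  proof (rule AE_I[of _ _ "- S"])
    have "measure (\<mu> x) (- S) = measure (\<mu> x) UNIV - measure (\<mu> x) S"
      using finite_measure.finite_measure_compl[OF finite_measure_mu, of S x] S(1)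
      by (simp add: Compl_eq_Diff_UNIV)
    then have "measure (\<mu> x) (- S) = 0" using S by (simp add: measure_mu_norm E_UNIV)
    then show "emeasure (\<mu> x) (- S) = 0"
      by (simp add: finite_measure.emeasure_eq_measure[OF finite_measure_mu])
  qed (use S in auto)
  have int: "integrable (\<mu> x) (\<lambda>t. (g t)\<^sup>2)" for x
  proof (rule finite_measure.integrable_const_bound[OF finite_measure_mu, where B = "C\<^sup>2"])
    show "AE t in \<mu> x. norm ((g t)\<^sup>2) \<le> C\<^sup>2"
      using AE
    proof eventually_elim
      case (elim t)
      have "\<bar>g t\<bar>\<^sup>2 \<le> C\<^sup>2" by (intro power_mono bound elim) simp
      then show ?case by simp
    qed
    show "(\<lambda>t. (g t)\<^sup>2) \<in> borel_measurable (\<mu> x)" using g by measurable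
  qed
  have bb: "bounded_borel (\<lambda>t. if \<bar>g t\<bar> \<le> real n then g t else 0)" for n
    using g by (intro bounded_borelI[of _ "real n"]) auto
  have bbS: "bounded_borel (\<lambda>t. indicator S t * g t)"
  proof (rule bounded_borelI[of _ "\<bar>C\<bar>"])
    show "\<bar>indicator S t * g t\<bar> \<le> \<bar>C\<bar>" for t
      using order_trans[OF bound[of t] abs_ge_self] by (simp add: indicator_def)
  qed (use g S in simp)
  have "eventually (\<lambda>n. C \<le> real n) sequentially"
    using filterlim_real_sequentially by (simp add: filterlim_at_top)
  then have "eventually (\<lambda>n. \<Phi> (\<lambda>t. if \<bar>g t\<bar> \<le> real n then g t else 0) x = \<Phi> (\<lambda>t. indicator S t * g t) x)
      sequentially" for x
  proof eventually_elim
    case (elim n)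
    have "\<Phi> (\<lambda>t. if \<bar>g t\<bar> \<le> real n then g t else 0) = \<Phi> (\<lambda>t. indicator S t * g t)"
    proof (rule Phi_cong[OF S(2,1) bb bbS])
      fix t assume "t \<in> S"
      then show "(if \<bar>g t\<bar> \<le> real n then g t else 0) = indicator S t * g t"
        using order_trans[OF bound elim, of t] by simp
    qed
    then show ?case by simp
  qed
  then have lim: "(\<lambda>n. \<Phi> (\<lambda>t. if \<bar>g t\<bar> \<le> real n then g t else 0) x) \<longlonglongrightarrow> \<Phi> (\<lambda>t. indicator S t * g t) x"
    for x by (rule tendsto_eventually)
  show ?thesis
    unfolding spectral_integral_def graph_of_def using int lim LIMSEQ_unique by blast
qed

end


subsection \<open>Uniqueness of the spectral measure\<close>

context spectral_pvm
begin

abbreviation T :: "('a \<times> 'a) set" where "T \<equiv> spectral_integral E (\<lambda>t. t)"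

lemma T_restrict:
  assumes xy: "(x, y) \<in> T" and S: "S \<in> sets borel" "\<And>t. t \<in> S \<Longrightarrow> \<bar>t\<bar> \<le> m"
  shows "E S y = \<Phi> (\<lambda>t. indicator S t * t) x"
proof (rule LIMSEQ_unique)
  show "(\<lambda>n. E S (\<Phi> (\<lambda>t. if \<bar>t\<bar> \<le> real n then t else 0) x)) \<longlonglongrightarrow> E S y"
    using xy by (intro blinfun.tendsto tendsto_const) (simp add: spectral_integral_def)
  have "eventually (\<lambda>n. m \<le> real n) sequentially"
    using filterlim_real_sequentially by (simp add: filterlim_at_top)
  then have "eventually (\<lambda>n. E S (\<Phi> (\<lambda>t. if \<bar>t\<bar> \<le> real n then t else 0) x) =
      \<Phi> (\<lambda>t. indicator S t * t) x) sequentially"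
  proof eventually_elim
    case (elim n)
    have eq: "(\<lambda>t. indicator S t * (if \<bar>t\<bar> \<le> real n then t else 0)) = (\<lambda>t. indicator S t * (t - 0))"
      by (rule indicator_truncation[OF S(2) elim])
    show ?case
      unfolding Phi_indicator_mult[OF S(1) truncation_bounded, symmetric] eq by simp
  qed
  then show "(\<lambda>n. E S (\<Phi> (\<lambda>t. if \<bar>t\<bar> \<le> real n then t else 0) x)) \<longlonglongrightarrow> \<Phi> (\<lambda>t. indicator S t * t) x"
    by (rule tendsto_eventually)
qed

lemma Phi_indicator_affine:
  assumes S: "S \<in> sets borel" "\<And>t. t \<in> S \<Longrightarrow> \<bar>t\<bar> \<le> m"
  shows "\<Phi> (\<lambda>t. indicator S t * (t - c)) x = \<Phi> (\<lambda>t. indicator S t * t) x - c *\<^sub>R E S x"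
proof -
  have "(\<lambda>t. indicator S t * (t - c)) = (\<lambda>t. indicator S t * t - c * indicator S t)"
    by (auto simp: algebra_simps)
  moreover have "bounded_borel (\<lambda>t. indicator S t * t)"
    using indicator_affine_bounded[of S m 0, OF S] by simp
  ultimately show ?thesis
    using S(1) by (simp add: Phi_diff Phi_scale Phi_indicator bounded_borel_intros blin_simps)
qed

text \<open>On the spectral subspace of a set at distance at least \<rho> from c, the operator T - c
  expands norms at least by the factor \<rho>. Boundedness of S makes the restriction of the
  unbounded T a bounded integral.\<close>

lemma T_lower_bound:
  assumes xy: "(x, y) \<in> T" and S: "S \<in> sets borel" "\<And>t. t \<in> S \<Longrightarrow> \<bar>t\<bar> \<le> m"
    and \<rho>: "\<And>t. t \<in> S \<Longrightarrow> \<rho> \<le> \<bar>t - c\<bar>" "0 \<le> \<rho>"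
  shows "\<rho> * norm (E S x) \<le> norm (E S (y - c *\<^sub>R x))"
proof -
  let ?g = "\<lambda>t. indicator S t * (t - c)"
  have g: "bounded_borel ?g" using S by (rule indicator_affine_bounded)
  have eq: "E S (y - c *\<^sub>R x) = \<Phi> ?g x"
    using T_restrict[OF xy S] Phi_indicator_affine[OF S] by (simp add: blin_simps)
  have "\<rho>\<^sup>2 * (norm (E S x))\<^sup>2 = (\<integral>t. \<rho>\<^sup>2 * indicator S t \<partial>\<mu> x)"
    using S(1) by (simp add: measure_mu_norm)
  also have "\<dots> \<le> (\<integral>t. (?g t)\<^sup>2 \<partial>\<mu> x)"
  proof (intro integral_mono bounded_borel_integrable)
    show "bounded_borel (\<lambda>t. \<rho>\<^sup>2 * indicator S t)" using S(1) by (intro bounded_borel_intros)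
    show "bounded_borel (\<lambda>t. (?g t)\<^sup>2)"
      unfolding power2_eq_square by (rule bounded_borel_mult[OF g g])
    show "\<rho>\<^sup>2 * indicator S t \<le> (?g t)\<^sup>2" for t
      using \<rho> by (auto simp: indicator_def abs_le_square_iff[symmetric])
  qed
  also have "\<dots> = (norm (E S (y - c *\<^sub>R x)))\<^sup>2"
    unfolding eq by (rule norm_Phi[OF g, symmetric])
  finally show ?thesis
    unfolding power_mult_distrib[symmetric] by (rule power2_le_imp_le) simp
qed

lemma measure_mu_compl: "S \<in> sets borel \<Longrightarrow> measure (\<mu> x) (- S) = (norm (x - E S x))\<^sup>2"
  using finite_measure.finite_measure_compl[OF finite_measure_mu, of S x]
  by (simp add: Compl_eq_Diff_UNIV measure_mu_UNIV measure_mu_norm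
      is_projection_diff_norm[OF E_projection])

text \<open>The sequence \<open>y\<close> plays the role of \<open>y k = (T - c)\<^sup>k (y 0)\<close>.\<close>

lemma E_interval_iterates:
  assumes y: "\<And>k. (y k, y (Suc k) + c *\<^sub>R y k) \<in> T" and K: "\<And>k. norm (y k) \<le> K * r ^ k"
    and r: "0 \<le> r"
  shows "E {c - r..c + r} (y 0) = y 0"
proof -
  \<comment> \<open>The component of y k in S grows at least like \<rho>^k, while y k itself is
    O(r^k) with r < \<rho>; so the component of y 0 vanishes.\<close>
  have zero: "E S (y 0) = 0"
    if S: "S \<in> sets borel" "\<And>t. t \<in> S \<Longrightarrow> \<bar>t\<bar> \<le> m" "\<And>t. t \<in> S \<Longrightarrow> \<rho> \<le> \<bar>t - c\<bar>" and "r < \<rho>"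
    for S m \<rho>
  proof -
    have \<rho>: "0 < \<rho>" using r \<open>r < \<rho>\<close> by simp
    have step: "\<rho> ^ k * norm (E S (y 0)) \<le> norm (E S (y k))" for k
    proof (induction k)
      case (Suc k)
      have "\<rho> ^ Suc k * norm (E S (y 0)) \<le> \<rho> * norm (E S (y k))"
        using mult_left_mono[OF Suc, of \<rho>] \<rho> by (simp add: mult.assoc)
      also have "\<dots> \<le> norm (E S (y (Suc k)))"
        using T_lower_bound[OF y S, of k] \<rho> by simp
      finally show ?case .
    qed simp
    have "norm (E S (y 0)) \<le> K * (r / \<rho>) ^ k" for k
    proof -
      have "norm (E S (y k)) \<le> norm (y k)" by (rule is_projection_norm_le[OF E_projection[OF S(1)]])
      then have "\<rho> ^ k * norm (E S (y 0)) \<le> K * r ^ k"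
        using step[of k] K[of k] by linarith
      then show ?thesis using \<rho> by (simp add: power_divide field_simps)
    qed
    moreover have "(\<lambda>k. K * (r / \<rho>) ^ k) \<longlonglongrightarrow> K * 0"
      using r \<rho> \<open>r < \<rho>\<close> by (intro tendsto_intros LIMSEQ_realpow_zero) auto
    ultimately have "norm (E S (y 0)) \<le> K * 0"
      by (intro LIMSEQ_le_const) auto
    then show ?thesis by simp
  qed
  \<comment> \<open>These sets exhaust the complement of the interval: the inverse keeps them at a
    distance greater than r from c, and the cutoff by n keeps them bounded.\<close>
  define X where "X n = {t. r + inverse (real (Suc n)) \<le> \<bar>t - c\<bar> \<and> \<bar>t\<bar> \<le> real n}" for n
  have X: "X n \<in> sets borel" for n unfolding X_def by measurable
  have "E (X n) (y 0) = 0" for n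
    by (rule zero[OF X, of n "real n" "r + inverse (real (Suc n))"]) (auto simp: X_def)
  then have "emeasure (\<mu> (y 0)) (X n) = 0" for n
    by (simp add: emeasure_mu[OF X] rinner.zero_right)
  then have "emeasure (\<mu> (y 0)) (\<Union>n. X n) = 0"
    using X by (intro emeasure_UN_eq_0) auto
  moreover have "(\<Union>n. X n) = - {c - r..c + r}"
  proof (intro equalityI subsetI)
    fix t assume t: "t \<in> - {c - r..c + r}"
    then have "0 < \<bar>t - c\<bar> - r" by (auto simp: abs_if)
    then obtain n where n: "inverse (real (Suc n)) < \<bar>t - c\<bar> - r"
      using reals_Archimedean by blast
    obtain m where m: "\<bar>t\<bar> \<le> real m" using real_arch_simple by blast
    have "inverse (real (Suc (max n m))) \<le> inverse (real (Suc n))" by simp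
    moreover have "real m \<le> real (max n m)" by simp
    ultimately have "t \<in> X (max n m)"
      unfolding X_def mem_Collect_eq using n m by linarith
    then show "t \<in> (\<Union>n. X n)" by blast
  next
    fix t assume "t \<in> (\<Union>n. X n)"
    then obtain n where "r + inverse (real (Suc n)) \<le> \<bar>t - c\<bar>" by (auto simp: X_def)
    moreover have "0 < inverse (real (Suc n))" by simp
    ultimately have "r < \<bar>t - c\<bar>" by linarith
    then show "t \<in> - {c - r..c + r}" by (auto simp: abs_if split: if_splits)
  qed
  ultimately have "measure (\<mu> (y 0)) (- {c - r..c + r}) = 0" by (simp add: measure_def)
  then show ?thesis using measure_mu_compl[of "{c - r..c + r}" "y 0"] by simp
qed

text \<open>Vectors in the range of a bounded interval lie in the domain of T, where T - c acts as a
  bounded operator. It maps that range into itself, so its iterates supply the converse of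
  \<open>E_interval_iterates\<close>.\<close>

lemma T_on_interval:
  assumes z: "E {c - r..c + r} z = z"
  shows "(z, \<Phi> (\<lambda>t. indicator {c - r..c + r} t * (t - c)) z + c *\<^sub>R z) \<in> T"
proof -
  let ?I = "{c - r..c + r}"
  define m where "m = \<bar>c\<bar> + \<bar>r\<bar>"
  have I: "?I \<in> sets borel" by simp
  have m: "\<bar>t\<bar> \<le> m" if "t \<in> ?I" for t using that by (auto simp: m_def)
  have AE: "AE t in \<mu> z. t \<in> ?I"
  proof (rule AE_I[of _ _ "- ?I"])
    have "measure (\<mu> z) (- ?I) = 0" using measure_mu_compl[OF I, of z] z by simp
    then show "emeasure (\<mu> z) (- ?I) = 0"
      by (simp add: finite_measure.emeasure_eq_measure[OF finite_measure_mu])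
  qed auto
  have "integrable (\<mu> z) (\<lambda>t. t\<^sup>2)"
  proof (rule finite_measure.integrable_const_bound[OF finite_measure_mu, where B = "m\<^sup>2"])
    show "AE t in \<mu> z. norm (t\<^sup>2) \<le> m\<^sup>2"
      using AE
    proof eventually_elim
      case (elim t)
      have "\<bar>t\<bar>\<^sup>2 \<le> m\<^sup>2" by (intro power_mono m elim) simp
      then show ?case by simp
    qed
  qed simp
  moreover have "(\<lambda>n. \<Phi> (\<lambda>t. if \<bar>t\<bar> \<le> real n then t else 0) z) \<longlonglongrightarrow>
      \<Phi> (\<lambda>t. indicator ?I t * (t - c)) z + c *\<^sub>R z"
  proof (rule tendsto_eventually)
    have "eventually (\<lambda>n. m \<le> real n) sequentially"
      using filterlim_real_sequentially by (simp add: filterlim_at_top)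
    then show "eventually (\<lambda>n. \<Phi> (\<lambda>t. if \<bar>t\<bar> \<le> real n then t else 0) z =
        \<Phi> (\<lambda>t. indicator ?I t * (t - c)) z + c *\<^sub>R z) sequentially"
    proof eventually_elim
      case (elim n)
      have eq: "(\<lambda>t. indicator ?I t * (if \<bar>t\<bar> \<le> real n then t else 0)) = (\<lambda>t. indicator ?I t * (t - 0))"
        by (rule indicator_truncation[OF m elim])
      have "\<Phi> (\<lambda>t. if \<bar>t\<bar> \<le> real n then t else 0) z = E ?I (\<Phi> (\<lambda>t. if \<bar>t\<bar> \<le> real n then t else 0) z)"
        unfolding Phi_commutes_E[OF truncation_bounded I] z ..
      also have "\<dots> = \<Phi> (\<lambda>t. indicator ?I t * (t - 0)) z"
        unfolding Phi_indicator_mult[OF I truncation_bounded, symmetric] eq ..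
      finally show ?case using Phi_indicator_affine[OF I m, of c z] z by simp
    qed
  qed
  ultimately show ?thesis by (simp add: spectral_integral_def)
qed

lemma interval_iterates_exist:
  assumes z: "E {c - r..c + r} z = z" and r: "0 \<le> r"
  shows "\<exists>y. y 0 = z \<and> (\<forall>k. (y k, y (Suc k) + c *\<^sub>R y k) \<in> T \<and> norm (y k) \<le> norm z * r ^ k)"
proof -
  define B where "B = \<Phi> (\<lambda>t. indicator {c - r..c + r} t * (t - c))"
  define y where "y k = (blinfun_apply B ^^ k) z" for k
  have bb: "bounded_borel (\<lambda>t. indicator {c - r..c + r} t * (t - c))"
    by (rule indicator_affine_bounded[of _ "\<bar>c\<bar> + \<bar>r\<bar>"]) auto
  have y: "y 0 = z" "y (Suc k) = B (y k)" for k by (simp_all add: y_def)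
  have "E {c - r..c + r} (y k) = y k" for k
    by (induction k) (simp_all add: y z B_def Phi_commutes_E[OF bb])
  then have "(y k, y (Suc k) + c *\<^sub>R y k) \<in> T" for k
    using T_on_interval by (simp add: y B_def)
  moreover have "norm (y k) \<le> norm z * r ^ k" for k
  proof (induction k)
    case (Suc k)
    have "norm (y (Suc k)) \<le> r * norm (y k)"
      unfolding y B_def by (rule norm_Phi_le[OF bb]) (use r in \<open>auto simp: indicator_def abs_if\<close>)
    also have "\<dots> \<le> r * (norm z * r ^ k)" using Suc r by (rule mult_left_mono)
    finally show ?case by (simp add: ac_simps)
  qed (simp add: y)
  ultimately show ?thesis using y by blast
qed

end

lemma is_projection_eqI:
  assumes P: "is_projection P" and Q: "is_projection Q"
    and range: "\<And>x. blinfun_apply P x = x \<longleftrightarrow> blinfun_apply Q x = x"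
  shows "P = Q"
proof (rule symop_eqI)
  have QP: "Q (P x) = P x" for x using range is_projectionD(2)[OF P] by blast
  have PQ: "P (Q x) = Q x" for x using range is_projectionD(2)[OF Q] by blast
  fix x
  have "rinner x (P x) = rinner x (Q (P x))" by (simp add: QP)
  also have "\<dots> = rinner (P (Q x)) x"
    using symopD[OF is_projectionD(1)[OF P]] symopD[OF is_projectionD(1)[OF Q]] by metis
  also have "\<dots> = rinner x (Q x)" unfolding PQ by (rule rinner_commute)
  finally show "rinner x (P x) = rinner x (Q x)" .
qed (use P Q in \<open>simp_all add: is_projectionD\<close>)

text \<open>The range of \<open>E {c - r..c + r}\<close> consists of the vectors with iterates \<open>(T - c)\<^sup>k x\<close> of size
  \<open>O(r\<^sup>k)\<close>, hence depends on \<open>T\<close> only.\<close>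

lemma pvm_unique:
  assumes E: "pvm E" and E': "pvm E'"
    and eq: "spectral_integral E (\<lambda>t. t) = spectral_integral E' (\<lambda>t. t)"
    and S: "S \<in> sets borel"
  shows "E S = E' S"
proof -
  interpret E: spectral_pvm E by unfold_locales fact
  interpret E': spectral_pvm E' by unfold_locales fact
  have icc: "E {a..b} = E' {a..b}" for a b
  proof (cases "a \<le> b")
    case True
    define c r where "c = (a + b) / 2" and "r = (b - a) / 2"
    have ab: "{a..b} = {c - r..c + r}" and r: "0 \<le> r"
      using True by (auto simp: c_def r_def field_simps)
    show ?thesis
      unfolding ab
    proof (rule is_projection_eqI)
      show "is_projection (E {c - r..c + r})" "is_projection (E' {c - r..c + r})"
        by (simp_all add: E.E_projection E'.E_projection)
      show "E {c - r..c + r} x = x \<longleftrightarrow> E' {c - r..c + r} x = x" for x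
      proof
        assume "E {c - r..c + r} x = x"
        from E.interval_iterates_exist[OF this r] obtain y where "y 0 = x"
          "\<And>k. (y k, y (Suc k) + c *\<^sub>R y k) \<in> E'.T" "\<And>k. norm (y k) \<le> norm x * r ^ k"
          unfolding eq by blast
        with E'.E_interval_iterates[of y c "norm x" r] r show "E' {c - r..c + r} x = x" by simp
      next
        assume "E' {c - r..c + r} x = x"
        from E'.interval_iterates_exist[OF this r] obtain y where "y 0 = x"
          "\<And>k. (y k, y (Suc k) + c *\<^sub>R y k) \<in> E.T" "\<And>k. norm (y k) \<le> norm x * r ^ k"
          unfolding eq by blast
        with E.E_interval_iterates[of y c "norm x" r] r show "E {c - r..c + r} x = x" by simp
      qed
    qed
  next
    case False
    then show ?thesis by (simp add: E.E_empty E'.E_empty)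
  qed
  have "scalar_measure E x = scalar_measure E' x" for x
  proof (rule measure_eqI_generator_eq)
    let ?G = "range (\<lambda>(a, b). {a..b::real})"
    show "Int_stable ?G" by (auto simp: Int_stable_def)
    show "sets (scalar_measure E x) = sigma_sets UNIV ?G" "sets (scalar_measure E' x) = sigma_sets UNIV ?G"
      by (simp_all add: borel_eq_atLeastAtMost)
    show "emeasure (scalar_measure E x) X = emeasure (scalar_measure E' x) X" if "X \<in> ?G" for X
      using that icc by (auto simp: E.emeasure_mu E'.emeasure_mu)
    show "range (\<lambda>n::nat. {- real n..real n}) \<subseteq> ?G" by auto
    have "\<exists>n. - real n \<le> t \<and> t \<le> real n" for t
      using real_arch_simple[of "\<bar>t\<bar>"] by (metis abs_le_iff minus_le_iff)
    then show "(\<Union>n::nat. {- real n..real n}) = UNIV" by auto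
    show "emeasure (scalar_measure E x) {- real n..real n} \<noteq> \<infinity>" for n :: nat
      by (simp add: E.emeasure_mu)
  qed simp
  then have "measure (scalar_measure E x) S = measure (scalar_measure E' x) S" for x by simp
  then show ?thesis
    using S by (intro symop_eqI) (simp_all add: E.E_symop E'.E_symop E.measure_mu E'.measure_mu)
qed


subsection \<open>The spectral measure of an operator\<close>

lemma spectral_integral_cong:
  assumes "\<And>S. S \<in> sets borel \<Longrightarrow> E S = E' S"
  shows "spectral_integral E g = spectral_integral E' g"
proof -
  have "scalar_measure E = scalar_measure E'"
  proof
    fix x
    show "scalar_measure E x = scalar_measure E' x"
      unfolding scalar_measure_def
    proof (rule measure_of_eq)
      fix S :: "real set" assume "S \<in> sigma_sets UNIV (sets borel)"
      then have "S \<in> sets borel" using sets.sigma_sets_eq[of "borel :: real measure"] by simp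
      then show "ennreal (Re (cinner x (E S x))) = ennreal (Re (cinner x (E' S x)))"
        by (simp add: assms)
    qed simp
  qed
  then show ?thesis
    by (simp add: spectral_integral_def bounded_spectral_integral_def)
qed

text \<open>A Riemann sum argument. On the range of the projection of (a, b] both A and its
  candidate integral B have quadratic forms between a and b, so their difference D is at most b - a
  there. Summing over a partition bounds the form of D by the mesh times the squared norm of
  x.\<close>

lemma (in spectral_family) spectral_integral_E:
  assumes A: "A \<in> bounded_ops"
  shows "spectral_integral E (\<lambda>t. t) = graph_of A"
proof -
  interpret E: spectral_pvm E by unfold_locales (rule pvm_E[OF A])
  \<comment> \<open>Strictly larger than the norm of A, so that \<open>P (- R)\<close> is zero and
    \<open>P R\<close> is the identity; the half-open interval then carries all of E.\<close>
  define R where "R = norm A + 1"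
  have R: "norm A < R" "0 < R" using norm_ge_zero[of A] by (simp_all add: R_def add_nonneg_pos)
  let ?S = "{- R<..R}" and ?g = "\<lambda>t. indicator {- R<..R} t * t"
  have ES: "E ?S = id_blinfun"
  proof -
    have "E ?S = P R - P (- R)" using R by (intro E_Ioc) simp
    then show ?thesis using R by (intro blinfun_eqI) (simp add: blin_simps P_zero P_id)
  qed
  have absS: "\<bar>t\<bar> \<le> R" if "t \<in> ?S" for t using that by auto
  have g: "bounded_borel ?g"
  proof (rule bounded_borelI[of _ R])
    show "\<bar>?g t\<bar> \<le> R" for t using absS[of t] R by (cases "t \<in> ?S") auto
  qed simp
  define B where "B = E.\<Phi> ?g"
  have symB: "symop B" unfolding B_def by (rule E.Phi_symop[OF g])
  define D where "D = A - B"
  have D_bound: "\<bar>rinner x (D (P b x)) - rinner x (D (P a x))\<bar> \<le> (b - a) * (F x b - F x a)"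
    if ab: "a \<le> b" "- R \<le> a" "b \<le> R" for a b x
  proof -
    define z where "z = E {a<..b} x"
    have z: "z = P b x - P a x" by (simp add: z_def E_Ioc ab blin_simps)
    have Pz: "P b z = z" "P a z = 0" using ab commP[of b a] by (simp_all add: z blin_simps idem P_P)
    have nz: "(norm z)\<^sup>2 = F x b - F x a"
      unfolding z_def E.measure_mu_norm[symmetric, of "{a<..b}", simplified]
      using ab by (simp add: E.measure_mu E_Ioc blin_simps rinner_simps F_def)
    have EA: "E {a<..b} (A v) = A (E {a<..b} v)" for v
      using commutesD[OF E_commutes[OF _ commutes_refl], of "{a<..b}" v] by simp
    have EB: "E {a<..b} (B v) = B (E {a<..b} v)" for v
      unfolding B_def by (rule E.Phi_commutes_E[OF g]) simp
    have "rinner x (D (P b x)) - rinner x (D (P a x)) = rinner x (D z)"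
      by (simp add: z blin_simps rinner_simps)
    \<comment> \<open>D commutes with the projections, so the form of D has no cross terms between
      different pieces of the partition and the pieces can be summed.\<close>
    also have "\<dots> = rinner z (D z)"
    proof -
      have "D z = E {a<..b} (D z)"
        unfolding D_def z_def by (simp add: blin_simps EA EB E.E_Int)
      then show ?thesis
        using symopD[OF E.E_symop[of "{a<..b}"], of x "D z"] by (simp add: z_def)
    qed
    also have "\<dots> = rinner z (A z) - rinner z (B z)" by (simp add: D_def blin_simps rinner_simps)
    finally have eq: "rinner x (D (P b x)) - rinner x (D (P a x)) = rinner z (A z) - rinner z (B z)" .
    have A_bounds: "a * (norm z)\<^sup>2 \<le> rinner z (A z)" "rinner z (A z) \<le> b * (norm z)\<^sup>2"
      using upper[OF Pz(1)] lower[OF Pz(2)] by auto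
    have bb: "bounded_borel (\<lambda>t. indicator {a<..b} t * ?g t)"
      by (rule bounded_borel_mult[OF bounded_borel_indicator g]) simp
    have "rinner z (B z) = rinner x (E {a<..b} (B x))"
    proof -
      have "rinner z (B z) = rinner x (E {a<..b} (B z))"
        using symopD[OF E.E_symop[of "{a<..b}"], of x "B z"] by (simp add: z_def)
      then show ?thesis by (simp add: z_def EB E.E_Int)
    qed
    also have "\<dots> = rinner x (E.\<Phi> (\<lambda>t. indicator {a<..b} t * ?g t) x)"
      unfolding B_def by (rule arg_cong[where f = "rinner x"], rule E.Phi_indicator_mult[symmetric, OF _ g]) simp
    also have "\<dots> = (\<integral>t. indicator {a<..b} t * ?g t \<partial>E.\<mu> x)"
      by (rule E.rinner_Phi[OF bb])
    finally have Bz: "rinner z (B z) = (\<integral>t. indicator {a<..b} t * ?g t \<partial>E.\<mu> x)" .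
    have mz: "measure (E.\<mu> x) {a<..b} = (norm z)\<^sup>2"
      by (simp add: E.measure_mu_norm z_def)
    have int_c: "(\<integral>t. c * indicator {a<..b} t \<partial>E.\<mu> x) = c * (norm z)\<^sup>2" for c
      by (simp add: mz)
    have bc: "bounded_borel (\<lambda>t. c * indicator {a<..b} t)" for c
      by (intro bounded_borel_intros) auto
    have "a * (norm z)\<^sup>2 \<le> rinner z (B z)"
      unfolding Bz int_c[symmetric]
      by (intro integral_mono E.bounded_borel_integrable bb bc) (use ab in \<open>auto simp: indicator_def\<close>)
    moreover have "rinner z (B z) \<le> b * (norm z)\<^sup>2"
      unfolding Bz int_c[symmetric]
      by (intro integral_mono E.bounded_borel_integrable bb bc) (use ab in \<open>auto simp: indicator_def\<close>)
    ultimately show ?thesis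
      unfolding eq nz[symmetric] using A_bounds by (simp add: abs_le_iff left_diff_distrib)
  qed
  have "rinner x (D x) = 0" for x
  proof -
    have bound: "\<bar>rinner x (D x)\<bar> \<le> 2 * R * (norm x)\<^sup>2 / real (Suc n)" for n
    proof -
      define s where "s k = - R + real k * (2 * R / real (Suc n))" for k
      have s_step: "s (Suc k) - s k = 2 * R / real (Suc n)" for k
        by (simp only: s_def of_nat_Suc distrib_right)
      have s_mono: "s k \<le> s (Suc k)" for k
        using s_step[of k] R by (smt (verit) divide_nonneg_nonneg of_nat_0_le_iff)
      have s_bounds: "- R \<le> s k" "k \<le> Suc n \<Longrightarrow> s k \<le> R" for k
      proof -
        show "- R \<le> s k" using R by (simp add: s_def)
        assume "k \<le> Suc n"
        then have "real k * (2 * R / real (Suc n)) \<le> real (Suc n) * (2 * R / real (Suc n))"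
          using R by (intro mult_right_mono) auto
        then show "s k \<le> R" by (simp add: s_def)
      qed
      have "\<bar>rinner x (D (P (s k) x)) - rinner x (D (P (s 0) x))\<bar> \<le>
          2 * R / real (Suc n) * (F x (s k) - F x (s 0))" if "k \<le> Suc n" for k
        using that
      proof (induction k)
        case (Suc k)
        have "\<bar>rinner x (D (P (s (Suc k)) x)) - rinner x (D (P (s k) x))\<bar> \<le>
            2 * R / real (Suc n) * (F x (s (Suc k)) - F x (s k))"
          using D_bound[OF s_mono s_bounds(1) s_bounds(2)[OF Suc.prems], where x = x]
          unfolding s_step .
        moreover have "\<bar>rinner x (D (P (s k) x)) - rinner x (D (P (s 0) x))\<bar> \<le>
            2 * R / real (Suc n) * (F x (s k) - F x (s 0))"
          using Suc by simp
        ultimately show ?case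
          unfolding right_diff_distrib by linarith
      qed simp
      from this[of "Suc n"] have "\<bar>rinner x (D (P (s (Suc n)) x)) - rinner x (D (P (s 0) x))\<bar> \<le>
          2 * R / real (Suc n) * (F x (s (Suc n)) - F x (s 0))" by simp
      moreover have "s 0 = - R" "s (Suc n) = R" by (simp_all add: s_def)
      ultimately show ?thesis
        using R by (simp add: P_zero P_id F_norm blin_simps rinner_simps)
    qed
    have "(\<lambda>n. 2 * R * (norm x)\<^sup>2 / real (Suc n)) \<longlonglongrightarrow> 0"
      using tendsto_mult_right_zero[OF LIMSEQ_inverse_real_of_nat, of "2 * R * (norm x)\<^sup>2"]
      by (simp add: divide_inverse)
    then have "\<bar>rinner x (D x)\<bar> \<le> 0"
      using bound by (intro LIMSEQ_le_const) auto
    then show ?thesis by simp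
  qed
  then have "A = B"
    by (intro symop_eqI symA symB) (simp add: D_def blin_simps rinner_simps)
  moreover have "spectral_integral E (\<lambda>t. t) = graph_of B"
    unfolding B_def using absS by (intro E.spectral_integral_bounded[OF _ _ ES, of _ R]) auto
  ultimately show ?thesis by simp
qed

theorem spectral_theorem:
  assumes "A \<in> bounded_ops" "symop A"
  obtains E where "pvm E" "spectral_integral E (\<lambda>t. t) = graph_of A"
    "\<And>S C. S \<in> sets borel \<Longrightarrow> commutes C A \<Longrightarrow> commutes C (E S)"
proof -
  obtain P where "spectral_family A P" using spectral_family_exists[OF assms(2)] by blast
  then interpret spectral_family A P .
  show thesis using that[OF pvm_E spectral_integral_E E_commutes] assms by blast
qed

text \<open>Determines the chosen spectral measure from any known one: the choice again satisfies
  the defining property, and uniqueness forces agreement on Borel sets.\<close>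

lemma spectral_measure_spec:
  assumes "pvm E" "T = spectral_integral E (\<lambda>t. t)"
  shows "pvm (spectral_measure T)" "T = spectral_integral (spectral_measure T) (\<lambda>t. t)"
    "S \<in> sets borel \<Longrightarrow> spectral_measure T S = E S"
proof -
  have *: "pvm (spectral_measure T) \<and> T = spectral_integral (spectral_measure T) (\<lambda>t. t)"
    unfolding spectral_measure_def by (rule someI[of _ E]) (use assms in blast)
  then show "pvm (spectral_measure T)" "T = spectral_integral (spectral_measure T) (\<lambda>t. t)"
    by blast+
  show "spectral_measure T S = E S" if "S \<in> sets borel"
    using pvm_unique[of "spectral_measure T" E S] * assms that by metis
qed

text \<open>The pushforward of E along g. By uniqueness it is the spectral measure of the integral
  of g, for unbounded g as well, which covers the logarithm.\<close>

lemma (in spectral_pvm) pvm_vimage: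
  assumes g: "g \<in> borel_measurable borel"
  shows "pvm (\<lambda>S. E (g -` S))"
proof -
  have meas: "g -` S \<in> sets borel" if "S \<in> sets borel" for S
    using measurable_sets[OF g that] by simp
  show ?thesis
    unfolding pvm_def
  proof (intro conjI ballI allI impI; (elim conjE)?)
    fix S :: "real set" assume S: "S \<in> sets borel"
    show "E (g -` S) \<in> bounded_ops" by (rule E_bounded_ops[OF meas[OF S]])
    then show "adj (E (g -` S)) = E (g -` S)"
      using adj_eq_iff_symop E_symop[OF meas[OF S]] by blast
    fix S' :: "real set" assume S': "S' \<in> sets borel"
    show "E (g -` (S \<inter> S')) = E (g -` S) o\<^sub>L E (g -` S')"
      by (rule blinfun_eqI) (simp add: E_Int meas S S')
  next
    fix X :: "nat \<Rightarrow> real set" and x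
    assume X: "range X \<subseteq> sets borel" "disjoint_family X"
    have "(\<lambda>n. E (g -` X n) x) sums E (\<Union>n. g -` X n) x"
      using X meas by (intro E_sums) (auto simp: disjoint_family_on_def)
    then show "(\<lambda>n. E (g -` X n) x) sums E (g -` (\<Union>n. X n)) x" by (simp add: vimage_UN)
  qed (simp add: E_UNIV)
qed

lemma (in spectral_pvm) spectral_integral_vimage:
  assumes g: "g \<in> borel_measurable borel" and u: "u \<in> borel_measurable borel"
  shows "spectral_integral (\<lambda>S. E (g -` S)) u = spectral_integral E (\<lambda>t. u (g t))"
proof -
  interpret G: spectral_pvm "\<lambda>S. E (g -` S)" by unfold_locales (rule pvm_vimage[OF g])
  have sm: "G.\<mu> x = distr (\<mu> x) borel g" for x
  proof (rule measure_eqI)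
    fix S assume "S \<in> sets (G.\<mu> x)"
    then have "S \<in> sets borel" by simp
    then show "emeasure (G.\<mu> x) S = emeasure (distr (\<mu> x) borel g) S"
      using g measurable_sets[OF g] by (simp add: G.emeasure_mu emeasure_mu emeasure_distr)
  qed simp
  have int: "integral\<^sup>L (G.\<mu> x) v = (\<integral>t. v (g t) \<partial>\<mu> x)" if "v \<in> borel_measurable borel" for v :: "real \<Rightarrow> real" and x
    unfolding sm using that g by (simp add: integral_distr)
  have "integrable (G.\<mu> x) (\<lambda>t. (u t)\<^sup>2) \<longleftrightarrow> integrable (\<mu> x) (\<lambda>t. (u (g t))\<^sup>2)" for x
    unfolding sm using g u by (simp add: integrable_distr_eq)
  \<comment> \<open>Both sides are definite descriptions, and after the change of variables their
    defining conditions coincide.\<close>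
  moreover have "G.\<Phi> (\<lambda>t. if \<bar>u t\<bar> \<le> real n then u t else 0) =
      \<Phi> (\<lambda>t. if \<bar>u (g t)\<bar> \<le> real n then u (g t) else 0)" for n
    unfolding bounded_spectral_integral_def using u by (simp add: int)
  ultimately show ?thesis by (simp add: spectral_integral_def)
qed

lemma graph_of_inject: "graph_of A = graph_of B \<longleftrightarrow> A = B"
  by (auto simp: graph_of_def intro!: blinfun_eqI)

lemma (in spectral_pvm) fun_calc_spectral_integral:
  assumes g: "g \<in> borel_measurable borel" and u: "u \<in> borel_measurable borel"
  shows "fun_calc u (spectral_integral E g) = spectral_integral E (\<lambda>t. u (g t))"
proof -
  have eq: "spectral_integral E g = spectral_integral (\<lambda>S. E (g -` S)) (\<lambda>t. t)"
    using spectral_integral_vimage[OF g, of "\<lambda>t. t"] by simp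
  have "fun_calc u (spectral_integral E g) = spectral_integral (\<lambda>S. E (g -` S)) u"
    unfolding fun_calc_def
    by (intro spectral_integral_cong spectral_measure_spec(3)[OF pvm_vimage[OF g] eq])
  then show ?thesis by (simp add: spectral_integral_vimage[OF g u])
qed

lemma (in spectral_pvm) graph_of_Phi:
  assumes "bounded_borel g"
  shows "graph_of (\<Phi> g) = spectral_integral E g"
proof -
  obtain C where "\<And>t. \<bar>g t\<bar> \<le> C" using assms by (auto simp: bounded_borel_def)
  with spectral_integral_bounded[of g UNIV C] assms show ?thesis
    by (simp add: bounded_borel_measurable E_UNIV)
qed

lemma (in spectral_pvm) exp_op_Phi:
  assumes g: "bounded_borel g"
  shows "exp_op (\<Phi> g) = \<Phi> (\<lambda>t. exp (g t))" and "bounded_borel (\<lambda>t. exp (g t))"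
proof -
  obtain C where C: "\<And>t. \<bar>g t\<bar> \<le> C" using g by (auto simp: bounded_borel_def)
  show bb: "bounded_borel (\<lambda>t. exp (g t))"
    using C bounded_borel_measurable[OF g]
    by (intro bounded_borelI[of _ "exp C"]) (auto simp: abs_le_iff)
  have "fun_calc exp (graph_of (\<Phi> g)) = graph_of (\<Phi> (\<lambda>t. exp (g t)))"
    unfolding graph_of_Phi[OF g] graph_of_Phi[OF bb]
    by (intro fun_calc_spectral_integral bounded_borel_measurable[OF g]) simp
  then show "exp_op (\<Phi> g) = \<Phi> (\<lambda>t. exp (g t))"
    unfolding exp_op_def by (auto simp: graph_of_inject Phi_bounded_ops[OF bb])
qed


subsection \<open>Traces of spectral integrals\<close>

lemma von_neumann_algebra_memI:
  assumes "von_neumann_algebra M" "A \<in> bounded_ops" "\<And>C. C \<in> commutant M \<Longrightarrow> commutes C A"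
  shows "A \<in> M"
proof -
  have "C o\<^sub>L A = A o\<^sub>L C" if "C \<in> commutant M" for C
    using assms(3)[OF that] by (intro blinfun_eqI) (simp add: commutes_def)
  then have "A \<in> commutant (commutant M)" using assms(2) by (simp add: commutant_def)
  then show ?thesis using assms(1) by (simp add: von_neumann_algebra_def)
qed

lemma commutant_commutes:
  assumes "C \<in> commutant M" "A \<in> M"
  shows "commutes C A"
proof -
  have "A o\<^sub>L C = C o\<^sub>L A" using assms by (simp add: commutant_def)
  then show ?thesis unfolding commutes_def by (metis blinfun_apply_blinfun_compose)
qed

lemma von_neumann_algebra_bounded_ops: "von_neumann_algebra M \<Longrightarrow> A \<in> M \<Longrightarrow> A \<in> bounded_ops"
  by (auto simp: von_neumann_algebra_def)

lemma von_neumann_algebra_closed: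
  assumes "von_neumann_algebra M"
  shows "id_blinfun \<in> M" "A \<in> M \<Longrightarrow> B \<in> M \<Longrightarrow> A + B \<in> M" "A \<in> M \<Longrightarrow> B \<in> M \<Longrightarrow> A - B \<in> M"
    "A \<in> M \<Longrightarrow> r *\<^sub>R A \<in> M"
proof -
  have memI: "A \<in> M" if "\<And>C. (\<forall>X\<in>M. commutes C X) \<Longrightarrow> commutes C A" for A
  proof (rule von_neumann_algebra_memI[OF assms])
    \<comment> \<open>Scalar multiplications are themselves among the real-linear operators
      commuting with all of M, so the hypothesis on C already contains complex linearity of
      A.\<close>
    have "\<forall>X\<in>M. commutes (Blinfun (\<lambda>x. c *\<^sub>C x)) X" for c
      using von_neumann_algebra_bounded_ops[OF assms] bounded_ops_iff_commutes by blast
    then show "A \<in> bounded_ops" unfolding bounded_ops_iff_commutes using that by blast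
    show "commutes C A" if "C \<in> commutant M" for C
      using \<open>\<And>C. (\<forall>X\<in>M. commutes C X) \<Longrightarrow> commutes C A\<close> commutant_commutes[OF that] by blast
  qed
  show "id_blinfun \<in> M" by (rule memI) (rule commutes_id)
  show "A + B \<in> M" if "A \<in> M" "B \<in> M" using that by (intro memI commutes_add) auto
  show "A - B \<in> M" if "A \<in> M" "B \<in> M" using that by (intro memI commutes_diff) auto
  show "r *\<^sub>R A \<in> M" if "A \<in> M" using that by (intro memI commutes_scaleR) auto
qed

lemma scaleC_op_of_real: "scaleC_op (complex_of_real r) A = r *\<^sub>R A"
proof (rule blinfun_eqI)
  have "bounded_linear (\<lambda>x. complex_of_real r *\<^sub>C A x)"
    by (intro bounded_linear_compose[OF bounded_linear_scaleC] blinfun.bounded_linear_right)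
  then show "scaleC_op (complex_of_real r) A x = (r *\<^sub>R A) x" for x
    by (simp add: scaleC_op_def bounded_linear_Blinfun_apply scaleC_of_real blin_simps)
qed

lemma op_le_iff:
  "A \<in> bounded_ops \<Longrightarrow> B \<in> bounded_ops \<Longrightarrow> op_le A B \<longleftrightarrow> posop (B - A)"
  unfolding op_le_def positive_op_iff
  by (simp add: bounded_ops_iff_commutes commutes_diff)

lemma posop_add: "posop A \<Longrightarrow> posop B \<Longrightarrow> posop (A + B)"
  by (simp add: posop_def symop_add blin_simps rinner_simps)

lemma is_projection_posop: "is_projection P \<Longrightarrow> posop P"
  by (simp add: posop_def is_projectionD is_projection_norm)

locale traced_pvm = spectral_pvm E
  for E :: "real set \<Rightarrow> ('a::complex_hilbert \<Rightarrow>\<^sub>L 'a)" +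
  fixes M :: "('a \<Rightarrow>\<^sub>L 'a) set" and \<tau> :: "('a \<Rightarrow>\<^sub>L 'a) \<Rightarrow> complex"
  assumes vN: "von_neumann_algebra M" and trace: "finite_trace M \<tau>" and normal: "normal_on M \<tau>"
    and unit: "\<tau> id_blinfun = 1" and E_mem: "S \<in> sets borel \<Longrightarrow> E S \<in> M"
begin

lemmas M_closed = von_neumann_algebra_closed[OF vN]
lemmas M_bounded = von_neumann_algebra_bounded_ops[OF vN]

lemma Phi_mem: "bounded_borel g \<Longrightarrow> \<Phi> g \<in> M"
  by (rule von_neumann_algebra_memI[OF vN Phi_bounded_ops Phi_commutes])
    (auto intro: commutant_commutes E_mem)

lemma trace_add: "A \<in> M \<Longrightarrow> B \<in> M \<Longrightarrow> \<tau> (A + B) = \<tau> A + \<tau> B"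
  and trace_nonneg: "A \<in> M \<Longrightarrow> posop A \<Longrightarrow> 0 \<le> Re (\<tau> A)"
  and trace_real: "A \<in> M \<Longrightarrow> posop A \<Longrightarrow> Im (\<tau> A) = 0"
  using trace M_bounded by (auto simp: finite_trace_def positive_op_iff complex_is_Real_iff)

lemma trace_scaleR: "A \<in> M \<Longrightarrow> \<tau> (r *\<^sub>R A) = r * \<tau> A"
  using trace by (simp add: finite_trace_def scaleC_op_of_real[symmetric])

lemma trace_diff: "A \<in> M \<Longrightarrow> B \<in> M \<Longrightarrow> \<tau> (A - B) = \<tau> A - \<tau> B"
  using trace_add[of A "(- 1) *\<^sub>R B"] trace_scaleR[of B "- 1"] M_closed(4)[of B "- 1"] by simp

lemma trace_zero: "\<tau> 0 = 0"
  using trace_scaleR[OF M_closed(1), of 0] by simp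

lemma trace_mono: "A \<in> M \<Longrightarrow> B \<in> M \<Longrightarrow> posop (B - A) \<Longrightarrow> Re (\<tau> A) \<le> Re (\<tau> B)"
  using trace_nonneg[of "B - A"] M_closed(3)[of B A] by (simp add: trace_diff)

text \<open>Normality speaks of suprema of directed sets. The range of an increasing sequence is
  directed, and its strong limit is its least upper bound because order is tested on quadratic
  forms, which pass to the limit.\<close>

lemma trace_monotone_limit:
  assumes A: "\<And>n. A n \<in> M" "\<And>n. posop (A n)" and mono: "\<And>n. posop (A (Suc n) - A n)"
    and B: "B \<in> M" and lim: "\<And>x. (\<lambda>n. blinfun_apply (A n) x) \<longlonglongrightarrow> B x"
  shows "(\<lambda>n. Re (\<tau> (A n))) \<longlonglongrightarrow> Re (\<tau> B)"
proof -
  have sym: "symop B" by (rule symop_limit[OF posopD(1)[OF A(2)] lim])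
  have inc: "incseq (\<lambda>n. rinner x (A n x))" for x
    using posopD(2)[OF mono, of x] by (intro incseq_SucI) (simp add: blin_simps rinner_simps)
  have qlim: "(\<lambda>n. rinner x (A n x)) \<longlonglongrightarrow> rinner x (B x)" for x
    by (intro rinner.tendsto tendsto_const lim)
  have le: "posop (A n - A m)" if "m \<le> n" for m n
    using incseqD[OF inc that] posopD(1)[OF A(2)]
    by (simp add: posop_def symop_diff blin_simps rinner_simps)
  have leB: "posop (B - A n)" for n
    using incseq_le[OF inc qlim] posopD(1)[OF A(2)] sym
    by (simp add: posop_def symop_diff blin_simps rinner_simps)
  have ops: "A n \<in> bounded_ops" "B \<in> bounded_ops" for n using A B M_bounded by auto
  have "is_sup_in M (range A) B"
    unfolding is_sup_in_def
  proof (intro conjI ballI impI B)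
    show "op_le X B" if "X \<in> range A" for X
      using that leB ops by (auto simp: op_le_iff)
    fix C assume C: "C \<in> M" "\<forall>X\<in>range A. op_le X C"
    then have CA: "posop (C - A n)" for n using op_le_iff[OF ops(1) M_bounded[OF C(1)]] by auto
    have "symop C" using symop_add[OF posopD(1)[OF CA[of 0]] posopD(1)[OF A(2)[of 0]]] by simp
    moreover have "rinner x (B x) \<le> rinner x (C x)" for x
      using posopD(2)[OF CA, of x]
      by (intro LIMSEQ_le_const2[OF qlim]) (auto simp: blin_simps rinner_simps)
    ultimately have "posop (C - B)" using sym by (simp add: posop_def symop_diff blin_simps rinner_simps)
    then show "op_le B C" using op_le_iff[OF ops(2) M_bounded[OF C(1)]] by simp
  qed
  moreover have "\<exists>U\<in>range A. op_le X U \<and> op_le Y U" if "X \<in> range A" "Y \<in> range A" for X Y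
  proof -
    obtain m n where "X = A m" "Y = A n" using \<open>X \<in> range A\<close> \<open>Y \<in> range A\<close> by auto
    then have "op_le X (A (max m n)) \<and> op_le Y (A (max m n))"
      using le ops by (simp add: op_le_iff)
    then show ?thesis by blast
  qed
  moreover have "\<forall>X\<in>range A. positive_op X" using A ops by (simp add: positive_op_iff)
  moreover have "range A \<subseteq> M" "range A \<noteq> {}" using A by auto
  ultimately have "Re (\<tau> B) = (SUP X\<in>range A. Re (\<tau> X))"
    using normal unfolding normal_on_def by blast
  also have "\<dots> = (SUP n. Re (\<tau> (A n)))" by (simp add: image_image)
  finally have sup: "Re (\<tau> B) = (SUP n. Re (\<tau> (A n)))" .
  have "bdd_above (range (\<lambda>n. Re (\<tau> (A n))))"
    using trace_mono[OF A(1) B leB] by (intro bdd_aboveI2)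
  moreover have "incseq (\<lambda>n. Re (\<tau> (A n)))"
    by (intro incseq_SucI trace_mono A mono)
  ultimately show ?thesis unfolding sup by (rule LIMSEQ_incseq_SUP)
qed

section \<open>The trace of a function of the operator as an integral over the measure \<nu>\<close>

definition \<nu> :: "real measure" where
  "\<nu> = measure_of UNIV (sets borel) (\<lambda>S. ennreal (Re (\<tau> (E S))))"

lemma trace_E_sums:
  assumes X: "range X \<subseteq> sets borel" "disjoint_family X"
  shows "(\<lambda>n::nat. Re (\<tau> (E (X n)))) sums Re (\<tau> (E (\<Union>n. X n)))"
proof -
  have XB: "X n \<in> sets borel" for n using X by auto
  have pos: "posop (E (X n))" for n by (rule is_projection_posop[OF E_projection[OF XB]])
  have part: "(\<Sum>i<n. E (X i)) \<in> M \<and> posop (\<Sum>i<n. E (X i)) \<and>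
      Re (\<tau> (\<Sum>i<n. E (X i))) = (\<Sum>i<n. Re (\<tau> (E (X i))))" for n
  proof (induction n)
    case 0
    have "posop (0 :: 'a \<Rightarrow>\<^sub>L 'a)" by (simp add: posop_def symop_0 rinner_simps)
    then show ?case using M_closed(4)[OF M_closed(1), of 0] by (simp add: trace_zero)
  next
    case (Suc n)
    then show ?case using pos E_mem[OF XB] by (simp add: M_closed posop_add trace_add)
  qed
  have "(\<lambda>n. Re (\<tau> (\<Sum>i<n. E (X i)))) \<longlonglongrightarrow> Re (\<tau> (E (\<Union>n. X n)))"
  proof (rule trace_monotone_limit)
    show "(\<lambda>n. blinfun_apply (\<Sum>i<n. E (X i)) x) \<longlonglongrightarrow> E (\<Union>n. X n) x" for x
      using E_sums[OF X, of x] by (simp add: sums_def blinfun.sum_left)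
    show "E (\<Union>n. X n) \<in> M" using XB by (intro E_mem) auto
  qed (use part pos in simp_all)
  then show ?thesis by (simp add: sums_def part)
qed

lemma sets_nu [simp, measurable_cong]: "sets \<nu> = sets borel"
  and space_nu [simp]: "space \<nu> = UNIV"
  and emeasure_nu: "S \<in> sets borel \<Longrightarrow> emeasure \<nu> S = ennreal (Re (\<tau> (E S)))"
  and measure_nu: "S \<in> sets borel \<Longrightarrow> measure \<nu> S = Re (\<tau> (E S))"
  and finite_measure_nu: "finite_measure \<nu>"
proof -
  have "0 \<le> Re (\<tau> (E S))" if "S \<in> sets borel" for S
    by (rule trace_nonneg[OF E_mem[OF that] is_projection_posop[OF E_projection[OF that]]])
  moreover have "Re (\<tau> (E {})) = 0" by (simp add: E_empty trace_zero)
  ultimately show "sets \<nu> = sets borel" "space \<nu> = UNIV"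
    "S \<in> sets borel \<Longrightarrow> emeasure \<nu> S = ennreal (Re (\<tau> (E S)))"
    "S \<in> sets borel \<Longrightarrow> measure \<nu> S = Re (\<tau> (E S))" "finite_measure \<nu>"
    unfolding \<nu>_def
    using measure_of_borel[of "\<lambda>S. Re (\<tau> (E S))", OF _ _ trace_E_sums] by blast+
qed

lemma measure_nu_UNIV: "measure \<nu> UNIV = 1"
  by (simp add: measure_nu E_UNIV unit)

lemma integrable_nu:
  assumes "bounded_borel g"
  shows "integrable \<nu> g"
proof -
  obtain C where "\<And>t. \<bar>g t\<bar> \<le> C" using assms by (auto simp: bounded_borel_def)
  moreover have "g \<in> borel_measurable \<nu>" using bounded_borel_measurable[OF assms] by measurable
  ultimately show ?thesis
    by (intro finite_measure.integrable_const_bound[OF finite_measure_nu, of _ C]) auto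
qed

lemma trace_Phi_nonneg:
  assumes "u \<in> borel_measurable borel" "\<And>t. 0 \<le> u t" "\<And>t. u t \<le> C"
  shows "Re (\<tau> (\<Phi> u)) = (\<integral>t. u t \<partial>\<nu>)"
  using assms
proof (induction u arbitrary: C rule: borel_measurable_induct_real)
  case (set S)
  then show ?case by (simp add: Phi_indicator measure_nu)
next
  case (mult u c)
  show ?case
  proof (cases "c = 0")
    case True
    then show ?thesis by (simp add: Phi_const trace_zero)
  next
    case False
    then have le: "u t \<le> C / c" for t
      using mult.hyps(1) mult.prems[of t] by (simp add: pos_le_divide_eq mult.commute)
    moreover have "bounded_borel u"
      using mult.hyps(2,3) le by (intro bounded_borelI[of _ "C / c"]) auto
    ultimately show ?thesis
      using mult.IH[of "C / c"] by (simp add: Phi_scale trace_scaleR Phi_mem)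
  qed
next
  case (add u v)
  have "u t \<le> C" "v t \<le> C" for t
    using add.prems[of t] add.hyps(2)[of t] add.hyps(4)[of t] by linarith+
  moreover from this have "bounded_borel u" "bounded_borel v"
    using add.hyps(1-4) by (auto intro!: bounded_borelI[of _ C])
  ultimately show ?case
    using add.IH[of C] by (simp add: Phi_add trace_add Phi_mem integrable_nu)
next
  case (seq U)
  have inc: "incseq (\<lambda>i. U i t)" for t using seq.hyps(3) by (simp add: incseq_def le_fun_def)
  have lim: "(\<lambda>i. U i t) \<longlonglongrightarrow> u t" for t using seq.hyps(4) by simp
  have leu: "U i t \<le> u t" for i t using incseq_le[OF inc lim] .
  have le: "U i t \<le> C" for i t
    using leu seq.prems by (rule order_trans)
  have ab: "\<bar>U i t\<bar> \<le> C" for i t using le seq.hyps(2) by simp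
  have meas: "u \<in> borel_measurable borel"
    using seq.hyps(1,4) by (intro borel_measurable_LIMSEQ_real[of borel U u]) auto
  have u0: "0 \<le> u t" for t using order_trans[OF seq.hyps(2) leu] .
  have bbU: "bounded_borel (U i)" for i using seq.hyps(1) ab by (rule bounded_borelI)
  have bbu: "bounded_borel u" using meas u0 seq.prems by (intro bounded_borelI[of _ C]) auto
  have pos: "posop (\<Phi> v)" if "bounded_borel v" "\<And>t. 0 \<le> v t" for v
    using that by (simp add: posop_def Phi_symop rinner_Phi)
  have "(\<lambda>i. Re (\<tau> (\<Phi> (U i)))) \<longlonglongrightarrow> Re (\<tau> (\<Phi> u))"
  proof (rule trace_monotone_limit[OF Phi_mem[OF bbU] _ _ Phi_mem[OF bbu]])
    show "posop (\<Phi> (U i))" for i by (rule pos[OF bbU seq.hyps(2)])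
    show "posop (\<Phi> (U (Suc i)) - \<Phi> (U i))" for i
      unfolding Phi_diff[OF bbU bbU, symmetric] using inc
      by (intro pos bounded_borel_diff bbU) (simp add: incseq_Suc_iff)
    \<comment> \<open>The squared distance is the integral of (u - U i)^2 over the scalar measure of
      x, so dominated convergence there gives the strong convergence that normality needs.\<close>
    show "(\<lambda>i. \<Phi> (U i) x) \<longlonglongrightarrow> \<Phi> u x" for x
    proof -
      have "(\<lambda>i. \<integral>t. (u t - U i t)\<^sup>2 \<partial>\<mu> x) \<longlonglongrightarrow> (\<integral>t. 0 \<partial>\<mu> x)"
      proof (rule dominated_convergence_mu)
        show "\<bar>(u t - U i t)\<^sup>2\<bar> \<le> C\<^sup>2" for i t
          using leu[of i t] seq.hyps(2)[of i t] seq.prems[of t]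
          by (simp add: abs_le_square_iff[symmetric])
        show "(\<lambda>i. (u t - U i t)\<^sup>2) \<longlonglongrightarrow> 0" for t
          using tendsto_power[OF tendsto_diff[OF tendsto_const lim], of "u t" t 2] by simp
      qed (use meas seq.hyps(1) in auto)
      then have "(\<lambda>i. (norm (\<Phi> u x - \<Phi> (U i) x))\<^sup>2) \<longlonglongrightarrow> 0"
        by (simp add: norm_Phi[symmetric] bounded_borel_diff bbu bbU Phi_diff blin_simps)
      from tendsto_real_sqrt[OF this] show ?thesis
        by (subst tendsto_dist_iff) (simp add: dist_norm norm_minus_commute)
    qed
  qed
  moreover have "(\<lambda>i. \<integral>t. U i t \<partial>\<nu>) \<longlonglongrightarrow> (\<integral>t. u t \<partial>\<nu>)"
  proof (rule integral_dominated_convergence[where w = "\<lambda>_. C"])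
    show "integrable \<nu> (\<lambda>_. C)" by (rule integrable_nu[OF bounded_borel_const])
    show "u \<in> borel_measurable \<nu>" "\<And>i. U i \<in> borel_measurable \<nu>"
      using meas seq.hyps(1) by measurable
  qed (use ab lim in auto)
  moreover have "Re (\<tau> (\<Phi> (U i))) = (\<integral>t. U i t \<partial>\<nu>)" for i by (rule seq.IH[OF le])
  ultimately show ?case using LIMSEQ_unique by simp
qed

text \<open>The full complex value is needed, since the constraint on f is an equation in the
  complex numbers. The shift by C makes the operator positive, and the trace of a positive operator
  is real.\<close>

lemma trace_Phi:
  assumes u: "bounded_borel u"
  shows "\<tau> (\<Phi> u) = complex_of_real (\<integral>t. u t \<partial>\<nu>)"
proof -
  obtain C where C: "\<And>t. \<bar>u t\<bar> \<le> C" using u by (auto simp: bounded_borel_def)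
  have bb: "bounded_borel (\<lambda>t. u t + C)" by (intro bounded_borel_intros u)
  have nonneg: "0 \<le> u t + C" and le: "u t + C \<le> 2 * C" for t using C[of t] by linarith+
  have "Re (\<tau> (\<Phi> (\<lambda>t. u t + C))) = (\<integral>t. u t + C \<partial>\<nu>)"
    by (rule trace_Phi_nonneg[OF bounded_borel_measurable[OF bb] nonneg le])
  moreover have "posop (\<Phi> (\<lambda>t. u t + C))"
    using nonneg bb by (simp add: posop_def Phi_symop rinner_Phi)
  ultimately have "\<tau> (\<Phi> (\<lambda>t. u t + C)) = complex_of_real (\<integral>t. u t + C \<partial>\<nu>)"
    using trace_real[OF Phi_mem[OF bb]] by (simp add: complex_eq_iff)
  moreover have "\<Phi> (\<lambda>t. u t + C) = \<Phi> u + C *\<^sub>R id_blinfun"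
    by (simp add: Phi_add u bounded_borel_const Phi_const)
  ultimately show ?thesis
    using integrable_nu[OF u] finite_measure.integrable_const[OF finite_measure_nu, of C]
    by (simp add: trace_add trace_scaleR Phi_mem u M_closed unit measure_nu_UNIV)
qed

text \<open>The chosen spectral measure of the integral of g is the pushforward of E, so its trace
  measure is the image of \<nu> under g. With g = \<open>ln\<close> this evaluates the extended
  trace of the possibly unbounded logarithm.\<close>

lemma nn_integral_trace_measure:
  assumes g: "g \<in> borel_measurable borel" and v: "v \<in> borel_measurable borel"
  shows "(\<integral>\<^sup>+ t. v t \<partial>trace_measure \<tau> (spectral_integral E g)) = (\<integral>\<^sup>+ t. v (g t) \<partial>\<nu>)"
proof -
  have eq: "spectral_integral E g = spectral_integral (\<lambda>S. E (g -` S)) (\<lambda>t. t)"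
    using spectral_integral_vimage[OF g, of "\<lambda>t. t"] by simp
  have gS: "g -` S \<in> sets borel" if "S \<in> sets borel" for S
    using measurable_sets[OF g that] by simp
  have "trace_measure \<tau> (spectral_integral E g) =
      measure_of UNIV (sets borel) (\<lambda>S. emeasure (distr \<nu> borel g) S)"
    unfolding trace_measure_def
  proof (rule measure_of_eq)
    fix S :: "real set" assume "S \<in> sigma_sets UNIV (sets borel)"
    then have S: "S \<in> sets borel" using sets.sigma_sets_eq[of "borel :: real measure"] by simp
    have "spectral_measure (spectral_integral E g) S = E (g -` S)"
      using spectral_measure_spec(3)[OF pvm_vimage[OF g] eq S] .
    then show "ennreal (Re (\<tau> (spectral_measure (spectral_integral E g) S))) = emeasure (distr \<nu> borel g) S"
      using g S gS[OF S] by (simp add: emeasure_distr emeasure_nu)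
  qed simp
  also have "\<dots> = distr \<nu> borel g"
    using measure_of_of_measure[of "distr \<nu> borel g"] by simp
  finally show ?thesis using g v by (simp add: nn_integral_distr)
qed

end


subsection \<open>The determinant inequality\<close>

theorem proposition3:
  fixes M :: "('a::complex_hilbert \<Rightarrow>\<^sub>L 'a) set"
    and \<tau> :: "('a \<Rightarrow>\<^sub>L 'a) \<Rightarrow> complex"
    and h :: "'a \<Rightarrow>\<^sub>L 'a"
  assumes "von_neumann_algebra M"
    and "finite_trace M \<tau>" and "faithful M \<tau>" and "normal_on M \<tau>"
    and "\<tau> id_blinfun = 1"
    and "h \<in> M" and "positive_op h" and "log_exists h"
  shows "exp_ereal (ext_trace \<tau> (log_op h))
           \<ge> Inf {ereal (Re (\<tau> (h o\<^sub>L exp_op (re_op f)))) | f. f \<in> M \<and> \<tau> f = 0}"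
    (is "_ \<ge> Inf ?V")
proof -
  define E where "E = spectral_measure (graph_of h)"
  have h: "h \<in> bounded_ops" "posop h" using assms(7) by (simp_all add: positive_op_iff)
  obtain E0 where E0: "pvm E0" "spectral_integral E0 (\<lambda>t. t) = graph_of h"
    "\<And>S C. S \<in> sets borel \<Longrightarrow> commutes C h \<Longrightarrow> commutes C (E0 S)"
    using spectral_theorem[OF h(1) posopD(1)[OF h(2)]] by blast
  note E = spectral_measure_spec[OF E0(1) E0(2)[symmetric], folded E_def]
  have mem: "E S \<in> M" if "S \<in> sets borel" for S
  proof (rule von_neumann_algebra_memI[OF assms(1)])
    show "E S \<in> bounded_ops" using E(1) that by (simp add: pvm_def)
    show "commutes C (E S)" if "C \<in> commutant M" for C
      unfolding E(3)[OF \<open>S \<in> sets borel\<close>]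
      by (intro E0(3) \<open>S \<in> sets borel\<close> commutant_commutes[OF that assms(6)])
  qed
  interpret traced_pvm E M \<tau>
    by unfold_locales (use assms E(1) mem in auto)
  define R where "R = norm h"
  have R: "0 \<le> R" by (simp add: R_def)
  \<comment> \<open>The iterates of h grow at most like powers of its norm, so the growth criterion
    with center 0 places every vector in the range of this interval.\<close>
  have ER: "E {- R..R} = id_blinfun"
  proof (rule blinfun_eqI)
    fix x
    have "(z, h z) \<in> T" for z unfolding E(2)[symmetric] by (auto simp: graph_of_def)
    moreover have "norm ((blinfun_apply h ^^ k) x) \<le> norm x * R ^ k" for k
    proof (induction k)
      case (Suc k)
      have "norm (h ((blinfun_apply h ^^ k) x)) \<le> R * norm ((blinfun_apply h ^^ k) x)"
        unfolding R_def by (rule norm_blinfun)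
      also have "\<dots> \<le> R * (norm x * R ^ k)" using Suc R by (rule mult_left_mono)
      finally show ?case by (simp add: ac_simps)
    qed simp
    ultimately show "E {- R..R} x = id_blinfun x"
      using E_interval_iterates[of "\<lambda>k. (blinfun_apply h ^^ k) x" 0 "norm x" R] R by simp
  qed
  define S where "S = {0<..R}"
  have S: "S \<in> sets borel" by (simp add: S_def)
  have ES: "E S = id_blinfun"
  proof (rule blinfun_eqI)
    fix x
    have "E {0<..} = id_blinfun" using assms(8) by (simp add: log_exists_def E_def)
    moreover have "{- R..R} \<inter> {0<..} = S" by (auto simp: S_def)
    ultimately show "E S x = id_blinfun x"
      using E_Int[of "{- R..R}" "{0<..}" x] ER by simp
  qed
  have AE_S: "AE t in \<nu>. t \<in> S"
  proof (rule AE_I[of _ _ "- S"])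
    have "measure \<nu> (- S) = 0"
      using finite_measure.finite_measure_compl[OF finite_measure_nu, of S] S
      by (simp add: Compl_eq_Diff_UNIV measure_nu_UNIV measure_nu ES unit)
    then show "emeasure \<nu> (- S) = 0"
      by (simp add: finite_measure.emeasure_eq_measure[OF finite_measure_nu])
  qed (use S in auto)
  \<comment> \<open>A globally bounded stand-in for the identity function on the spectrum. Off S it
    is 0, so that ln (q + \<epsilon>) remains bounded on the whole line.\<close>
  define q where "q t = indicator S t * t" for t :: real
  have q: "0 \<le> q t" "q t \<le> R" for t using R by (auto simp: q_def S_def indicator_def)
  have q_meas: "q \<in> borel_measurable borel" unfolding q_def using S by measurable
  have bq: "bounded_borel q" using q q_meas by (intro bounded_borelI[of _ R]) auto
  have hq: "h = \<Phi> q"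
  proof -
    have "graph_of h = graph_of (\<Phi> q)"
      unfolding E(2) q_def by (rule spectral_integral_bounded[OF _ S ES, of _ R]) (auto simp: S_def)
    then show ?thesis by (simp add: graph_of_inject)
  qed
  define \<epsilon> where "\<epsilon> n = inverse (real (Suc n))" for n
  have \<epsilon>: "0 < \<epsilon> n" "\<epsilon> n \<le> 1" "\<epsilon> (Suc n) \<le> \<epsilon> n" for n
    by (auto simp: \<epsilon>_def inverse_le_1_iff)
  have bl: "bounded_borel (\<lambda>t. ln (q t + \<epsilon> n))" for n
  proof (rule bounded_borelI)
    show "(\<lambda>t. ln (q t + \<epsilon> n)) \<in> borel_measurable borel" using q_meas by measurable
    show "\<bar>ln (q t + \<epsilon> n)\<bar> \<le> \<bar>ln (\<epsilon> n)\<bar> + \<bar>ln (R + \<epsilon> n)\<bar>" for t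
    proof -
      have "ln (\<epsilon> n) \<le> ln (q t + \<epsilon> n)" "ln (q t + \<epsilon> n) \<le> ln (R + \<epsilon> n)"
        using q[of t] \<epsilon>(1)[of n] by auto
      then show ?thesis by linarith
    qed
  qed
  define c where "c n = (\<integral>t. ln (q t + \<epsilon> n) \<partial>\<nu>)" for n
  have Inf_le: "Inf ?V \<le> ereal (exp (c n))" for n
  proof -
    define g where "g t = c n - ln (q t + \<epsilon> n)" for t
    have bg: "bounded_borel g" unfolding g_def by (intro bounded_borel_intros bl)
    have f: "\<Phi> g \<in> M" by (rule Phi_mem[OF bg])
    have "(\<integral>t. g t \<partial>\<nu>) = 0"
      unfolding g_def using integrable_nu[OF bl] integrable_nu[OF bounded_borel_const]
      by (simp add: measure_nu_UNIV c_def)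
    then have f0: "\<tau> (\<Phi> g) = 0" by (simp add: trace_Phi[OF bg])
    have "adj (\<Phi> g) = \<Phi> g"
      using adj_eq_iff_symop[OF Phi_bounded_ops[OF bg]] Phi_symop[OF bg] by simp
    then have re: "re_op (\<Phi> g) = \<Phi> g" by (simp add: re_op_def scaleR_2[symmetric])
    have be: "bounded_borel (\<lambda>t. q t * exp (g t))"
      by (intro bounded_borel_intros bq exp_op_Phi(2) bg)
    have "h o\<^sub>L exp_op (re_op (\<Phi> g)) = \<Phi> (\<lambda>t. q t * exp (g t))"
      unfolding re exp_op_Phi(1)[OF bg] hq
      by (rule blinfun_eqI) (simp add: Phi_mult[OF bq exp_op_Phi(2)[OF bg]])
    then have "Re (\<tau> (h o\<^sub>L exp_op (re_op (\<Phi> g)))) = (\<integral>t. q t * exp (g t) \<partial>\<nu>)"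
      by (simp add: trace_Phi[OF be])
    also have "\<dots> \<le> (\<integral>t. exp (c n) \<partial>\<nu>)"
    proof (intro integral_mono integrable_nu be bounded_borel_const)
      fix t
      have "q t + \<epsilon> n > 0" using q(1)[of t] \<epsilon>(1)[of n] by linarith
      then have "q t * exp (g t) = exp (c n) * (q t / (q t + \<epsilon> n))"
        by (simp add: g_def exp_diff)
      also have "\<dots> \<le> exp (c n) * 1"
        using \<open>q t + \<epsilon> n > 0\<close> \<epsilon>(1)[of n] by (intro mult_left_mono) auto
      finally show "q t * exp (g t) \<le> exp (c n)" by simp
    qed
    also have "\<dots> = exp (c n)" by (simp add: measure_nu_UNIV)
    finally have "ereal (Re (\<tau> (h o\<^sub>L exp_op (re_op (\<Phi> g))))) \<le> ereal (exp (c n))" by simp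
    moreover have "Inf ?V \<le> ereal (Re (\<tau> (h o\<^sub>L exp_op (re_op (\<Phi> g)))))"
      using f f0 by (intro Inf_lower) blast
    ultimately show ?thesis by (rule order_trans[rotated])
  qed
  define L where "L = ext_trace \<tau> (log_op h)"
  have L: "L = enn2ereal (\<integral>\<^sup>+ t. ennreal (ln t) \<partial>\<nu>) - enn2ereal (\<integral>\<^sup>+ t. ennreal (- ln t) \<partial>\<nu>)"
  proof -
    have "log_op h = spectral_integral E ln"
      unfolding log_op_def E(2) by (subst fun_calc_spectral_integral) auto
    then show ?thesis by (simp add: L_def ext_trace_def nn_integral_trace_measure)
  qed
  \<comment> \<open>Convergence of c n to L is replaced by this one-sided statement: a common lower
    bound of all c n is at most L. It avoids deciding beforehand whether L is -\<infinity>; a finite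
    b forces \<open>ln\<close> to be integrable.\<close>
  have lower: "ereal b \<le> L" if b: "\<And>n. b \<le> c n" for b
  proof -
    \<comment> \<open>As q is at most R and \<epsilon> at most 1, K dominates all the logarithms, so
      K - ln (q + \<epsilon>) is nonnegative and increases with n: monotone convergence
      applies.\<close>
    define K where "K = ln (R + 1)"
    have u_nonneg: "0 \<le> K - ln (q t + \<epsilon> n)" for n t
      using q[of t] \<epsilon>[of n] by (simp add: K_def)
    have "(\<integral>\<^sup>+ t. ennreal (K - ln t) \<partial>\<nu>) = (\<integral>\<^sup>+ t. (SUP n. ennreal (K - ln (q t + \<epsilon> n))) \<partial>\<nu>)"
    proof (rule nn_integral_cong_AE)
      show "AE t in \<nu>. ennreal (K - ln t) = (SUP n. ennreal (K - ln (q t + \<epsilon> n)))"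
        using AE_S
      proof eventually_elim
        case (elim t)
        then have t: "0 < t" "q t = t" by (auto simp: S_def q_def)
        have "incseq (\<lambda>n. ennreal (K - ln (q t + \<epsilon> n)))"
          using q(1)[of t] \<epsilon> by (intro incseq_SucI ennreal_leI) (simp add: add_nonneg_pos)
        then have "(\<lambda>n. ennreal (K - ln (q t + \<epsilon> n))) \<longlonglongrightarrow> (SUP n. ennreal (K - ln (q t + \<epsilon> n)))"
          by (rule LIMSEQ_SUP)
        moreover have "\<epsilon> \<longlonglongrightarrow> 0" unfolding \<epsilon>_def by (rule LIMSEQ_inverse_real_of_nat)
        then have "(\<lambda>n. K - ln (q t + \<epsilon> n)) \<longlonglongrightarrow> K - ln (t + 0)"
          unfolding t(2) using t(1) by (intro tendsto_intros) auto
        then have "(\<lambda>n. ennreal (K - ln (q t + \<epsilon> n))) \<longlonglongrightarrow> ennreal (K - ln t)"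
          by (intro tendsto_ennrealI) simp
        ultimately show ?case by (rule LIMSEQ_unique[rotated])
      qed
    qed
    also have "\<dots> = (SUP n. \<integral>\<^sup>+ t. ennreal (K - ln (q t + \<epsilon> n)) \<partial>\<nu>)"
    proof (rule nn_integral_monotone_convergence_SUP)
      show "incseq (\<lambda>n t. ennreal (K - ln (q t + \<epsilon> n)))"
      proof (intro incseq_SucI le_funI ennreal_leI)
        fix n t
        show "K - ln (q t + \<epsilon> n) \<le> K - ln (q t + \<epsilon> (Suc n))"
          using q(1)[of t] \<epsilon>(3)[of n] \<epsilon>(1)[of "Suc n"] by (simp add: add_nonneg_pos)
      qed
      show "(\<lambda>t. ennreal (K - ln (q t + \<epsilon> n))) \<in> borel_measurable \<nu>" for n
        using q_meas by measurable
    qed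
    also have "\<dots> \<le> ennreal (K - b)"
    proof (rule SUP_least)
      fix n
      have "(\<integral>\<^sup>+ t. ennreal (K - ln (q t + \<epsilon> n)) \<partial>\<nu>) = ennreal (\<integral>t. K - ln (q t + \<epsilon> n) \<partial>\<nu>)"
        using u_nonneg
        by (intro nn_integral_eq_integral integrable_nu bounded_borel_intros bl) auto
      also have "(\<integral>t. K - ln (q t + \<epsilon> n) \<partial>\<nu>) = K - c n"
        using integrable_nu[OF bl] integrable_nu[OF bounded_borel_const]
        by (simp add: measure_nu_UNIV c_def)
      finally show "(\<integral>\<^sup>+ t. ennreal (K - ln (q t + \<epsilon> n)) \<partial>\<nu>) \<le> ennreal (K - b)"
        using b[of n] by (simp add: ennreal_leI)
    qed
    finally have W: "(\<integral>\<^sup>+ t. ennreal (K - ln t) \<partial>\<nu>) \<le> ennreal (K - b)" .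
    have AE_nonneg: "AE t in \<nu>. 0 \<le> K - ln t"
      using AE_S by eventually_elim (auto simp: S_def K_def)
    have int: "integrable \<nu> (\<lambda>t. K - ln t)"
    proof (rule integrableI_nonneg)
      show "(\<lambda>t. K - ln t) \<in> borel_measurable \<nu>" by measurable
      show "(\<integral>\<^sup>+ t. ennreal (K - ln t) \<partial>\<nu>) < \<infinity>" using W by (auto intro: le_less_trans)
    qed (rule AE_nonneg)
    \<comment> \<open>\<open>ennreal\<close> sends negative numbers to 0, so the estimate by
      \<open>ennreal (K - b)\<close> can be read as one between reals only if K - b is
      nonnegative.\<close>
    have "b \<le> K"
    proof (rule ccontr)
      assume "\<not> b \<le> K"
      then have "K < c 0" using b[of 0] by simp
      moreover have "0 \<le> (\<integral>t. K - ln (q t + \<epsilon> 0) \<partial>\<nu>)" using u_nonneg by simp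
      ultimately show False
        using integrable_nu[OF bl] integrable_nu[OF bounded_borel_const]
        by (simp add: measure_nu_UNIV c_def)
    qed
    then have "(\<integral>t. K - ln t \<partial>\<nu>) \<le> K - b"
      using W nn_integral_eq_integral[OF int AE_nonneg] by simp
    moreover have intK: "integrable \<nu> (\<lambda>t. K)" by (rule integrable_nu[OF bounded_borel_const])
    have int_ln: "integrable \<nu> ln"
      using Bochner_Integration.integrable_diff[OF intK int] by simp
    ultimately have "b \<le> (\<integral>t. ln t \<partial>\<nu>)"
      using intK by (simp add: measure_nu_UNIV)
    also have "ereal (\<integral>t. ln t \<partial>\<nu>) = L"
    proof -
      have fin: "(\<integral>\<^sup>+ t. ennreal (ln t) \<partial>\<nu>) < \<infinity>" "(\<integral>\<^sup>+ t. ennreal (- ln t) \<partial>\<nu>) < \<infinity>"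
        using int_ln by (auto simp: real_integrable_def less_top)
      then obtain x y where xy: "0 \<le> x" "0 \<le> y" "(\<integral>\<^sup>+ t. ennreal (ln t) \<partial>\<nu>) = ennreal x"
        "(\<integral>\<^sup>+ t. ennreal (- ln t) \<partial>\<nu>) = ennreal y"
        using less_top_ennreal by (metis infinity_ennreal_def)
      then show ?thesis
        unfolding L real_lebesgue_integral_def[OF int_ln] by (simp add: enn2ereal_ennreal)
    qed
    finally show ?thesis by simp
  qed
  \<comment> \<open>Contrapositive use of \<open>lower\<close>: if b exceeds L, it is not a common
    lower bound, so some c n lies below b.\<close>
  have approx: "Inf ?V \<le> ereal (exp b)" if "L < ereal b" for b
  proof -
    obtain n where "c n < b" using lower[of b] \<open>L < ereal b\<close> by (meson not_le)
    then have "ereal (exp (c n)) \<le> ereal (exp b)" by simp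
    with Inf_le[of n] show ?thesis by (rule order_trans)
  qed
  have "Inf ?V \<le> exp_ereal L"
  proof (cases L)
    case (real l)
    have "(\<lambda>n. ereal (exp (l + inverse (real (Suc n))))) \<longlonglongrightarrow> ereal (exp (l + 0))"
      by (intro tendsto_intros LIMSEQ_inverse_real_of_nat)
    moreover have "Inf ?V \<le> ereal (exp (l + inverse (real (Suc n))))" for n
      by (rule approx) (simp add: real)
    ultimately have "Inf ?V \<le> ereal (exp (l + 0))" by (intro LIMSEQ_le_const) blast+
    then show ?thesis by (simp add: real)
  next
    case MInf
    have "(\<lambda>n. exp (- real n)) \<longlonglongrightarrow> 0"
      by (rule filterlim_compose[OF exp_at_bot filterlim_compose[OF filterlim_uminus_at_bot_at_top filterlim_real_sequentially]])
    then have "(\<lambda>n. ereal (exp (- real n))) \<longlonglongrightarrow> ereal 0" by (rule tendsto_ereal)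
    moreover have "Inf ?V \<le> ereal (exp (- real n))" for n
      by (rule approx) (simp add: MInf)
    ultimately have "Inf ?V \<le> ereal 0" by (intro LIMSEQ_le_const) blast+
    then show ?thesis
      using exp_ereal.simps(3) by (simp add: MInf zero_ereal_def)
  next
    case PInf
    then show ?thesis using exp_ereal.simps(2) by simp
  qed
  then show ?thesis by (simp add: L_def)
qed

end
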